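(* For every $\beta\ge0$ and every $\rho\in[0,1]$, $\mathbb P(d\omega)$-almost surely the limit \[ \lim_{N\to\infty,\ m/N\to\rho}\ \frac1N\log \mathbf E\Big[\exp\Big(\beta\sum_{j=1}^N\omega_j\delta_j\Big)\mathbf 1_{\tau_m=N}\Big]=:\textsc{g}(\beta,\rho) \] exists, and $\textsc{g}(\beta,\rho)\in\mathbb R$ is non-random. Moreover $\textsc{g}(\beta,\cdot)$ is concave on $[0,1]$, $\lim_{\rho\searrow0}\textsc{g}(\beta,\rho)=\textsc{g}(\beta,0)=0$, $\lim_{\rho\nearrow1}\textsc{g}(\beta,\rho)=\textsc{g}(\beta,1)=\log K(1)$, and $\lim_{\rho\nearrow1}\partial_\rho\textsc{g}(\beta,\rho)=-\infty$ (where $\partial_\rho$ denotes a one-sided derivative, which exists by concavity). Also, for every $\beta\ge0$ and $h\in\mathbb R$ the limit \[ \lim_{N\to\infty}\frac1N\log Z^\Psi_{N,\omega,\beta,h}=:\textsc{f}_H(\beta,h) \] exists $\mathbb P(d\omega)$-a.s. and in $\mathbb L^1$, $\textsc{f}_H(\beta,h)\in\mathbb R$ is non-random, $\textsc{f}_H(\beta,\cdot)$ is non-decreasing and convex, and \[ \textsc{f}_H(\beta,h)=\sup_{\rho\in[0,1]}\big(h\rho+H(\rho)+\textsc{g}(\beta,\rho)\big),\qquad \textsc{g}(\beta,\rho)=\inf_{h\in\mathbb R}\big(\textsc{f}_H(\beta,h)-\rho h-H(\rho)\big). \]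
   Context: Let $\tau=(\tau_j)_{j\ge0}$ be a renewal process with $\tau_0=0$ and i.i.d. increments $\eta_j=\tau_j-\tau_{j-1}$ with values in $\mathbb N=\{1,2,\dots\}$, law $\mathbf P$, expectation $\mathbf E$. Let $K(n)=\mathbf P(\eta_1=n)$; assume $K(n)>0$ for all $n\in\mathbb N$ and $K(n)\sim C_K n^{-(1+\alpha)}$ as $n\to\infty$, for some $\alpha>0$, $C_K>0$. Identify $\tau$ with the random set $\{\tau_0,\tau_1,\dots\}$ and set $\delta_n=\mathbf 1_{n\in\tau}$. Let $\omega=(\omega_n)_{n\in\mathbb N}$ be i.i.d. with law $\mathbb P$, independent of $\tau$, with $\lambda(s)=\log\mathbb E[e^{s\omega_1}]<\infty$ for all $s\in\mathbb R$, $\mathbb E[\omega_1]=0$, $\mathbb E[\omega_1^2]=1$. Let $\Psi(m,N)$, $N\in\mathbb N$, $m\in\{1,\dots,N\}$, be of the form $\Psi(m,N)=Q(m,N)\exp(NH(m/N))$ where: (i) $H:[0,1]\to\mathbb R\cup\{-\infty\}$ is concave, real analytic in $(0,1)$ and continuous on $[0,1]$ (allowing the values $H(0)=-\infty$ and/or $H(1)=-\infty$); (ii) $Q(m,N)\ge0$; for every $b>0$ there is $c>0$ with $Q(m,N)\le c\,e^{bN}$ for all $N$ and $m\le N$; and for every $0<u<v<1$ and $b>0$ there is $c>0$ with $Q(m,N)\ge c\,e^{-bN}$ whenever $m/N\in[u,v]$. For $N\in\mathbb N$, $\beta\ge0$, $h\in\mathbb R$, define \[ Z^\Psi_{N,\omega,\beta,h}=\mathbf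 E\Big[\exp\Big(\sum_{j=1}^N(\beta\omega_j+h)\delta_j\Big)\Psi\Big(\sum_{j=1}^N\delta_j,N\Big)\delta_N\Big]. \]
   Formalization: The formula g(β,ρ) = inf_h (f_H(β,h) − ρh − H(ρ)) is stated only for ρ in [0,1] with H(ρ) > −∞; at an endpoint where H(ρ) = −∞ the right side is +∞ while g(β,ρ) is finite, so the formula fails there. *)

theory Defs
  imports "HOL-Probability.Probability" "HOL-Library.Landau_Symbols"
begin

text \<open>Renewal process: the increments eta_1, eta_2, ... are represented by a sample
  eta :: nat => nat, where eta i is the (i+1)-th increment; they are i.i.d. with law Kp
  under the infinite product measure renewal_law Kp.  Then tau_j = eta_1 + ... + eta_j.\<close>

definition ren_tau :: "(nat \<Rightarrow> nat) \<Rightarrow> nat \<Rightarrow> nat" where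
  "ren_tau \<eta> j = (\<Sum>i<j. \<eta> i)"

definition ren_delta :: "(nat \<Rightarrow> nat) \<Rightarrow> nat \<Rightarrow> nat" where
  "ren_delta \<eta> n = (if n \<in> range (ren_tau \<eta>) then 1 else 0)"

definition renewal_law :: "nat pmf \<Rightarrow> (nat \<Rightarrow> nat) measure" where
  "renewal_law Kp = PiM UNIV (\<lambda>_. measure_pmf Kp)"

text \<open>Disorder: omega :: nat => real, i.i.d. coordinates with law mu (omega 0 is unused).\<close>

definition disorder_law :: "real measure \<Rightarrow> (nat \<Rightarrow> real) measure" where
  "disorder_law \<mu> = PiM UNIV (\<lambda>_. \<mu>)"

definition constrained_pf ::
  "nat pmf \<Rightarrow> real \<Rightarrow> (nat \<Rightarrow> real) \<Rightarrow> nat \<Rightarrow> nat \<Rightarrow> real" where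
  "constrained_pf Kp \<beta> \<omega> N m =
     (\<integral>\<eta>. exp (\<beta> * (\<Sum>j=1..N. \<omega> j * real (ren_delta \<eta> j)))
            * indicator {\<eta>. ren_tau \<eta> m = N} \<eta> \<partial>renewal_law Kp)"

text \<open>Psi(m,N) = Q(m,N) exp(N H(m/N)), with H valued in R union {-infinity}
  (exp(-infinity) = 0).\<close>

definition Psi :: "(nat \<Rightarrow> nat \<Rightarrow> real) \<Rightarrow> (real \<Rightarrow> ereal) \<Rightarrow> nat \<Rightarrow> nat \<Rightarrow> real" where
  "Psi Q H m N = Q m N *
     (if H (real m / real N) = -\<infinity> then 0
      else exp (real N * real_of_ereal (H (real m / real N))))"

definition Z_Psi ::
  "nat pmf \<Rightarrow> (nat \<Rightarrow> nat \<Rightarrow> real) \<Rightarrow> (real \<Rightarrow> ereal) \<Rightarrow> real \<Rightarrow> real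
     \<Rightarrow> (nat \<Rightarrow> real) \<Rightarrow> nat \<Rightarrow> real" where
  "Z_Psi Kp Q H \<beta> h \<omega> N =
     (\<integral>\<eta>. exp (\<Sum>j=1..N. (\<beta> * \<omega> j + h) * real (ren_delta \<eta> j))
            * Psi Q H (\<Sum>j=1..N. ren_delta \<eta> j) N
            * real (ren_delta \<eta> N) \<partial>renewal_law Kp)"

definition real_analytic_on :: "(real \<Rightarrow> real) \<Rightarrow> real set \<Rightarrow> bool" where
  "real_analytic_on f S \<longleftrightarrow>
     (\<forall>x\<in>S. \<exists>r>0. \<exists>c::nat \<Rightarrow> real.
        \<forall>y. \<bar>y - x\<bar> < r \<longrightarrow> (\<lambda>n. c n * (y - x) ^ n) sums f y)"

definition ereal_concave_on :: "real set \<Rightarrow> (real \<Rightarrow> ereal) \<Rightarrow> bool" where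
  "ereal_concave_on S H \<longleftrightarrow>
     (\<forall>x\<in>S. \<forall>y\<in>S. \<forall>t\<in>{0..1::real}.
        ereal t * H x + ereal (1 - t) * H y \<le> H (t * x + (1 - t) * y))"

end

theory Submission
  imports Defs
begin

text \<open>
  Decomposing according to the first renewal gives a recursion for the partition function
  \<open>Z\<^sub>N\<^sub>,\<^sub>m\<close> constrained to \<open>\<tau>\<^sub>m = N\<close>, from which one reads off that \<open>ln Z\<^sub>N\<^sub>,\<^sub>m\<close> is
  \<open>\<beta>\<close>-Lipschitz in every \<open>\<omega>\<^sub>j\<close> and that \<open>Z\<close> is supermultiplicative. Integrating out one coordinate
  at a time, the Lipschitz property yields exponential concentration of \<open>ln Z\<^sub>N\<^sub>,\<^sub>m\<close> around its mean
  \<open>a(N,m)\<close>; the bound survives a union over \<open>m \<le> N\<close>, so by Borel-Cantelli \<open>ln Z\<^sub>N\<^sub>,\<^sub>m\<close> may be replaced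
  by \<open>a(N,m)\<close> up to \<open>o(N)\<close>, uniformly in \<open>m\<close>. The array \<open>a\<close> is superadditive, so a Fekete argument gives \<open>a(N,m)/N \<rightarrow> g(\<rho>)\<close> along
  \<open>m/N \<rightarrow> \<rho> \<in> (0,1)\<close> and concavity of \<open>g\<close>; at \<open>\<rho> = 0\<close> and \<open>\<rho> = 1\<close> the limit follows from explicit
  bounds. Jensen's inequality gives \<open>g(1 - 1/q) \<ge> ln P(\<tau>\<^sub>q\<^sub>-\<^sub>1 = q)/q\<close>, and the entropy \<open>ln (q - 1)\<close> of the
  position of the only gap of size 2 makes the slope of \<open>g\<close> at 1 infinite. Finally
  \<open>Z\<^sup>\<Psi>\<close> is a sum of \<open>N\<close> terms \<open>e\<^sup>h\<^sup>m \<Psi>(m,N) Z\<^sub>N\<^sub>,\<^sub>m\<close>, so Laplace's principle gives \<open>f\<close> as a Legendre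
  transform, which is inverted by concavity and upper semicontinuity of \<open>H + g\<close>.
\<close>

section \<open>Concentration for coordinatewise Lipschitz functions\<close>

lemma exp_le_quadratic: "exp (y::real) \<le> 1 + y + y\<^sup>2 * exp \<bar>y\<bar>"
proof (cases "y \<ge> 0")
  case True
  have e: "exp y - 1 \<le> y * exp y"
  proof -
    have "(1 - y) * exp y \<le> exp (-y) * exp y"
      using exp_ge_add_one_self[of "-y"] by (intro mult_right_mono) auto
    then show ?thesis by (simp add: exp_minus algebra_simps)
  qed
  have "y * (exp y - 1) \<le> y * (y * exp y)"
    using e True by (intro mult_left_mono)
  with e True show ?thesis by (simp add: algebra_simps power2_eq_square)
next
  case False
  define z where "z = - y"
  have z: "z > 0" using False by (simp add: z_def)
  have "1 \<le> (1 + z) * (1 - z + z\<^sup>2)"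
    using z by (simp add: algebra_simps power2_eq_square)
  also have "\<dots> \<le> exp z * (1 - z + z\<^sup>2)"
  proof (rule mult_right_mono)
    show "1 + z \<le> exp z" by (rule exp_ge_add_one_self)
    have "0 \<le> (z - 1/2)\<^sup>2 + 3/4" by simp
    also have "\<dots> = 1 - z + z\<^sup>2" by (simp add: power2_eq_square algebra_simps)
    finally show "0 \<le> 1 - z + z\<^sup>2" .
  qed
  finally have "exp (-z) \<le> 1 - z + z\<^sup>2"
    by (simp add: exp_minus field_simps)
  also have "\<dots> \<le> 1 - z + z\<^sup>2 * exp z"
    using z by (simp add: mult_le_cancel_left1)
  finally show ?thesis using False by (simp add: z_def)
qed

lemma borel_measurable_lipschitz:
  fixes G :: "real \<Rightarrow> real"
  assumes L: "\<And>x y. \<bar>G x - G y\<bar> \<le> b * \<bar>x - y\<bar>" and b: "b \<ge> 0"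
  shows "G \<in> borel_measurable borel"
proof -
  have "b-lipschitz_on UNIV G" using L b by (intro lipschitz_onI) (auto simp: dist_real_def)
  then show ?thesis by (intro borel_measurable_continuous_onI lipschitz_on_continuous_on)
qed

lemma summable_Suc_exp:
  fixes k :: real
  assumes "k > 0"
  shows "summable (\<lambda>N. real (Suc N) * (B * exp (- k * real N)))"
proof -
  have s: "summable (\<lambda>N. real (Suc N) * exp (- k * real N))"
  proof (rule summable_comparison_test')
    show "summable (\<lambda>N. (2 / k + 1) * exp (- (k / 2)) ^ N)"
      using assms by (intro summable_mult summable_geometric) simp
    fix N :: nat
    have 1: "k / 2 * real N \<le> exp (k / 2 * real N)"
      using exp_ge_add_one_self[of "k / 2 * real N"] by linarith
    have "real N \<le> 2 / k * exp (k / 2 * real N)"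
      using 1 assms by (simp add: field_simps)
    moreover have "1 \<le> exp (k / 2 * real N)" using assms by simp
    ultimately have "real (Suc N) \<le> (2 / k + 1) * exp (k / 2 * real N)"
      unfolding distrib_right of_nat_Suc mult_1 by linarith
    then have "real (Suc N) * exp (- k * real N) \<le> (2 / k + 1) * exp (k / 2 * real N) * exp (- k * real N)"
      by (intro mult_right_mono) auto
    also have "\<dots> = (2 / k + 1) * exp (- (k / 2)) ^ N"
      by (simp add: exp_of_nat_mult[symmetric] exp_add[symmetric] algebra_simps)
    finally show "norm (real (Suc N) * exp (- k * real N)) \<le> (2 / k + 1) * exp (- (k / 2)) ^ N"
      by simp
  qed
  show ?thesis using summable_mult[OF s, of B] by (simp add: algebra_simps)
qed

context sequence_space
begin

lemma nn_integral_case_nat: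
  assumes [measurable]: "f \<in> borel_measurable S"
  shows "(\<integral>\<^sup>+\<omega>. f \<omega> \<partial>S) = (\<integral>\<^sup>+x. \<integral>\<^sup>+\<omega>. f (case_nat x \<omega>) \<partial>S \<partial>M)"
proof -
  have "(\<integral>\<^sup>+\<omega>. f \<omega> \<partial>S) = (\<integral>\<^sup>+\<omega>. f \<omega> \<partial>distr (M \<Otimes>\<^sub>M S) S (\<lambda>(s, \<omega>). case_nat s \<omega>))"
    by (simp add: PiM_iter)
  also have "\<dots> = (\<integral>\<^sup>+X. f ((\<lambda>(s, \<omega>). case_nat s \<omega>) X) \<partial>(M \<Otimes>\<^sub>M S))"
    by (rule nn_integral_distr) auto
  also have "\<dots> = (\<integral>\<^sup>+x. \<integral>\<^sup>+\<omega>. f ((\<lambda>(s, \<omega>). case_nat s \<omega>) (x, \<omega>)) \<partial>S \<partial>M)"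
    by (subst P.nn_integral_fst) simp_all
  finally show ?thesis by simp
qed

lemma integral_case_nat:
  fixes f :: "(nat \<Rightarrow> 'a) \<Rightarrow> real"
  assumes f: "integrable S f"
  shows "(\<integral>\<omega>. f \<omega> \<partial>S) = (\<integral>x. \<integral>\<omega>. f (case_nat x \<omega>) \<partial>S \<partial>M)"
proof -
  interpret pair: pair_sigma_finite M S ..
  have [measurable]: "f \<in> borel_measurable S" using f by auto
  have i: "integrable (M \<Otimes>\<^sub>M S) (\<lambda>X. f ((\<lambda>(s, \<omega>). case_nat s \<omega>) X))"
    using f by (subst (asm) PiM_iter[symmetric], subst (asm) integrable_distr_eq) auto
  have "(\<integral>\<omega>. f \<omega> \<partial>S) = (\<integral>\<omega>. f \<omega> \<partial>distr (M \<Otimes>\<^sub>M S) S (\<lambda>(s, \<omega>). case_nat s \<omega>))"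
    by (simp add: PiM_iter)
  also have "\<dots> = (\<integral>X. f ((\<lambda>(s, \<omega>). case_nat s \<omega>) X) \<partial>(M \<Otimes>\<^sub>M S))"
    by (rule integral_distr) auto
  also have "\<dots> = (\<integral>x. \<integral>\<omega>. f ((\<lambda>(s, \<omega>). case_nat s \<omega>) (x, \<omega>)) \<partial>S \<partial>M)"
    using i by (subst pair.integral_fst'[symmetric]) (simp_all add: case_prod_beta')
  finally show ?thesis by simp
qed

lemma distr_shift: "distr S S (\<lambda>\<omega> j. \<omega> (j + k)) = S"
proof (induction k)
  case 0
  show ?case by (simp add: distr_id)
next
  case (Suc k)
  have m[measurable]: "(\<lambda>\<omega> j. \<omega> (j + n)) \<in> measurable S S" for n
    by (rule measurable_PiM_single') (auto simp: space_PiM)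
  have "distr S S (\<lambda>\<omega> j. \<omega> (Suc j)) = S"
  proof (rule measure_eqI)
    fix A assume A: "A \<in> sets (distr S S (\<lambda>\<omega> j. \<omega> (Suc j)))"
    then have [measurable]: "A \<in> sets S" by simp
    have [measurable]: "(\<lambda>\<omega> j. \<omega> (Suc j)) \<in> measurable S S" using m[of 1] by simp
    have "emeasure (distr S S (\<lambda>\<omega> j. \<omega> (Suc j))) A = (\<integral>\<^sup>+\<omega>. indicator A (\<lambda>j. \<omega> (Suc j)) \<partial>S)"
      by (subst nn_integral_indicator[symmetric], simp) (subst nn_integral_distr, auto)
    also have "\<dots> = (\<integral>\<^sup>+x. \<integral>\<^sup>+\<omega>. indicator A \<omega> \<partial>S \<partial>M)"
      by (subst nn_integral_case_nat) auto
    also have "\<dots> = emeasure S A"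
      by (simp add: M.emeasure_space_1)
    finally show "emeasure (distr S S (\<lambda>\<omega> j. \<omega> (Suc j))) A = emeasure S A" .
  qed simp
  then have "distr S S (\<lambda>\<omega> j. \<omega> (j + k)) = distr (distr S S (\<lambda>\<omega> j. \<omega> (Suc j))) S (\<lambda>\<omega> j. \<omega> (j + k))"
    by simp
  also have "\<dots> = distr S S (\<lambda>\<omega> j. \<omega> (j + Suc k))"
    using m[of 1] by (subst distr_distr) (auto simp: comp_def)
  finally show ?case using Suc by simp
qed

end

definition coord_lipschitz :: "real \<Rightarrow> nat \<Rightarrow> ((nat \<Rightarrow> real) \<Rightarrow> real) \<Rightarrow> bool" where
  "coord_lipschitz b n F \<longleftrightarrow> (\<forall>\<omega> \<omega>'. F \<omega> - F \<omega>' \<le> b * (\<Sum>j<n. \<bar>\<omega> j - \<omega>' j\<bar>))"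

lemma coord_lipschitz_abs:
  assumes "coord_lipschitz b n F"
  shows "\<bar>F \<omega> - F \<omega>'\<bar> \<le> b * (\<Sum>j<n. \<bar>\<omega> j - \<omega>' j\<bar>)"
  using assms[unfolded coord_lipschitz_def, rule_format, of \<omega> \<omega>']
    assms[unfolded coord_lipschitz_def, rule_format, of \<omega>' \<omega>]
  by (simp add: abs_minus_commute abs_le_iff)

lemma coord_lipschitz_case_nat:
  assumes "coord_lipschitz b (Suc n) F"
  shows "coord_lipschitz b n (\<lambda>\<omega>. F (case_nat x \<omega>))"
  unfolding coord_lipschitz_def
proof (intro allI)
  fix \<omega> \<omega>'
  show "F (case_nat x \<omega>) - F (case_nat x \<omega>') \<le> b * (\<Sum>j<n. \<bar>\<omega> j - \<omega>' j\<bar>)"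
    using assms[unfolded coord_lipschitz_def, rule_format, of "case_nat x \<omega>" "case_nat x \<omega>'"]
    by (simp add: sum.lessThan_Suc_shift del: sum.lessThan_Suc)
qed

locale iid_disorder = prob_space \<mu> for \<mu> :: "real measure" +
  assumes sets_mu[measurable_cong]: "sets \<mu> = sets borel"
    and expmom: "\<And>s. integrable \<mu> (\<lambda>x. exp (s * x))"
    and mean: "(\<integral>x. x \<partial>\<mu>) = 0"
    and var: "(\<integral>x. x ^ 2 \<partial>\<mu>) = 1"
begin

abbreviation disorder :: "(nat \<Rightarrow> real) measure" (\<open>\<P>\<close>) where "\<P> \<equiv> disorder_law \<mu>"

sublocale seq: sequence_space \<mu> ..

lemma space_mu[simp]: "space \<mu> = UNIV"
  using sets_eq_imp_space_eq[OF sets_mu] by simp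

lemma prob_UNIV[simp]: "prob UNIV = 1"
  using prob_space by simp

lemma integrable_exp_abs: "integrable \<mu> (\<lambda>x. exp (s * \<bar>x\<bar>))"
proof (rule Bochner_Integration.integrable_bound)
  show "integrable \<mu> (\<lambda>x. exp (s * x) + exp ((-s) * x))"
    by (intro Bochner_Integration.integrable_add expmom)
  show "AE x in \<mu>. norm (exp (s * \<bar>x\<bar>)) \<le> norm (exp (s * x) + exp ((-s) * x))"
  proof (rule AE_I2)
    fix x
    have "norm (exp (s * x) + exp ((-s) * x)) = exp (s * x) + exp ((-s) * x)"
      by (simp add: add_nonneg_nonneg)
    then show "norm (exp (s * \<bar>x\<bar>)) \<le> norm (exp (s * x) + exp ((-s) * x))"
      by (cases "x \<ge> 0") simp_all
  qed
qed simp

lemma integrable_sq: "integrable \<mu> (\<lambda>x. x\<^sup>2)"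
  using var not_integrable_integral_eq[of \<mu> "\<lambda>x. x\<^sup>2"] by auto

lemma integrable_id: "integrable \<mu> (\<lambda>x. x)"
proof (rule Bochner_Integration.integrable_bound)
  show "integrable \<mu> (\<lambda>x. 1 + x\<^sup>2)"
    by (intro Bochner_Integration.integrable_add integrable_sq) simp
  have "\<bar>x\<bar> \<le> 1 + x\<^sup>2" for x :: real
    using zero_le_power2[of "\<bar>x\<bar> - 1/2"] by (simp add: power2_eq_square algebra_simps)
  then show "AE x in \<mu>. norm x \<le> norm (1 + x\<^sup>2)"
    by (auto intro: order_trans[OF _ abs_ge_self])
qed simp

lemma disorder_component:
  fixes f :: "real \<Rightarrow> real"
  assumes "integrable \<mu> f"
  shows "integrable \<P> (\<lambda>\<omega>. f (\<omega> j))"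
    and "(\<integral>\<omega>. f (\<omega> j) \<partial>\<P>) = (\<integral>x. f x \<partial>\<mu>)"
proof -
  have d: "distr \<P> \<mu> (\<lambda>\<omega>. \<omega> j) = \<mu>"
    unfolding disorder_law_def by (rule distr_PiM_component) (auto intro: prob_space_axioms)
  have [measurable]: "f \<in> borel_measurable \<mu>" using assms by auto
  have m[measurable]: "(\<lambda>\<omega>. \<omega> j) \<in> measurable \<P> \<mu>"
    unfolding disorder_law_def by measurable
  show "integrable \<P> (\<lambda>\<omega>. f (\<omega> j))"
    using assms by (subst (asm) d[symmetric], subst (asm) integrable_distr_eq) auto
  show "(\<integral>\<omega>. f (\<omega> j) \<partial>\<P>) = (\<integral>x. f x \<partial>\<mu>)"
    by (subst (2) d[symmetric], subst integral_distr) auto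
qed

lemma prob_space_disorder: "prob_space \<P>"
  unfolding disorder_law_def by (rule seq.P.prob_space_axioms)

lemma coord_lipschitz_integrable:
  assumes [measurable]: "F \<in> borel_measurable \<P>" and L: "coord_lipschitz b n F"
  shows "integrable \<P> F"
proof (rule Bochner_Integration.integrable_bound)
  interpret P: prob_space \<P> by (rule prob_space_disorder)
  show "integrable \<P> (\<lambda>\<omega>. \<bar>F (\<lambda>_. 0)\<bar> + b * (\<Sum>j<n. \<bar>\<omega> j\<bar>))"
    by (intro Bochner_Integration.integrable_add integrable_mult_right
        Bochner_Integration.integrable_sum disorder_component integrable_abs integrable_id) auto
  have "\<bar>F \<omega>\<bar> \<le> \<bar>F (\<lambda>_. 0)\<bar> + b * (\<Sum>j<n. \<bar>\<omega> j\<bar>)" for \<omega>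
    using coord_lipschitz_abs[OF L, of \<omega> "\<lambda>_. 0"] by simp
  then show "AE \<omega> in \<P>. norm (F \<omega>) \<le> norm (\<bar>F (\<lambda>_. 0)\<bar> + b * (\<Sum>j<n. \<bar>\<omega> j\<bar>))"
    by (auto intro: order_trans[OF _ abs_ge_self])
qed simp

lemma one_dim_mgf:
  assumes b: "b \<ge> 0"
  shows "\<exists>C\<ge>0. \<forall>s G. \<bar>s\<bar> \<le> 1 \<longrightarrow> (\<forall>x y. \<bar>G x - G y\<bar> \<le> b * \<bar>x - y\<bar>) \<longrightarrow>
     (\<integral>\<^sup>+x. ennreal (exp (s * (G x - (\<integral>y. G y \<partial>\<mu>)))) \<partial>\<mu>) \<le> ennreal (exp (C * s\<^sup>2))"
proof -
  define m where "m = (\<integral>x. \<bar>x\<bar> \<partial>\<mu>)"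
  define V where "V x = 2 * exp (2 * b * m) * exp (2 * b * \<bar>x\<bar>)" for x
  have iV: "integrable \<mu> V" unfolding V_def by (intro integrable_mult_right integrable_exp_abs)
  define C where "C = (\<integral>x. V x \<partial>\<mu>)"
  have V0: "V x \<ge> 0" for x by (simp add: V_def)
  have C0: "C \<ge> 0" unfolding C_def by (intro integral_nonneg_AE) (simp add: V0)
  have "(\<integral>\<^sup>+x. ennreal (exp (s * (G x - (\<integral>y. G y \<partial>\<mu>)))) \<partial>\<mu>) \<le> ennreal (exp (C * s\<^sup>2))"
    if s: "\<bar>s\<bar> \<le> 1" and L: "\<And>x y. \<bar>G x - G y\<bar> \<le> b * \<bar>x - y\<bar>" for s G
  proof -
    note [measurable] = borel_measurable_lipschitz[OF L b]
    have iG: "integrable \<mu> G"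
    proof (rule Bochner_Integration.integrable_bound)
      show "integrable \<mu> (\<lambda>x. \<bar>G 0\<bar> + b * \<bar>x\<bar>)"
        by (intro Bochner_Integration.integrable_add integrable_mult_right integrable_abs integrable_id) simp
      have "\<bar>G x\<bar> \<le> \<bar>G 0\<bar> + b * \<bar>x\<bar>" for x using L[of x 0] by simp
      then show "AE x in \<mu>. norm (G x) \<le> norm (\<bar>G 0\<bar> + b * \<bar>x\<bar>)"
        by (auto intro: order_trans[OF _ abs_ge_self])
    qed simp
    define E where "E = (\<integral>y. G y \<partial>\<mu>)"
    define y where "y x = s * (G x - E)" for x
    have dev: "\<bar>G x - E\<bar> \<le> b * (\<bar>x\<bar> + m)" for x
    proof -
      have "G x - E = (\<integral>z. G x - G z \<partial>\<mu>)"
        using iG by (simp add: E_def prob_space)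
      also have "\<bar>\<dots>\<bar> \<le> (\<integral>z. \<bar>G x - G z\<bar> \<partial>\<mu>)" by (rule integral_abs_bound)
      also have "\<dots> \<le> (\<integral>z. b * (\<bar>x\<bar> + \<bar>z\<bar>) \<partial>\<mu>)"
      proof (rule integral_mono)
        show "integrable \<mu> (\<lambda>z. \<bar>G x - G z\<bar>)" using iG by (intro integrable_abs) simp
        show "integrable \<mu> (\<lambda>z. b * (\<bar>x\<bar> + \<bar>z\<bar>))"
          by (intro integrable_mult_right Bochner_Integration.integrable_add integrable_abs integrable_id) simp
        show "\<bar>G x - G z\<bar> \<le> b * (\<bar>x\<bar> + \<bar>z\<bar>)" for z
          using L[of x z] b mult_left_mono[of "\<bar>x - z\<bar>" "\<bar>x\<bar> + \<bar>z\<bar>" b] by linarith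
      qed
      also have "\<dots> = b * (\<bar>x\<bar> + m)"
        using integrable_id by (simp add: m_def prob_space)
      finally show ?thesis .
    qed
    have bd: "exp (y x) \<le> 1 + y x + s\<^sup>2 * V x" for x
    proof -
      define t where "t = b * (\<bar>x\<bar> + m)"
      have t0: "t \<ge> 0" using dev[of x] unfolding t_def by linarith
      have yt: "\<bar>y x\<bar> \<le> \<bar>s\<bar> * t" unfolding y_def t_def abs_mult
        by (intro mult_left_mono dev) auto
      have yt1: "\<bar>y x\<bar> \<le> t" using yt s t0 mult_right_mono[of "\<bar>s\<bar>" 1 t] by linarith
      have "(y x)\<^sup>2 \<le> (\<bar>s\<bar> * t)\<^sup>2"
        using yt by (metis abs_le_square_iff abs_mult abs_abs abs_of_nonneg t0)
      also have "\<dots> = s\<^sup>2 * t\<^sup>2" by (simp add: power_mult_distrib)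
      finally have 1: "(y x)\<^sup>2 \<le> s\<^sup>2 * t\<^sup>2" .
      have 2: "t\<^sup>2 \<le> 2 * exp t" using exp_lower_Taylor_quadratic[OF t0] t0 by simp
      have "(y x)\<^sup>2 * exp \<bar>y x\<bar> \<le> (s\<^sup>2 * (2 * exp t)) * exp t"
        using 1 2 yt1 by (intro mult_mono order_trans[OF 1] mult_left_mono) auto
      also have "\<dots> = s\<^sup>2 * V x"
        by (simp add: V_def t_def exp_add[symmetric] algebra_simps)
      finally show ?thesis using exp_le_quadratic[of "y x"] by linarith
    qed
    have iy: "integrable \<mu> y" unfolding y_def using iG by simp
    have Ey: "(\<integral>x. y x \<partial>\<mu>) = 0" unfolding y_def using iG by (simp add: E_def prob_space)
    have nn: "0 \<le> 1 + y x + s\<^sup>2 * V x" for x using bd[of x] exp_gt_zero[of "y x"] by linarith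
    have "(\<integral>\<^sup>+x. ennreal (exp (y x)) \<partial>\<mu>) \<le> (\<integral>\<^sup>+x. ennreal (1 + y x + s\<^sup>2 * V x) \<partial>\<mu>)"
      by (intro nn_integral_mono ennreal_leI bd)
    also have "\<dots> = ennreal (\<integral>x. 1 + y x + s\<^sup>2 * V x \<partial>\<mu>)"
      using iy iV nn by (intro nn_integral_eq_integral) auto
    also have "(\<integral>x. 1 + y x + s\<^sup>2 * V x \<partial>\<mu>) = 1 + s\<^sup>2 * C"
      using iy iV by (simp add: Ey C_def prob_space)
    also have "ennreal (1 + s\<^sup>2 * C) \<le> ennreal (exp (C * s\<^sup>2))"
      using exp_ge_add_one_self[of "C * s\<^sup>2"] by (intro ennreal_leI) (simp add: mult.commute)
    finally show ?thesis unfolding y_def E_def .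
  qed
  with C0 show ?thesis by blast
qed

lemma coord_lipschitz_mgf:
  assumes b: "b \<ge> 0"
  shows "\<exists>C\<ge>0. \<forall>s n F. \<bar>s\<bar> \<le> 1 \<longrightarrow> F \<in> borel_measurable \<P> \<longrightarrow> coord_lipschitz b n F \<longrightarrow>
     (\<integral>\<^sup>+\<omega>. ennreal (exp (s * (F \<omega> - (integral\<^sup>L \<P> F)))) \<partial>\<P>)
       \<le> ennreal (exp (C * s\<^sup>2 * real n))"
proof -
  interpret P: prob_space \<P> by (rule prob_space_disorder)
  obtain C where C: "C \<ge> 0" "\<And>s G. \<bar>s\<bar> \<le> 1 \<Longrightarrow> (\<And>x y. \<bar>G x - G y\<bar> \<le> b * \<bar>x - y\<bar>) \<Longrightarrow>
     (\<integral>\<^sup>+x. ennreal (exp (s * (G x - (\<integral>y. G y \<partial>\<mu>)))) \<partial>\<mu>) \<le> ennreal (exp (C * s\<^sup>2))"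
    using one_dim_mgf[OF b] by blast
  have "(\<integral>\<^sup>+\<omega>. ennreal (exp (s * (F \<omega> - (integral\<^sup>L \<P> F)))) \<partial>\<P>)
       \<le> ennreal (exp (C * s\<^sup>2 * real n))"
    if s: "\<bar>s\<bar> \<le> 1" and "F \<in> borel_measurable \<P>" "coord_lipschitz b n F" for s n F
    using that(2-)
  proof (induction n arbitrary: F)
    case 0
    have "F \<omega> = F (\<lambda>_. 0)" for \<omega>
      using coord_lipschitz_abs[OF 0(2), of \<omega> "\<lambda>_. 0"] by simp
    then have "F = (\<lambda>_. F (\<lambda>_. 0))" by blast
    then obtain c where "F = (\<lambda>_. c)" by blast
    then show ?case by (simp add: P.prob_space P.emeasure_space_1)
  next
    case (Suc n)
    note [measurable] = Suc.prems(1)[unfolded disorder_law_def]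
      define G where "G x = (\<integral>\<omega>. F (case_nat x \<omega>) \<partial>\<P>)" for x
    have mF[measurable]: "(\<lambda>\<omega>. F (case_nat x \<omega>)) \<in> borel_measurable \<P>" for x
      unfolding disorder_law_def by measurable
    have LF: "coord_lipschitz b n (\<lambda>\<omega>. F (case_nat x \<omega>))" for x
      by (rule coord_lipschitz_case_nat[OF Suc.prems(2)])
    have iF: "integrable \<P> (\<lambda>\<omega>. F (case_nat x \<omega>))" for x
      by (rule coord_lipschitz_integrable[OF mF LF])
    have EF: "(integral\<^sup>L \<P> F) = (\<integral>x. G x \<partial>\<mu>)"
      using coord_lipschitz_integrable[OF Suc.prems] unfolding G_def disorder_law_def
      by (rule seq.integral_case_nat)
    have LG: "\<bar>G x - G y\<bar> \<le> b * \<bar>x - y\<bar>" for x y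
    proof -
      have "G x - G y = (\<integral>\<omega>. F (case_nat x \<omega>) - F (case_nat y \<omega>) \<partial>\<P>)"
        unfolding G_def using iF by simp
      also have "\<bar>\<dots>\<bar> \<le> (\<integral>\<omega>. \<bar>F (case_nat x \<omega>) - F (case_nat y \<omega>)\<bar> \<partial>\<P>)"
        by (rule integral_abs_bound)
      also have "\<dots> \<le> (\<integral>\<omega>. b * \<bar>x - y\<bar> \<partial>\<P>)"
      proof (rule integral_mono)
        show "integrable \<P> (\<lambda>\<omega>. \<bar>F (case_nat x \<omega>) - F (case_nat y \<omega>)\<bar>)"
          using iF by (intro integrable_abs) simp
        show "\<bar>F (case_nat x \<omega>) - F (case_nat y \<omega>)\<bar> \<le> b * \<bar>x - y\<bar>" for \<omega>
          using coord_lipschitz_abs[OF Suc.prems(2), of "case_nat x \<omega>" "case_nat y \<omega>"]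
          by (simp add: sum.lessThan_Suc_shift del: sum.lessThan_Suc)
      qed simp
      finally show ?thesis by (simp add: P.prob_space)
    qed
    let ?E = "\<integral>x. G x \<partial>\<mu>"
    have "(\<integral>\<^sup>+\<omega>. ennreal (exp (s * (F \<omega> - ?E))) \<partial>\<P>)
        = (\<integral>\<^sup>+x. \<integral>\<^sup>+\<omega>. ennreal (exp (s * (F (case_nat x \<omega>) - ?E))) \<partial>\<P> \<partial>\<mu>)"
      unfolding disorder_law_def by (rule seq.nn_integral_case_nat) measurable
    also have "\<dots> \<le> (\<integral>\<^sup>+x. ennreal (exp (s * (G x - ?E))) * ennreal (exp (C * s\<^sup>2 * real n)) \<partial>\<mu>)"
    proof (rule nn_integral_mono)
      fix x
      have "(\<integral>\<^sup>+\<omega>. ennreal (exp (s * (F (case_nat x \<omega>) - ?E))) \<partial>\<P>)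
          = (\<integral>\<^sup>+\<omega>. ennreal (exp (s * (G x - ?E))) * ennreal (exp (s * (F (case_nat x \<omega>) - G x))) \<partial>\<P>)"
        by (intro nn_integral_cong) (simp add: ennreal_mult[symmetric] exp_add[symmetric] algebra_simps)
      also have "\<dots> = ennreal (exp (s * (G x - ?E))) * (\<integral>\<^sup>+\<omega>. ennreal (exp (s * (F (case_nat x \<omega>) - G x))) \<partial>\<P>)"
        by (rule nn_integral_cmult) measurable
      also have "\<dots> \<le> ennreal (exp (s * (G x - ?E))) * ennreal (exp (C * s\<^sup>2 * real n))"
        unfolding G_def[of x] by (intro mult_left_mono Suc.IH[OF mF LF]) simp
      finally show "(\<integral>\<^sup>+\<omega>. ennreal (exp (s * (F (case_nat x \<omega>) - ?E))) \<partial>\<P>)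
        \<le> ennreal (exp (s * (G x - ?E))) * ennreal (exp (C * s\<^sup>2 * real n))" .
    qed
    also have "\<dots> = (\<integral>\<^sup>+x. ennreal (exp (s * (G x - ?E))) \<partial>\<mu>) * ennreal (exp (C * s\<^sup>2 * real n))"
    proof (rule nn_integral_multc)
      note [measurable] = borel_measurable_lipschitz[OF LG b]
      show "(\<lambda>x. ennreal (exp (s * (G x - ?E)))) \<in> borel_measurable \<mu>" by measurable
    qed
    also have "\<dots> \<le> ennreal (exp (C * s\<^sup>2)) * ennreal (exp (C * s\<^sup>2 * real n))"
      by (intro mult_right_mono C s LG) simp
    also have "\<dots> = ennreal (exp (C * s\<^sup>2 * real (Suc n)))"
      by (simp add: ennreal_mult[symmetric] exp_add[symmetric] algebra_simps)
    finally show ?case unfolding EF .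
  qed
  with C(1) show ?thesis by blast
qed

lemma deviation:
  assumes b: "b \<ge> 0" and e: "\<epsilon> > 0"
  shows "\<exists>s>0. \<exists>B\<ge>0. \<exists>k>0. \<forall>N F. F \<in> borel_measurable \<P> \<longrightarrow> coord_lipschitz b (Suc N) F \<longrightarrow>
     (\<integral>\<^sup>+\<omega>. ennreal (exp (s * (\<bar>F \<omega> - (integral\<^sup>L \<P> F)\<bar> - \<epsilon> * real N))) \<partial>\<P>)
       \<le> ennreal (B * exp (- k * real N))"
proof -
  obtain C where C: "C \<ge> 0" "\<And>s n F. \<bar>s\<bar> \<le> 1 \<Longrightarrow> F \<in> borel_measurable \<P> \<Longrightarrow> coord_lipschitz b n F \<Longrightarrow>
     (\<integral>\<^sup>+\<omega>. ennreal (exp (s * (F \<omega> - (integral\<^sup>L \<P> F)))) \<partial>\<P>) \<le> ennreal (exp (C * s\<^sup>2 * real n))"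
    using coord_lipschitz_mgf[OF b] by blast
  define s where "s = min 1 (\<epsilon> / (2 * (C + 1)))"
  have s: "s > 0" "s \<le> 1" using e C(1) by (auto simp: s_def)
  have "s \<le> \<epsilon> / (2 * (C + 1))" by (simp add: s_def)
  then have "s * (C + 1) \<le> \<epsilon> / 2" using C(1) by (simp add: field_simps)
  then have Cs: "C * s \<le> \<epsilon> / 2" using s by (simp add: algebra_simps)
  define k where "k = s * \<epsilon> / 2"
  have k: "k > 0" using s e by (simp add: k_def)
  have "(\<integral>\<^sup>+\<omega>. ennreal (exp (s * (\<bar>F \<omega> - (integral\<^sup>L \<P> F)\<bar> - \<epsilon> * real N))) \<partial>\<P>)
       \<le> ennreal (2 * exp C * exp (- k * real N))"
    if [measurable]: "F \<in> borel_measurable \<P>" and L: "coord_lipschitz b (Suc N) F" for N F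
  proof -
    let ?E = "\<integral>\<omega>. F \<omega> \<partial>\<P>"
    have "(\<integral>\<^sup>+\<omega>. ennreal (exp (s * (\<bar>F \<omega> - ?E\<bar> - \<epsilon> * real N))) \<partial>\<P>)
      \<le> (\<integral>\<^sup>+\<omega>. ennreal (exp (- s * \<epsilon> * real N)) *
            (ennreal (exp (s * (F \<omega> - ?E))) + ennreal (exp ((-s) * (F \<omega> - ?E)))) \<partial>\<P>)"
    proof (rule nn_integral_mono)
      fix \<omega>
      have "exp (s * \<bar>F \<omega> - ?E\<bar>) \<le> exp (s * (F \<omega> - ?E)) + exp ((-s) * (F \<omega> - ?E))"
      proof -
        have "s * \<bar>F \<omega> - ?E\<bar> = s * (F \<omega> - ?E) \<or> s * \<bar>F \<omega> - ?E\<bar> = (-s) * (F \<omega> - ?E)"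
          by (cases "F \<omega> - ?E \<ge> 0") (auto simp: algebra_simps)
        then show ?thesis by (elim disjE) (simp_all only: le_add_same_cancel1 le_add_same_cancel2 exp_ge_zero)
      qed
      then have "exp (- s * \<epsilon> * real N) * exp (s * \<bar>F \<omega> - ?E\<bar>)
          \<le> exp (- s * \<epsilon> * real N) * (exp (s * (F \<omega> - ?E)) + exp ((-s) * (F \<omega> - ?E)))"
        by (intro mult_left_mono) auto
      then have "exp (s * (\<bar>F \<omega> - ?E\<bar> - \<epsilon> * real N))
          \<le> exp (- s * \<epsilon> * real N) * (exp (s * (F \<omega> - ?E)) + exp ((-s) * (F \<omega> - ?E)))"
        by (simp add: exp_add[symmetric] algebra_simps)
      then show "ennreal (exp (s * (\<bar>F \<omega> - ?E\<bar> - \<epsilon> * real N))) \<le> ennreal (exp (- s * \<epsilon> * real N)) *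
            (ennreal (exp (s * (F \<omega> - ?E))) + ennreal (exp ((-s) * (F \<omega> - ?E))))"
        by (subst ennreal_plus[symmetric], simp, simp, subst ennreal_mult[symmetric])
           (auto intro!: ennreal_leI add_nonneg_nonneg)
    qed
    also have "\<dots> = ennreal (exp (- s * \<epsilon> * real N)) *
        ((\<integral>\<^sup>+\<omega>. ennreal (exp (s * (F \<omega> - ?E))) \<partial>\<P>) + (\<integral>\<^sup>+\<omega>. ennreal (exp ((-s) * (F \<omega> - ?E))) \<partial>\<P>))"
      by (subst nn_integral_cmult, measurable) (subst nn_integral_add, auto)
    also have "\<dots> \<le> ennreal (exp (- s * \<epsilon> * real N)) *
        (ennreal (exp (C * s\<^sup>2 * real (Suc N))) + ennreal (exp (C * (-s)\<^sup>2 * real (Suc N))))"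
      using s by (intro mult_left_mono add_mono C L) auto
    also have "\<dots> = ennreal (2 * exp (C * s\<^sup>2 * real (Suc N) - s * \<epsilon> * real N))"
      by (subst ennreal_plus[symmetric], simp, simp, subst ennreal_mult[symmetric])
         (auto simp: exp_diff exp_minus field_simps)
    also have "\<dots> \<le> ennreal (2 * exp C * exp (- k * real N))"
    proof (rule ennreal_leI)
      have "C * s\<^sup>2 \<le> s * \<epsilon> / 2" using mult_left_mono[OF Cs, of s] s by (simp add: power2_eq_square algebra_simps)
      then have 1: "C * s\<^sup>2 * real N \<le> s * \<epsilon> / 2 * real N" by (intro mult_right_mono) auto
      have 2: "C * s\<^sup>2 \<le> C" using s C(1) mult_left_mono[of "s\<^sup>2" 1 C] by (simp add: power_le_one)
      have "C * s\<^sup>2 * real (Suc N) - s * \<epsilon> * real N \<le> C + (- k * real N)"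
        using 1 2 by (simp add: k_def algebra_simps)
      then have "exp (C * s\<^sup>2 * real (Suc N) - s * \<epsilon> * real N) \<le> exp C * exp (- k * real N)"
        by (simp add: exp_add[symmetric])
      then show "2 * exp (C * s\<^sup>2 * real (Suc N) - s * \<epsilon> * real N) \<le> 2 * exp C * exp (- k * real N)"
        by simp
    qed
    finally show ?thesis .
  qed
  then show ?thesis using s(1) k by (intro exI[of _ s] exI[of _ "2 * exp C"] exI[of _ k] conjI) auto
qed

lemma concentration_AE:
  assumes b: "b \<ge> 0" and [measurable]: "\<And>N i. F N i \<in> borel_measurable \<P>"
    and L: "\<And>N i. coord_lipschitz b (Suc N) (F N i)"
  shows "AE \<omega> in \<P>. \<forall>\<epsilon>>0. \<forall>\<^sub>F N in sequentially. \<forall>i\<le>N.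
     \<bar>F N i \<omega> - (integral\<^sup>L \<P> (F N i))\<bar> \<le> \<epsilon> * real N"
proof -
  interpret P: prob_space \<P> by (rule prob_space_disorder)
  define E where "E N i = (integral\<^sup>L \<P> (F N i))" for N and i :: nat
  have ev: "AE \<omega> in \<P>. \<forall>\<^sub>F N in sequentially. \<forall>i\<le>N. \<bar>F N i \<omega> - E N i\<bar> \<le> \<epsilon> * real N"
    if e: "\<epsilon> > 0" for \<epsilon> :: real
  proof -
    obtain s B k where s: "s > 0" and B: "B \<ge> 0" and k: "k > 0" and
      dev: "\<And>N G. G \<in> borel_measurable \<P> \<Longrightarrow> coord_lipschitz b (Suc N) G \<Longrightarrow>
       (\<integral>\<^sup>+\<omega>. ennreal (exp (s * (\<bar>G \<omega> - (integral\<^sup>L \<P> G)\<bar> - \<epsilon> * real N))) \<partial>\<P>)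
         \<le> ennreal (B * exp (- k * real N))"
      using deviation[OF b e] by blast
    define D where "D N i = {\<omega>\<in>space \<P>. \<bar>F N i \<omega> - E N i\<bar> > \<epsilon> * real N}" for N i
    have [measurable]: "D N i \<in> sets \<P>" for N i unfolding D_def by measurable
    have mD: "measure \<P> (D N i) \<le> B * exp (- k * real N)" for N i
    proof -
      have "emeasure \<P> (D N i) = (\<integral>\<^sup>+\<omega>. indicator (D N i) \<omega> \<partial>\<P>)" by simp
      also have "\<dots> \<le> (\<integral>\<^sup>+\<omega>. ennreal (exp (s * (\<bar>F N i \<omega> - E N i\<bar> - \<epsilon> * real N))) \<partial>\<P>)"
        using s by (intro nn_integral_mono) (auto simp: D_def indicator_def simp flip: ennreal_1 intro!: ennreal_leI)
      also have "\<dots> \<le> ennreal (B * exp (- k * real N))"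
        unfolding E_def by (intro dev L) measurable
      finally show ?thesis using B by (simp add: P.emeasure_eq_measure)
    qed
    define A where "A N = (\<Union>i\<le>N. D N i)" for N
    have [measurable]: "A N \<in> sets \<P>" for N unfolding A_def by measurable
    have mA: "measure \<P> (A N) \<le> real (Suc N) * (B * exp (- k * real N))" for N
    proof -
      have "measure \<P> (A N) \<le> (\<Sum>i\<le>N. measure \<P> (D N i))"
        unfolding A_def by (rule P.finite_measure_subadditive_finite) auto
      also have "\<dots> \<le> (\<Sum>i\<le>N. B * exp (- k * real N))" by (intro sum_mono mD)
      finally show ?thesis by simp
    qed
    have "AE \<omega> in \<P>. \<forall>\<^sub>F N in sequentially. \<omega> \<in> space \<P> - A N"
    proof (rule borel_cantelli_AE1)
      show "summable (\<lambda>N. measure \<P> (A N))"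
        by (rule summable_comparison_test'[OF summable_Suc_exp[OF k, of B]]) (use mA in auto)
    qed (auto simp: P.emeasure_eq_measure)
    then show ?thesis
    proof (rule AE_mp, intro AE_I2 impI)
      fix \<omega> assume "\<forall>\<^sub>F N in sequentially. \<omega> \<in> space \<P> - A N"
      then show "\<forall>\<^sub>F N in sequentially. \<forall>i\<le>N. \<bar>F N i \<omega> - E N i\<bar> \<le> \<epsilon> * real N"
        by eventually_elim (auto simp: A_def D_def not_less)
    qed
  qed
  have "AE \<omega> in \<P>. \<forall>n. \<forall>\<^sub>F N in sequentially. \<forall>i\<le>N. \<bar>F N i \<omega> - E N i\<bar> \<le> (1 / real (Suc n)) * real N"
    by (subst AE_all_countable) (intro allI ev, simp)
  then show ?thesis
  proof (rule AE_mp, intro AE_I2 impI allI)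
    fix \<omega> and \<epsilon> :: real
    assume A: "\<forall>n. \<forall>\<^sub>F N in sequentially. \<forall>i\<le>N. \<bar>F N i \<omega> - E N i\<bar> \<le> (1 / real (Suc n)) * real N" and e: "\<epsilon> > 0"
    obtain n where n: "inverse (real (Suc n)) < \<epsilon>" using reals_Archimedean[OF e] by auto
    show "\<forall>\<^sub>F N in sequentially. \<forall>i\<le>N. \<bar>F N i \<omega> - (integral\<^sup>L \<P> (F N i))\<bar> \<le> \<epsilon> * real N"
      using A[rule_format, of n]
    proof eventually_elim
      case (elim N)
      have "1 / real (Suc n) * real N \<le> \<epsilon> * real N"
        using n by (intro mult_right_mono) (auto simp: field_simps)
      then show ?case using elim unfolding E_def by (meson order_trans)
    qed
  qed
qed

lemma concentration_L1:
  assumes b: "b \<ge> 0" and [measurable]: "\<And>N. F N \<in> borel_measurable \<P>"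
    and L: "\<And>N. coord_lipschitz b (Suc N) (F N)"
  shows "(\<lambda>N. (\<integral>\<omega>. \<bar>F N \<omega> - (integral\<^sup>L \<P> (F N))\<bar> \<partial>\<P>) / real N) \<longlonglongrightarrow> 0"
proof (rule LIMSEQ_I)
  interpret P: prob_space \<P> by (rule prob_space_disorder)
  fix r :: real assume r: "r > 0"
  define \<epsilon> where "\<epsilon> = r / 2"
  have e: "\<epsilon> > 0" using r by (simp add: \<epsilon>_def)
  obtain s B k where s: "s > 0" and B: "B \<ge> 0" and k: "k > 0" and
    dev: "\<And>N G. G \<in> borel_measurable \<P> \<Longrightarrow> coord_lipschitz b (Suc N) G \<Longrightarrow>
     (\<integral>\<^sup>+\<omega>. ennreal (exp (s * (\<bar>G \<omega> - (integral\<^sup>L \<P> G)\<bar> - \<epsilon> * real N))) \<partial>\<P>)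
       \<le> ennreal (B * exp (- k * real N))"
    using deviation[OF b e] by blast
  define E where "E N = (integral\<^sup>L \<P> (F N))" for N
  have bd: "(\<integral>\<omega>. \<bar>F N \<omega> - E N\<bar> \<partial>\<P>) \<le> \<epsilon> * real N + B / s" for N
  proof -
    have iF: "integrable \<P> (F N)" by (rule coord_lipschitz_integrable[OF _ L]) measurable
    have "ennreal (\<integral>\<omega>. \<bar>F N \<omega> - E N\<bar> \<partial>\<P>) = (\<integral>\<^sup>+\<omega>. ennreal \<bar>F N \<omega> - E N\<bar> \<partial>\<P>)"
      using iF by (intro nn_integral_eq_integral[symmetric]) auto
    also have "\<dots> \<le> (\<integral>\<^sup>+\<omega>. ennreal (\<epsilon> * real N) + ennreal (1 / s) * ennreal (exp (s * (\<bar>F N \<omega> - E N\<bar> - \<epsilon> * real N))) \<partial>\<P>)"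
    proof (rule nn_integral_mono)
      fix \<omega>
      have "s * (\<bar>F N \<omega> - E N\<bar> - \<epsilon> * real N) \<le> exp (s * (\<bar>F N \<omega> - E N\<bar> - \<epsilon> * real N))" (is "s * ?d \<le> ?x")
        using exp_ge_add_one_self[of "s * (\<bar>F N \<omega> - E N\<bar> - \<epsilon> * real N)"] by linarith
      then have "?d \<le> 1 / s * ?x" using s by (simp add: field_simps)
      then have "\<bar>F N \<omega> - E N\<bar> \<le> \<epsilon> * real N + 1 / s * ?x" by linarith
      then have "ennreal \<bar>F N \<omega> - E N\<bar> \<le> ennreal (\<epsilon> * real N + 1 / s * ?x)"
        by (rule ennreal_leI)
      also have "\<dots> = ennreal (\<epsilon> * real N) + ennreal (1 / s) * ennreal ?x"
        using s e by (simp add: ennreal_mult[symmetric] flip: ennreal_plus)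
      finally show "ennreal \<bar>F N \<omega> - E N\<bar> \<le> ennreal (\<epsilon> * real N) + ennreal (1 / s) * ennreal ?x" .
    qed
    also have "\<dots> = ennreal (\<epsilon> * real N) + ennreal (1 / s) * (\<integral>\<^sup>+\<omega>. ennreal (exp (s * (\<bar>F N \<omega> - E N\<bar> - \<epsilon> * real N))) \<partial>\<P>)"
      by (subst nn_integral_add, measurable) (simp add: nn_integral_cmult P.emeasure_space_1)
    also have "\<dots> \<le> ennreal (\<epsilon> * real N) + ennreal (1 / s) * ennreal (B * exp (- k * real N))"
      unfolding E_def by (intro add_left_mono mult_left_mono dev L) auto
    also have "\<dots> \<le> ennreal (\<epsilon> * real N) + ennreal (1 / s) * ennreal B"
      using B k by (intro add_left_mono mult_left_mono ennreal_leI) (auto intro!: mult_left_le)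
    also have "\<dots> = ennreal (\<epsilon> * real N + B / s)"
      using s B e by (subst ennreal_mult[symmetric], simp, simp, subst ennreal_plus[symmetric]) auto
    finally show ?thesis using s B e by (subst (asm) ennreal_le_iff) auto
  qed
  obtain N0 :: nat where N0: "real N0 > B / s / \<epsilon>" using reals_Archimedean2 by blast
  show "\<exists>no. \<forall>N\<ge>no. norm ((\<integral>\<omega>. \<bar>F N \<omega> - (integral\<^sup>L \<P> (F N))\<bar> \<partial>\<P>) / real N - 0) < r"
  proof (intro exI[of _ "max 1 N0"] allI impI)
    fix N assume N: "max 1 N0 \<le> N"
    then have "real N > B / s / \<epsilon>" using N0 by (metis max.bounded_iff of_nat_le_iff order_less_le_trans)
    then have "B / s < \<epsilon> * real N" using e pos_divide_less_eq[OF e, of "B / s" "real N"] by (simp add: mult.commute)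
    then have "(\<integral>\<omega>. \<bar>F N \<omega> - E N\<bar> \<partial>\<P>) < r * real N"
      using bd[of N] by (simp add: \<epsilon>_def field_simps)
    then have "(\<integral>\<omega>. \<bar>F N \<omega> - E N\<bar> \<partial>\<P>) / real N < r" using N by (simp add: field_simps)
    moreover have "(\<integral>\<omega>. \<bar>F N \<omega> - E N\<bar> \<partial>\<P>) / real N \<ge> 0"
      by (intro divide_nonneg_nonneg integral_nonneg_AE) auto
    ultimately show "norm ((\<integral>\<omega>. \<bar>F N \<omega> - (integral\<^sup>L \<P> (F N))\<bar> \<partial>\<P>) / real N - 0) < r"
      unfolding E_def by simp
  qed
qed

end

section \<open>The constrained partition function\<close>

fun ren_pf :: "nat pmf \<Rightarrow> real \<Rightarrow> nat \<Rightarrow> nat \<Rightarrow> (nat \<Rightarrow> real) \<Rightarrow> real" where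
  "ren_pf Kp \<beta> 0 N \<omega> = (if N = 0 then 1 else 0)"
| "ren_pf Kp \<beta> (Suc m) N \<omega> =
     (\<Sum>n=1..N. pmf Kp n * exp (\<beta> * \<omega> n) * ren_pf Kp \<beta> m (N - n) (\<lambda>j. \<omega> (j + n)))"

abbreviation hom_pf :: "nat pmf \<Rightarrow> nat \<Rightarrow> nat \<Rightarrow> real" where
  "hom_pf Kp m N \<equiv> ren_pf Kp 0 m N (\<lambda>_. 0)"

lemma pf_nonneg: "ren_pf Kp \<beta> m N \<omega> \<ge> 0"
  by (induction m arbitrary: N \<omega>) (auto intro!: sum_nonneg)

lemma pf_eq_0: "N < m \<or> m = 0 \<and> N \<noteq> 0 \<Longrightarrow> ren_pf Kp \<beta> m N \<omega> = 0"
proof (induction m arbitrary: N \<omega>)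
  case (Suc m)
  have "ren_pf Kp \<beta> m (N - n) (\<lambda>j. \<omega> (j + n)) = 0" if "n \<in> {1..N}" for n
    by (rule Suc.IH) (use Suc.prems that in auto)
  then show ?case by simp
qed simp

text \<open>The function \<open>c\<close> accumulates a cost per site, \<open>\<kappa>\<close> is a cost per renewal; specialisations
  give the Lipschitz estimate and both upper bounds.\<close>

lemma pf_compare:
  assumes "\<And>k n. n \<ge> 1 \<Longrightarrow> k + n \<le> k0 + N \<Longrightarrow> \<beta> * \<omega> (k + n) \<le> \<beta>' * \<omega>' (k + n) + (c (k + n) - c k) + \<kappa>"
  shows "ren_pf Kp \<beta> m N (\<lambda>j. \<omega> (j + k0)) \<le> exp (c (k0 + N) - c k0 + \<kappa> * real m) * ren_pf Kp \<beta>' m N (\<lambda>j. \<omega>' (j + k0))"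
  using assms
proof (induction m arbitrary: N k0)
  case 0
  then show ?case by simp
next
  case (Suc m)
  show ?case
    unfolding ren_pf.simps sum_distrib_left
  proof (rule sum_mono)
    fix n assume n: "n \<in> {1..N}"
    have IH: "ren_pf Kp \<beta> m (N - n) (\<lambda>j. \<omega> (j + (k0 + n)))
       \<le> exp (c (k0 + n + (N - n)) - c (k0 + n) + \<kappa> * real m) * ren_pf Kp \<beta>' m (N - n) (\<lambda>j. \<omega>' (j + (k0 + n)))"
      by (rule Suc.IH, rule Suc.prems) (use n in auto)
    have "\<beta> * \<omega> (k0 + n) \<le> \<beta>' * \<omega>' (k0 + n) + (c (k0 + n) - c k0) + \<kappa>"
      by (rule Suc.prems) (use n in auto)
    then have "exp (\<beta> * \<omega> (k0 + n)) \<le> exp (\<beta>' * \<omega>' (k0 + n) + (c (k0 + n) - c k0) + \<kappa>)" by simp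
    then have "exp (\<beta> * \<omega> (k0 + n)) * ren_pf Kp \<beta> m (N - n) (\<lambda>j. \<omega> (j + (k0 + n)))
      \<le> exp (\<beta>' * \<omega>' (k0 + n) + (c (k0 + n) - c k0) + \<kappa>) *
        (exp (c (k0 + n + (N - n)) - c (k0 + n) + \<kappa> * real m) * ren_pf Kp \<beta>' m (N - n) (\<lambda>j. \<omega>' (j + (k0 + n))))"
      by (intro mult_mono IH pf_nonneg) auto
    also have "\<dots> = exp (c (k0 + N) - c k0 + \<kappa> * real (Suc m)) *
        (exp (\<beta>' * \<omega>' (k0 + n)) * ren_pf Kp \<beta>' m (N - n) (\<lambda>j. \<omega>' (j + (k0 + n))))"
      using n by (simp add: exp_add[symmetric] mult.assoc[symmetric]) (simp add: algebra_simps)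
    finally have "pmf Kp n * (exp (\<beta> * \<omega> (k0 + n)) * ren_pf Kp \<beta> m (N - n) (\<lambda>j. \<omega> (j + (k0 + n))))
      \<le> pmf Kp n * (exp (c (k0 + N) - c k0 + \<kappa> * real (Suc m)) *
        (exp (\<beta>' * \<omega>' (k0 + n)) * ren_pf Kp \<beta>' m (N - n) (\<lambda>j. \<omega>' (j + (k0 + n)))))"
      by (intro mult_left_mono) auto
    then show "pmf Kp n * exp (\<beta> * \<omega> (n + k0)) * ren_pf Kp \<beta> m (N - n) (\<lambda>j. \<omega> (j + n + k0))
      \<le> exp (c (k0 + N) - c k0 + \<kappa> * real (Suc m)) *
        (pmf Kp n * exp (\<beta>' * \<omega>' (n + k0)) * ren_pf Kp \<beta>' m (N - n) (\<lambda>j. \<omega>' (j + n + k0)))"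
      by (simp add: algebra_simps)
  qed
qed

lemma pf_lipschitz:
  assumes "\<beta> \<ge> 0"
  shows "ren_pf Kp \<beta> m N \<omega> \<le> exp (\<beta> * (\<Sum>j<Suc N. \<bar>\<omega> j - \<omega>' j\<bar>)) * ren_pf Kp \<beta> m N \<omega>'"
proof -
  define c where "c k = \<beta> * (\<Sum>j<Suc k. \<bar>\<omega> j - \<omega>' j\<bar>)" for k
  have "ren_pf Kp \<beta> m N (\<lambda>j. \<omega> (j + 0)) \<le> exp (c (0 + N) - c 0 + 0 * real m) * ren_pf Kp \<beta> m N (\<lambda>j. \<omega>' (j + 0))"
  proof (rule pf_compare)
    fix k n :: nat assume n: "n \<ge> 1"
    have "\<omega> (k + n) - \<omega>' (k + n) \<le> \<bar>\<omega> (k + n) - \<omega>' (k + n)\<bar>" by simp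
    also have "\<dots> + (\<Sum>j<Suc k. \<bar>\<omega> j - \<omega>' j\<bar>) \<le> (\<Sum>j<Suc (k + n). \<bar>\<omega> j - \<omega>' j\<bar>)"
    proof -
      have "(\<Sum>j<Suc k. \<bar>\<omega> j - \<omega>' j\<bar>) \<le> (\<Sum>j<k + n. \<bar>\<omega> j - \<omega>' j\<bar>)"
        using n by (intro sum_mono2) auto
      then show ?thesis unfolding sum.lessThan_Suc[of _ "k + n"] by linarith
    qed
    finally have "\<omega> (k + n) \<le> \<omega>' (k + n) + ((\<Sum>j<Suc (k + n). \<bar>\<omega> j - \<omega>' j\<bar>) - (\<Sum>j<Suc k. \<bar>\<omega> j - \<omega>' j\<bar>))"
      by simp
    from mult_left_mono[OF this assms]
    show "\<beta> * \<omega> (k + n) \<le> \<beta> * \<omega>' (k + n) + (c (k + n) - c k) + 0"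
      unfolding c_def by (simp add: algebra_simps)
  qed
  moreover have "c (0 + N) - c 0 + 0 * real m \<le> \<beta> * (\<Sum>j<Suc N. \<bar>\<omega> j - \<omega>' j\<bar>)"
    using assms by (simp add: c_def)
  then have "exp (c (0 + N) - c 0 + 0 * real m) * ren_pf Kp \<beta> m N \<omega>'
      \<le> exp (\<beta> * (\<Sum>j<Suc N. \<bar>\<omega> j - \<omega>' j\<bar>)) * ren_pf Kp \<beta> m N \<omega>'"
    by (intro mult_right_mono pf_nonneg) simp
  ultimately show ?thesis by simp
qed

lemma abs_le_square_over:
  fixes x T :: real
  assumes "T > 0"
  shows "\<bar>x\<bar> \<le> x\<^sup>2 / T + T"
proof -
  have "0 \<le> (\<bar>x\<bar> - T)\<^sup>2" by simp
  then have "\<bar>x\<bar> * T * 2 \<le> x\<^sup>2 + T * T" by (simp add: power2_eq_square algebra_simps)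
  moreover have "0 \<le> \<bar>x\<bar> * T" using assms by simp
  ultimately have "\<bar>x\<bar> * T \<le> x\<^sup>2 + T * T" by linarith
  then show ?thesis using assms by (simp add: field_simps)
qed

lemma pf_upper_few:
  assumes "\<beta> \<ge> 0" "T > 0"
  shows "ren_pf Kp \<beta> m N \<omega> \<le> exp (\<beta> * ((\<Sum>j=1..N. (\<omega> j)\<^sup>2 / T) + T * real m)) * hom_pf Kp m N"
proof -
  define c where "c k = \<beta> * (\<Sum>j=1..k. (\<omega> j)\<^sup>2 / T)" for k
  have "ren_pf Kp \<beta> m N (\<lambda>j. \<omega> (j + 0)) \<le> exp (c (0 + N) - c 0 + (\<beta> * T) * real m) * ren_pf Kp 0 m N (\<lambda>j. 0)"
  proof (rule pf_compare)
    fix k n :: nat assume n: "n \<ge> 1"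
    have "(\<omega> (k + n))\<^sup>2 / T + (\<Sum>j=1..k. (\<omega> j)\<^sup>2 / T) \<le> (\<Sum>j=1..k+n. (\<omega> j)\<^sup>2 / T)"
    proof -
      have "(\<omega> (k + n))\<^sup>2 / T + (\<Sum>j=1..k. (\<omega> j)\<^sup>2 / T) = (\<Sum>j\<in>insert (k+n) {1..k}. (\<omega> j)\<^sup>2 / T)"
        using n by simp
      also have "\<dots> \<le> (\<Sum>j=1..k+n. (\<omega> j)\<^sup>2 / T)"
        using n assms by (intro sum_mono2) auto
      finally show ?thesis .
    qed
    then have "\<omega> (k + n) \<le> (\<Sum>j=1..k+n. (\<omega> j)\<^sup>2 / T) - (\<Sum>j=1..k. (\<omega> j)\<^sup>2 / T) + T"
      using abs_le_square_over[OF assms(2), of "\<omega> (k+n)"] by linarith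
    from mult_left_mono[OF this assms(1)]
    show "\<beta> * \<omega> (k + n) \<le> 0 * 0 + (c (k + n) - c k) + \<beta> * T"
      unfolding c_def by (simp add: algebra_simps)
  qed
  moreover have "c (0 + N) - c 0 + (\<beta> * T) * real m = \<beta> * ((\<Sum>j=1..N. (\<omega> j)\<^sup>2 / T) + T * real m)"
    by (simp add: c_def algebra_simps)
  ultimately show ?thesis by simp
qed

text \<open>Comparison with the full set \<open>{1..N}\<close>: only the \<open>N - m\<close> sites that are not renewals cost \<open>T\<close>.\<close>

lemma pf_upper_many:
  assumes "\<beta> \<ge> 0" "T > 0"
  shows "ren_pf Kp \<beta> m N \<omega> \<le>
    exp (\<beta> * ((\<Sum>j=1..N. \<omega> j) + (\<Sum>j=1..N. (\<omega> j)\<^sup>2 / T) + T * (real N - real m))) * hom_pf Kp m N"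
proof -
  define d where "d j = \<omega> j + (\<omega> j)\<^sup>2 / T + T" for j
  have d0: "d j \<ge> 0" for j
    using abs_le_square_over[OF assms(2), of "\<omega> j"] unfolding d_def by linarith
  define c where "c k = \<beta> * (\<Sum>j=1..k. d j)" for k
  have "ren_pf Kp \<beta> m N (\<lambda>j. \<omega> (j + 0)) \<le> exp (c (0 + N) - c 0 + (- \<beta> * T) * real m) * ren_pf Kp 0 m N (\<lambda>j. 0)"
  proof (rule pf_compare)
    fix k n :: nat assume n: "n \<ge> 1"
    have "d (k + n) + (\<Sum>j=1..k. d j) = (\<Sum>j\<in>insert (k+n) {1..k}. d j)"
      using n by simp
    also have "\<dots> \<le> (\<Sum>j=1..k+n. d j)"
      using n d0 by (intro sum_mono2) auto
    finally have "\<omega> (k + n) \<le> (\<Sum>j=1..k+n. d j) - (\<Sum>j=1..k. d j) - T"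
      using assms(2) divide_nonneg_pos[of "(\<omega> (k+n))\<^sup>2" T, OF zero_le_power2] unfolding d_def[of "k+n"] by linarith
    from mult_left_mono[OF this assms(1)]
    show "\<beta> * \<omega> (k + n) \<le> 0 * 0 + (c (k + n) - c k) + - \<beta> * T"
      unfolding c_def by (simp add: algebra_simps)
  qed
  moreover have "c (0 + N) - c 0 + (- \<beta> * T) * real m =
      \<beta> * ((\<Sum>j=1..N. \<omega> j) + (\<Sum>j=1..N. (\<omega> j)\<^sup>2 / T) + T * (real N - real m))"
    by (simp add: c_def d_def sum.distrib algebra_simps)
  ultimately show ?thesis by simp
qed

lemma pf_supermult:
  "ren_pf Kp \<beta> m N \<omega> * ren_pf Kp \<beta> n M (\<lambda>j. \<omega> (j + N)) \<le> ren_pf Kp \<beta> (m + n) (N + M) \<omega>"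
proof (induction m arbitrary: N \<omega>)
  case 0
  then show ?case by (simp add: pf_nonneg)
next
  case (Suc m)
  have "ren_pf Kp \<beta> (Suc m) N \<omega> * ren_pf Kp \<beta> n M (\<lambda>j. \<omega> (j + N))
     = (\<Sum>i=1..N. pmf Kp i * exp (\<beta> * \<omega> i) *
        (ren_pf Kp \<beta> m (N - i) (\<lambda>j. \<omega> (j + i)) * ren_pf Kp \<beta> n M (\<lambda>j. \<omega> (j + N))))"
    by (simp add: sum_distrib_right mult.assoc)
  also have "\<dots> \<le> (\<Sum>i=1..N. pmf Kp i * exp (\<beta> * \<omega> i) * ren_pf Kp \<beta> (m + n) (N + M - i) (\<lambda>j. \<omega> (j + i)))"
  proof (intro sum_mono mult_left_mono)
    fix i assume i: "i \<in> {1..N}"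
    show "ren_pf Kp \<beta> m (N - i) (\<lambda>j. \<omega> (j + i)) * ren_pf Kp \<beta> n M (\<lambda>j. \<omega> (j + N))
       \<le> ren_pf Kp \<beta> (m + n) (N + M - i) (\<lambda>j. \<omega> (j + i))"
      using Suc.IH[of "N - i" "\<lambda>j. \<omega> (j + i)"] i by simp
  qed auto
  also have "\<dots> \<le> (\<Sum>i=1..N+M. pmf Kp i * exp (\<beta> * \<omega> i) * ren_pf Kp \<beta> (m + n) (N + M - i) (\<lambda>j. \<omega> (j + i)))"
    by (intro sum_mono2) (auto intro!: mult_nonneg_nonneg pf_nonneg)
  finally show ?case by simp
qed

lemma ln_sum_exp_ge:
  fixes p y :: "'i \<Rightarrow> real"
  assumes "finite I" "\<And>i. i \<in> I \<Longrightarrow> p i \<ge> 0" "sum p I > 0"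
  shows "ln (\<Sum>i\<in>I. p i * exp (y i)) \<ge> ln (sum p I) + (\<Sum>i\<in>I. p i * y i) / sum p I"
proof -
  define q where "q = sum p I"
  define a where "a = (\<Sum>i\<in>I. p i * y i) / q"
  have q: "q > 0" using assms by (simp add: q_def)
  have "exp a * q = (\<Sum>i\<in>I. p i * (exp a * (1 + (y i - a))))"
  proof -
    have "(\<Sum>i\<in>I. p i * (exp a * (1 + (y i - a)))) = exp a * (sum p I * (1 - a) + (\<Sum>i\<in>I. p i * y i))"
      by (simp add: sum_distrib_left sum_distrib_right sum.distrib sum_subtractf algebra_simps)
    also have "(\<Sum>i\<in>I. p i * y i) = a * q" using q by (simp add: a_def)
    finally show ?thesis by (simp add: q_def algebra_simps)
  qed
  also have "\<dots> \<le> (\<Sum>i\<in>I. p i * exp (y i))"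
  proof (intro sum_mono mult_left_mono assms)
    fix i
    have "exp a * (1 + (y i - a)) \<le> exp a * exp (y i - a)"
      by (intro mult_left_mono exp_ge_add_one_self) auto
    then show "exp a * (1 + (y i - a)) \<le> exp (y i)" by (simp add: exp_add[symmetric])
  qed
  finally have "ln (exp a * q) \<le> ln (\<Sum>i\<in>I. p i * exp (y i))"
    using q by (intro ln_mono) auto
  then show ?thesis using q by (simp add: ln_mult a_def q_def)
qed

locale renewal_kernel =
  fixes Kp :: "nat pmf"
  assumes K0: "pmf Kp 0 = 0" and Kpos: "\<And>n. n \<ge> 1 \<Longrightarrow> pmf Kp n > 0"
begin

lemma sum_K_le_1: "finite I \<Longrightarrow> sum (pmf Kp) I \<le> 1"
  by (metis measure_measure_pmf_finite measure_pmf.prob_le_1)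

lemma pf_pos: "1 \<le> m \<Longrightarrow> m \<le> N \<Longrightarrow> ren_pf Kp \<beta> m N \<omega> > 0"
proof (induction m arbitrary: N \<omega>)
  case (Suc m)
  let ?t = "\<lambda>n. pmf Kp n * exp (\<beta> * \<omega> n) * ren_pf Kp \<beta> m (N - n) (\<lambda>j. \<omega> (j + n))"
  obtain n where n: "n \<in> {1..N}" "?t n > 0"
  proof (cases "m = 0")
    case True
    then show ?thesis using that[of N] Suc.prems Kpos[of N] by simp
  next
    case False
    then show ?thesis using that[of 1] Suc.prems Kpos[of 1] Suc.IH[of "N - 1"] by simp
  qed
  then show ?case unfolding ren_pf.simps
    by (intro sum_pos2[of _ n]) (auto intro!: mult_nonneg_nonneg pf_nonneg)
qed simp

lemma hom_pf_le_1: "hom_pf Kp m N \<le> 1"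
proof (induction m arbitrary: N)
  case (Suc m)
  have "hom_pf Kp (Suc m) N \<le> (\<Sum>n=1..N. pmf Kp n * 1)"
    unfolding ren_pf.simps by (intro sum_mono) (use Suc in \<open>auto intro!: mult_left_le\<close>)
  also have "\<dots> \<le> 1" using sum_K_le_1[of "{1..N}"] by simp
  finally show ?case .
qed simp

lemma hom_pf_upper:
  assumes s: "s \<ge> 0"
  shows "hom_pf Kp m N \<le> exp (s * (real N - real m)) * (pmf Kp 1 + exp (- s)) ^ m"
proof (induction m arbitrary: N)
  case (Suc m)
  let ?q = "pmf Kp 1 + exp (- s)"
  have q: "?q \<ge> 0" by (simp add: add_nonneg_nonneg)
  have "hom_pf Kp (Suc m) N = (\<Sum>n=1..N. pmf Kp n * hom_pf Kp m (N - n))" by simp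
  also have "\<dots> \<le> (\<Sum>n=1..N. pmf Kp n * (exp (s * (real (N - n) - real m)) * ?q ^ m))"
    by (intro sum_mono mult_left_mono Suc) auto
  also have "\<dots> = (exp (s * (real N - real (Suc m))) * ?q ^ m) * (\<Sum>n=1..N. pmf Kp n * exp (- s * (real n - 1)))"
    unfolding sum_distrib_left
  proof (rule sum.cong[OF refl])
    fix n assume "n \<in> {1..N}"
    then have "exp (s * (real (N - n) - real m)) = exp (s * (real N - real (Suc m))) * exp (- s * (real n - 1))"
      by (simp add: exp_add[symmetric] of_nat_diff algebra_simps)
    then show "pmf Kp n * (exp (s * (real (N - n) - real m)) * ?q ^ m)
      = (exp (s * (real N - real (Suc m))) * ?q ^ m) * (pmf Kp n * exp (- s * (real n - 1)))" by simp
  qed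
  also have "\<dots> \<le> (exp (s * (real N - real (Suc m))) * ?q ^ m) * ?q"
  proof (intro mult_left_mono mult_nonneg_nonneg zero_le_power q)
    have "(\<Sum>n=1..N. pmf Kp n * exp (- s * (real n - 1)))
        \<le> (\<Sum>n=1..N. (if n = 1 then pmf Kp 1 else 0) + pmf Kp n * exp (- s))"
    proof (intro sum_mono)
      fix n assume n: "n \<in> {1..N}"
      show "pmf Kp n * exp (- s * (real n - 1)) \<le> (if n = 1 then pmf Kp 1 else 0) + pmf Kp n * exp (- s)"
      proof (cases "n = 1")
        case False
        then have "s * 1 \<le> s * (real n - 1)" using n s by (intro mult_left_mono) auto
        then show ?thesis using False by (auto intro!: mult_left_mono)
      qed simp
    qed
    also have "\<dots> = (\<Sum>n=1..N. if n = 1 then pmf Kp 1 else 0) + (\<Sum>n=1..N. pmf Kp n) * exp (- s)"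
      by (simp add: sum.distrib sum_distrib_right)
    also have "\<dots> \<le> pmf Kp 1 + 1 * exp (- s)"
    proof (intro add_mono mult_right_mono sum_K_le_1)
      show "(\<Sum>n=1..N. if n = 1 then pmf Kp 1 else 0) \<le> pmf Kp 1"
        by (subst sum.delta) auto
    qed auto
    finally show "(\<Sum>n=1..N. pmf Kp n * exp (- s * (real n - 1))) \<le> ?q" by simp
  qed auto
  finally show ?case by (simp add: mult_ac)
qed (use s in \<open>auto intro: exp_ge_add_one_self\<close>)

lemma hom_pf_lower: "m \<le> N \<Longrightarrow> hom_pf Kp (Suc m) (Suc N) \<ge> pmf Kp 1 ^ m * pmf Kp (Suc N - m)"
proof (induction m arbitrary: N)
  case 0
  have "hom_pf Kp (Suc 0) (Suc N) \<ge> (\<Sum>n\<in>{Suc N}. pmf Kp n * hom_pf Kp 0 (Suc N - n))"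
    by simp
  then show ?case by simp
next
  case (Suc m)
  have "pmf Kp 1 ^ Suc m * pmf Kp (Suc N - Suc m) \<le> pmf Kp 1 * hom_pf Kp (Suc m) N"
    using Suc.IH[of "N - 1"] Suc.prems mult_left_mono[of "pmf Kp 1 ^ m * pmf Kp (N - m)" _ "pmf Kp 1"]
    by (cases N) (auto simp: mult.assoc)
  also have "\<dots> = (\<Sum>n\<in>{1}. pmf Kp n * hom_pf Kp (Suc m) (Suc N - n))" by simp
  also have "\<dots> \<le> (\<Sum>n=1..Suc N. pmf Kp n * hom_pf Kp (Suc m) (Suc N - n))"
    by (intro sum_mono2) (auto intro!: mult_nonneg_nonneg pf_nonneg simp del: ren_pf.simps)
  also have "\<dots> = hom_pf Kp (Suc (Suc m)) (Suc N)" by simp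
  finally show ?case .
qed

lemma hom_pf_diag: "hom_pf Kp m m \<ge> pmf Kp 1 ^ m"
  using hom_pf_lower[of "m - 1" "m - 1"] by (cases m) (auto simp: mult.commute simp del: ren_pf.simps(2))

lemma hom_pf_subdiag: "hom_pf Kp (Suc m) (Suc (Suc m)) \<ge> real (Suc m) * pmf Kp 2 * pmf Kp 1 ^ m"
proof (induction m)
  case 0
  show ?case using hom_pf_lower[of 0 1] by (simp add: numeral_2_eq_2)
next
  case (Suc m)
  have "real (Suc (Suc m)) * pmf Kp 2 * pmf Kp 1 ^ Suc m
      = pmf Kp 1 * (real (Suc m) * pmf Kp 2 * pmf Kp 1 ^ m) + pmf Kp 2 * pmf Kp 1 ^ Suc m"
    by (simp add: algebra_simps)
  also have "\<dots> \<le> pmf Kp 1 * hom_pf Kp (Suc m) (Suc (Suc m)) + pmf Kp 2 * hom_pf Kp (Suc m) (Suc m)"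
    by (intro add_mono mult_left_mono Suc hom_pf_diag) auto
  also have "\<dots> = (\<Sum>n\<in>{1,2}. pmf Kp n * hom_pf Kp (Suc m) (Suc (Suc (Suc m)) - n))" by simp
  also have "\<dots> \<le> (\<Sum>n=1..Suc (Suc (Suc m)). pmf Kp n * hom_pf Kp (Suc m) (Suc (Suc (Suc m)) - n))"
    by (intro sum_mono2) (auto intro!: mult_nonneg_nonneg pf_nonneg simp del: ren_pf.simps)
  also have "\<dots> = hom_pf Kp (Suc (Suc m)) (Suc (Suc (Suc m)))" by simp
  finally show ?case .
qed

end

lemma ren_tau_Suc_case: "ren_tau (case_nat n \<eta>) (Suc i) = n + ren_tau \<eta> i"
  unfolding ren_tau_def by (simp add: sum.lessThan_Suc_shift del: sum.lessThan_Suc)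

lemma ren_tau_0[simp]: "ren_tau \<eta> 0 = 0"
  by (simp add: ren_tau_def)

lemma strict_mono_ren_tau:
  assumes "\<And>i. \<eta> i \<ge> 1"
  shows "strict_mono (ren_tau \<eta>)"
  by (rule strict_monoI_Suc) (use assms in \<open>simp add: ren_tau_def Suc_le_eq\<close>)

lemma sum_ren_delta:
  fixes g :: "nat \<Rightarrow> 'a::comm_semiring_1"
  assumes "\<And>i. \<eta> i \<ge> 1" and "ren_tau \<eta> m = N"
  shows "(\<Sum>j=1..N. g j * of_nat (ren_delta \<eta> j)) = (\<Sum>i=1..m. g (ren_tau \<eta> i))"
proof -
  note sm = strict_mono_ren_tau[of \<eta>, OF assms(1)]
  have img: "{j \<in> {1..N}. j \<in> range (ren_tau \<eta>)} = ren_tau \<eta> ` {1..m}"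
  proof (intro equalityI subsetI)
    fix j assume "j \<in> {j \<in> {1..N}. j \<in> range (ren_tau \<eta>)}"
    then obtain i where i: "j = ren_tau \<eta> i" "1 \<le> j" "j \<le> N" by auto
    then have "i \<le> m" using assms(2) strict_mono_less_eq[OF sm, of i m] by simp
    moreover have "i \<noteq> 0" using i by (intro notI) simp
    ultimately show "j \<in> ren_tau \<eta> ` {1..m}" using i by (intro image_eqI[of _ _ i]) auto
  next
    fix j assume "j \<in> ren_tau \<eta> ` {1..m}"
    then obtain i where i: "j = ren_tau \<eta> i" "1 \<le> i" "i \<le> m" by auto
    then have "j \<le> N" using assms(2) strict_mono_less_eq[OF sm, of i m] by simp
    moreover have "1 \<le> j" using i strict_mono_less[OF sm, of 0 i] by simp
    ultimately show "j \<in> {j \<in> {1..N}. j \<in> range (ren_tau \<eta>)}" using i by auto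
  qed
  have "(\<Sum>j=1..N. g j * of_nat (ren_delta \<eta> j)) = (\<Sum>j=1..N. if j \<in> range (ren_tau \<eta>) then g j else 0)"
    by (intro sum.cong) (auto simp: ren_delta_def)
  also have "\<dots> = (\<Sum>j\<in>{j \<in> {1..N}. j \<in> range (ren_tau \<eta>)}. g j)"
    by (rule sum.inter_filter[symmetric]) simp
  also have "\<dots> = (\<Sum>i=1..m. g (ren_tau \<eta> i))"
    unfolding img by (subst sum.reindex) (auto intro: inj_on_subset[OF strict_mono_imp_inj_on[OF sm]])
  finally show ?thesis .
qed

context renewal_kernel
begin

sublocale ren: sequence_space "measure_pmf Kp" ..

lemma prob_space_renewal: "prob_space (renewal_law Kp)"
  unfolding renewal_law_def by (rule ren.P.prob_space_axioms)

lemma AE_increments: "AE \<eta> in renewal_law Kp. \<forall>i. \<eta> i \<ge> 1"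
proof -
  have "AE \<eta> in renewal_law Kp. \<eta> i \<ge> 1" for i
    unfolding renewal_law_def
  proof (rule AE_PiM_component)
    show "AE x in measure_pmf Kp. 1 \<le> x"
      unfolding AE_measure_pmf_iff using K0 by (auto simp: set_pmf_iff) (metis One_nat_def not_less_eq_eq le_0_eq)
  qed (auto intro: measure_pmf.prob_space_axioms)
  then show ?thesis by (subst AE_all_countable) simp
qed

lemma measurable_ren_tau[measurable]:
  "(\<lambda>\<eta>. ren_tau \<eta> m) \<in> measurable (Pi\<^sub>M UNIV (\<lambda>_. measure_pmf Kp)) (count_space UNIV)"
  unfolding ren_tau_def by measurable

lemma measurable_ren_delta[measurable]:
  "(\<lambda>\<eta>. ren_delta \<eta> j) \<in> measurable (Pi\<^sub>M UNIV (\<lambda>_. measure_pmf Kp)) (count_space UNIV)"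
proof -
  have "(\<lambda>\<eta>. if \<exists>i. j = ren_tau \<eta> i then 1 else 0 :: nat)
      \<in> measurable (Pi\<^sub>M UNIV (\<lambda>_. measure_pmf Kp)) (count_space UNIV)"
    by measurable
  then show ?thesis by (simp add: ren_delta_def image_iff)
qed

lemma measurable_path_weight:
  fixes \<beta> :: real and \<omega> :: "nat \<Rightarrow> real"
  shows "(\<lambda>\<eta>. exp (\<beta> * (\<Sum>i=1..m. \<omega> (ren_tau \<eta> i))) * indicator {\<eta>. ren_tau \<eta> m = N} \<eta>)
     \<in> borel_measurable (renewal_law Kp)"
proof -
  have "(\<lambda>\<eta>. exp (\<beta> * (\<Sum>i=1..m. \<omega> (ren_tau \<eta> i))) * (if ren_tau \<eta> m = N then 1 else 0 :: real))
     \<in> borel_measurable (Pi\<^sub>M UNIV (\<lambda>_. measure_pmf Kp))"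
    by measurable
  then show ?thesis by (simp add: renewal_law_def indicator_def of_bool_def)
qed

lemma nn_integral_path_weight:
  fixes \<beta> :: real and \<omega> :: "nat \<Rightarrow> real"
  shows "(\<integral>\<^sup>+\<eta>. ennreal (exp (\<beta> * (\<Sum>i=1..m. \<omega> (ren_tau \<eta> i))) * indicator {\<eta>. ren_tau \<eta> m = N} \<eta>) \<partial>renewal_law Kp)
    = ennreal (ren_pf Kp \<beta> m N \<omega>)"
proof (induction m arbitrary: N \<omega>)
  case 0
  interpret P: prob_space "renewal_law Kp" by (rule prob_space_renewal)
  show ?case by (cases "N = 0") (simp_all add: P.emeasure_space_1)
next
  case (Suc m)
  let ?R = "renewal_law Kp"
  let ?w = "\<lambda>m N \<omega> \<eta>. exp (\<beta> * (\<Sum>i=1..m. \<omega> (ren_tau \<eta> i))) * indicator {\<eta>. ren_tau \<eta> m = N} \<eta>"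
  have eq: "?w (Suc m) N \<omega> (case_nat n \<eta>)
      = (if n \<le> N then exp (\<beta> * \<omega> n) * ?w m (N - n) (\<lambda>j. \<omega> (j + n)) \<eta> else 0)" for n \<eta>
  proof -
    have "(\<Sum>i=1..Suc m. \<omega> (ren_tau (case_nat n \<eta>) i)) = (\<Sum>i=0..m. \<omega> (n + ren_tau \<eta> i))"
      using sum.shift_bounds_cl_Suc_ivl[of "\<lambda>i. \<omega> (ren_tau (case_nat n \<eta>) i)" 0 m]
      by (simp add: ren_tau_Suc_case del: sum.cl_ivl_Suc)
    also have "\<dots> = \<omega> n + (\<Sum>i=1..m. \<omega> (ren_tau \<eta> i + n))"
      by (subst sum.atLeast_Suc_atMost) (simp_all add: add.commute)
    finally have s: "(\<Sum>i=1..Suc m. \<omega> (ren_tau (case_nat n \<eta>) i)) = \<omega> n + (\<Sum>i=1..m. \<omega> (ren_tau \<eta> i + n))" .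
    have i: "ren_tau (case_nat n \<eta>) (Suc m) = N \<longleftrightarrow> n \<le> N \<and> ren_tau \<eta> m = N - n"
      by (auto simp: ren_tau_Suc_case)
    show ?thesis unfolding s by (auto simp: indicator_def i distrib_left exp_add)
  qed
  have "(\<integral>\<^sup>+\<eta>. ennreal (?w (Suc m) N \<omega> \<eta>) \<partial>?R)
     = (\<integral>\<^sup>+n. \<integral>\<^sup>+\<eta>. ennreal (?w (Suc m) N \<omega> (case_nat n \<eta>)) \<partial>?R \<partial>measure_pmf Kp)"
    unfolding renewal_law_def using measurable_path_weight[unfolded renewal_law_def]
    by (intro ren.nn_integral_case_nat) measurable
  also have "\<dots> = (\<integral>\<^sup>+n. (if n \<le> N then ennreal (exp (\<beta> * \<omega> n) * ren_pf Kp \<beta> m (N - n) (\<lambda>j. \<omega> (j + n))) else 0) \<partial>measure_pmf Kp)"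
  proof (rule nn_integral_cong)
    fix n
    have "(\<integral>\<^sup>+\<eta>. ennreal (exp (\<beta> * \<omega> n) * ?w m (N - n) (\<lambda>j. \<omega> (j + n)) \<eta>) \<partial>?R)
       = ennreal (exp (\<beta> * \<omega> n)) * (\<integral>\<^sup>+\<eta>. ennreal (?w m (N - n) (\<lambda>j. \<omega> (j + n)) \<eta>) \<partial>?R)"
      using measurable_compose[OF measurable_path_weight[of \<beta> "\<lambda>j. \<omega> (j + n)" m "N - n"] measurable_ennreal]
      by (subst nn_integral_cmult[symmetric]) (simp_all add: ennreal_mult'[symmetric] del: One_nat_def)
    also have "\<dots> = ennreal (exp (\<beta> * \<omega> n) * ren_pf Kp \<beta> m (N - n) (\<lambda>j. \<omega> (j + n)))"
      by (subst Suc.IH) (simp add: ennreal_mult pf_nonneg)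
    finally show "(\<integral>\<^sup>+\<eta>. ennreal (?w (Suc m) N \<omega> (case_nat n \<eta>)) \<partial>?R) =
      (if n \<le> N then ennreal (exp (\<beta> * \<omega> n) * ren_pf Kp \<beta> m (N - n) (\<lambda>j. \<omega> (j + n))) else 0)"
      unfolding eq by simp
  qed
  also have "\<dots> = (\<Sum>n=1..N. (if n \<le> N then ennreal (exp (\<beta> * \<omega> n) * ren_pf Kp \<beta> m (N - n) (\<lambda>j. \<omega> (j + n))) else 0) * ennreal (pmf Kp n))"
  proof (rule nn_integral_measure_pmf_support)
    fix n assume n: "n \<in> set_pmf Kp" "n \<notin> {1..N}"
    then have "n \<noteq> 0" using K0 by (metis set_pmf_iff)
    then show "(if n \<le> N then ennreal (exp (\<beta> * \<omega> n) * ren_pf Kp \<beta> m (N - n) (\<lambda>j. \<omega> (j + n))) else 0) = 0"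
      using n by auto
  qed auto
  also have "\<dots> = (\<Sum>n=1..N. ennreal (pmf Kp n * exp (\<beta> * \<omega> n) * ren_pf Kp \<beta> m (N - n) (\<lambda>j. \<omega> (j + n))))"
    by (intro sum.cong) (auto simp: ennreal_mult pf_nonneg mult_ac)
  also have "\<dots> = ennreal (ren_pf Kp \<beta> (Suc m) N \<omega>)"
    unfolding ren_pf.simps by (rule sum_ennreal) (auto intro!: mult_nonneg_nonneg pf_nonneg)
  finally show ?case .
qed

lemma path_weight:
  fixes \<beta> :: real and \<omega> :: "nat \<Rightarrow> real"
  shows "integrable (renewal_law Kp)
      (\<lambda>\<eta>. exp (\<beta> * (\<Sum>i=1..m. \<omega> (ren_tau \<eta> i))) * indicator {\<eta>. ren_tau \<eta> m = N} \<eta>)" (is ?A)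
    and "(\<integral>\<eta>. exp (\<beta> * (\<Sum>i=1..m. \<omega> (ren_tau \<eta> i))) * indicator {\<eta>. ren_tau \<eta> m = N} \<eta> \<partial>renewal_law Kp)
      = ren_pf Kp \<beta> m N \<omega>" (is ?B)
proof -
  show ?A
    by (rule integrableI_nonneg[OF measurable_path_weight]) (auto simp: nn_integral_path_weight simp del: One_nat_def)
  show ?B
    by (subst integral_eq_nn_integral[OF measurable_path_weight])
      (auto simp: nn_integral_path_weight pf_nonneg simp del: One_nat_def)
qed

lemma constrained_pf_eq: "constrained_pf Kp \<beta> \<omega> N m = ren_pf Kp \<beta> m N \<omega>"
proof -
  have "constrained_pf Kp \<beta> \<omega> N m
    = (\<integral>\<eta>. exp (\<beta> * (\<Sum>i=1..m. \<omega> (ren_tau \<eta> i))) * indicator {\<eta>. ren_tau \<eta> m = N} \<eta> \<partial>renewal_law Kp)"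
    unfolding constrained_pf_def
  proof (rule integral_cong_AE)
    show eq: "AE \<eta> in renewal_law Kp. exp (\<beta> * (\<Sum>j = 1..N. \<omega> j * real (ren_delta \<eta> j))) * indicat_real {\<eta>. ren_tau \<eta> m = N} \<eta> =
        exp (\<beta> * (\<Sum>i = 1..m. \<omega> (ren_tau \<eta> i))) * indicat_real {\<eta>. ren_tau \<eta> m = N} \<eta>"
      using AE_increments by eventually_elim (auto simp: indicator_def sum_ren_delta[where g = \<omega>] simp del: One_nat_def)
    have "(\<lambda>\<eta>. exp (\<beta> * (\<Sum>j = 1..N. \<omega> j * real (ren_delta \<eta> j))) * (if ren_tau \<eta> m = N then 1 else 0))
      \<in> borel_measurable (Pi\<^sub>M UNIV (\<lambda>_. measure_pmf Kp))" by measurable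
    then show "(\<lambda>\<eta>. exp (\<beta> * (\<Sum>j = 1..N. \<omega> j * real (ren_delta \<eta> j))) * indicat_real {\<eta>. ren_tau \<eta> m = N} \<eta>)
      \<in> borel_measurable (renewal_law Kp)"
      by (simp add: renewal_law_def indicator_def of_bool_def)
  qed (rule measurable_path_weight)
  then show ?thesis by (simp add: path_weight del: One_nat_def)
qed

lemma Z_Psi_eq:
  assumes N: "N \<ge> 1"
  shows "Z_Psi Kp Q H \<beta> h \<omega> N = (\<Sum>m=1..N. exp (h * real m) * Psi Q H m N * ren_pf Kp \<beta> m N \<omega>)"
proof -
  let ?w = "\<lambda>m \<eta>. exp (\<beta> * (\<Sum>i=1..m. \<omega> (ren_tau \<eta> i))) * indicator {\<eta>. ren_tau \<eta> m = N} \<eta>"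
  have "Z_Psi Kp Q H \<beta> h \<omega> N
    = (\<integral>\<eta>. (\<Sum>m=1..N. exp (h * real m) * Psi Q H m N * ?w m \<eta>) \<partial>renewal_law Kp)"
    unfolding Z_Psi_def
  proof (rule integral_cong_AE)
    show "AE \<eta> in renewal_law Kp. exp (\<Sum>j = 1..N. (\<beta> * \<omega> j + h) * real (ren_delta \<eta> j)) * Psi Q H (\<Sum>j = 1..N. ren_delta \<eta> j) N * real (ren_delta \<eta> N)
      = (\<Sum>m=1..N. exp (h * real m) * Psi Q H m N * ?w m \<eta>)"
      using AE_increments
    proof eventually_elim
      case (elim \<eta>)
      note sm = strict_mono_ren_tau[of \<eta>, OF elim[rule_format]]
      show ?case
      proof (cases "N \<in> range (ren_tau \<eta>)")
        case False
        then have "?w m \<eta> = 0" for m by (auto simp: indicator_def)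
        then show ?thesis using False by (simp add: ren_delta_def)
      next
        case True
        then obtain m where m: "ren_tau \<eta> m = N" by auto
        have m1: "m \<noteq> 0" using m N by (intro notI) simp
        have mN: "m \<le> N" using strict_mono_imp_increasing[OF sm, of m] m by simp
        have u: "ren_tau \<eta> i = N \<longleftrightarrow> i = m" for i using m strict_mono_eq[OF sm, of i m] by auto
        have "(\<Sum>m=1..N. exp (h * real m) * Psi Q H m N * ?w m \<eta>)
           = (\<Sum>i=1..N. if i = m then exp (h * real m) * Psi Q H m N * exp (\<beta> * (\<Sum>i=1..m. \<omega> (ren_tau \<eta> i))) else 0)"
          by (intro sum.cong) (auto simp: indicator_def u)
        also have "\<dots> = exp (h * real m) * Psi Q H m N * exp (\<beta> * (\<Sum>i=1..m. \<omega> (ren_tau \<eta> i)))"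
          using m1 mN by simp
        finally have R: "(\<Sum>m=1..N. exp (h * real m) * Psi Q H m N * ?w m \<eta>) = \<dots>" .
        have "(\<Sum>j = 1..N. (\<beta> * \<omega> j + h) * real (ren_delta \<eta> j)) = (\<Sum>i=1..m. \<beta> * \<omega> (ren_tau \<eta> i) + h)"
          by (rule sum_ren_delta) (use elim m in auto)
        also have "\<dots> = \<beta> * (\<Sum>i=1..m. \<omega> (ren_tau \<eta> i)) + h * real m"
          by (simp add: sum.distrib sum_distrib_left)
        moreover have "(\<Sum>j = 1..N. ren_delta \<eta> j) = m"
          using sum_ren_delta[of \<eta> m N "\<lambda>_. 1::nat"] elim m by simp
        moreover have "ren_delta \<eta> N = 1" using True by (simp add: ren_delta_def)
        ultimately show ?thesis unfolding R by (simp add: exp_add)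
      qed
    qed
    show "(\<lambda>\<eta>. exp (\<Sum>j = 1..N. (\<beta> * \<omega> j + h) * real (ren_delta \<eta> j)) * Psi Q H (\<Sum>j = 1..N. ren_delta \<eta> j) N * real (ren_delta \<eta> N))
      \<in> borel_measurable (renewal_law Kp)"
      unfolding renewal_law_def by measurable
    show "(\<lambda>\<eta>. (\<Sum>m=1..N. exp (h * real m) * Psi Q H m N * ?w m \<eta>)) \<in> borel_measurable (renewal_law Kp)"
      by (intro borel_measurable_sum borel_measurable_times measurable_path_weight) auto
  qed
  also have "\<dots> = (\<Sum>m=1..N. exp (h * real m) * Psi Q H m N * ren_pf Kp \<beta> m N \<omega>)"
    by (subst Bochner_Integration.integral_sum) (auto intro!: integrable_mult_right path_weight sum.cong simp: path_weight simp del: One_nat_def)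
  finally show ?thesis .
qed

end

lemma coord_lipschitz_ln:
  assumes nn: "\<And>\<omega>. Z \<omega> \<ge> 0"
    and Z: "\<And>\<omega> \<omega>'. Z \<omega> \<le> exp (b * (\<Sum>j<n. \<bar>\<omega> j - \<omega>' j\<bar>)) * Z \<omega>'" and b: "b \<ge> 0"
  shows "coord_lipschitz b n (\<lambda>\<omega>. ln (Z \<omega>))"
  unfolding coord_lipschitz_def
proof (intro allI)
  fix \<omega> \<omega>'
  show "ln (Z \<omega>) - ln (Z \<omega>') \<le> b * (\<Sum>j<n. \<bar>\<omega> j - \<omega>' j\<bar>)"
  proof (cases "Z \<omega> = 0")
    case True
    then have "Z \<omega>' \<le> 0" using Z[of \<omega>' \<omega>] by simp
    then have "Z \<omega>' = 0" using nn[of \<omega>'] by simp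
    then show ?thesis using True b by (simp add: sum_nonneg)
  next
    case False
    then have p: "Z \<omega> > 0" using nn[of \<omega>] by simp
    then have "0 < exp (b * (\<Sum>j<n. \<bar>\<omega> j - \<omega>' j\<bar>)) * Z \<omega>'" using Z[of \<omega> \<omega>'] by linarith
    then have p': "Z \<omega>' > 0" by (simp add: zero_less_mult_iff)
    have "ln (Z \<omega>) \<le> ln (exp (b * (\<Sum>j<n. \<bar>\<omega> j - \<omega>' j\<bar>)) * Z \<omega>')"
      by (rule ln_mono[OF Z p])
    then show ?thesis using p' by (simp add: ln_mult)
  qed
qed

locale disordered_renewal = iid_disorder \<mu> + renewal_kernel Kp
  for \<mu> :: "real measure" and Kp :: "nat pmf" +
  fixes \<beta> :: real
  assumes beta_nonneg: "\<beta> \<ge> 0"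
begin

lemma measurable_shift: "(\<lambda>\<omega> j. \<omega> (j + n)) \<in> measurable \<P> \<P>"
  unfolding disorder_law_def by (rule measurable_PiM_single') (auto simp: space_PiM)

lemma measurable_coord[measurable]: "(\<lambda>\<omega>. \<omega> n) \<in> borel_measurable \<P>"
proof -
  have "(\<lambda>\<omega>. \<omega> n) \<in> measurable \<P> \<mu>" unfolding disorder_law_def by measurable
  then show ?thesis using measurable_cong_sets[OF refl sets_mu] by blast
qed

lemma measurable_pf[measurable]: "ren_pf Kp \<beta> m N \<in> borel_measurable \<P>"
proof (induction m arbitrary: N)
  case 0
  have "ren_pf Kp \<beta> 0 N = (\<lambda>_. if N = 0 then 1 else 0)" by (rule ext) simp
  then show ?case by simp
next
  case (Suc m)
  have "ren_pf Kp \<beta> (Suc m) N = (\<lambda>\<omega>. \<Sum>n=1..N. pmf Kp n * exp (\<beta> * \<omega> n) * ren_pf Kp \<beta> m (N - n) (\<lambda>j. \<omega> (j + n)))"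
    by (rule ext) simp
  moreover have m: "(\<lambda>\<omega>. ren_pf Kp \<beta> m (N - n) (\<lambda>j. \<omega> (j + n))) \<in> borel_measurable \<P>" for n
    by (rule measurable_compose[OF measurable_shift Suc])
  have "(\<lambda>\<omega>. \<Sum>n=1..N. pmf Kp n * exp (\<beta> * \<omega> n) * ren_pf Kp \<beta> m (N - n) (\<lambda>j. \<omega> (j + n)))
     \<in> borel_measurable \<P>"
    by (intro borel_measurable_sum borel_measurable_times m) measurable
  ultimately show ?case by simp
qed

lemma coord_lipschitz_ln_pf: "coord_lipschitz \<beta> (Suc N) (\<lambda>\<omega>. ln (ren_pf Kp \<beta> m N \<omega>))"
  by (rule coord_lipschitz_ln[OF pf_nonneg pf_lipschitz beta_nonneg]) (rule beta_nonneg)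

lemma integrable_ln_pf: "integrable \<P> (\<lambda>\<omega>. ln (ren_pf Kp \<beta> m N \<omega>))"
  by (rule coord_lipschitz_integrable[OF _ coord_lipschitz_ln_pf]) measurable

lemma shift_invariant:
  fixes F :: "(nat \<Rightarrow> real) \<Rightarrow> real"
  assumes F: "integrable \<P> F"
  shows "integrable \<P> (\<lambda>\<omega>. F (\<lambda>j. \<omega> (j + k)))"
    and "(\<integral>\<omega>. F (\<lambda>j. \<omega> (j + k)) \<partial>\<P>) = (integral\<^sup>L \<P> F)"
proof -
  have d: "distr \<P> \<P> (\<lambda>\<omega> j. \<omega> (j + k)) = \<P>"
    unfolding disorder_law_def by (rule seq.distr_shift)
  have m: "F \<in> borel_measurable \<P>" using F by auto
  show "integrable \<P> (\<lambda>\<omega>. F (\<lambda>j. \<omega> (j + k)))"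
    using F integrable_distr_eq[OF measurable_shift[of k] m] unfolding d by simp
  show "(\<integral>\<omega>. F (\<lambda>j. \<omega> (j + k)) \<partial>\<P>) = (integral\<^sup>L \<P> F)"
    using integral_distr[OF measurable_shift[of k] m] unfolding d by simp
qed

definition mean_ln_pf :: "nat \<Rightarrow> nat \<Rightarrow> real" where
  "mean_ln_pf N m = (\<integral>\<omega>. ln (ren_pf Kp \<beta> m N \<omega>) \<partial>\<P>)"

lemma mean_ln_pf_superadditive:
  assumes "1 \<le> m" "m \<le> N" "1 \<le> n" "n \<le> M"
  shows "mean_ln_pf N m + mean_ln_pf M n \<le> mean_ln_pf (N + M) (m + n)"
proof -
  have "mean_ln_pf N m + mean_ln_pf M n
     = (\<integral>\<omega>. ln (ren_pf Kp \<beta> m N \<omega>) \<partial>\<P>) + (\<integral>\<omega>. ln (ren_pf Kp \<beta> n M (\<lambda>j. \<omega> (j + N))) \<partial>\<P>)"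
    unfolding mean_ln_pf_def by (simp add: shift_invariant(2)[OF integrable_ln_pf])
  also have "\<dots> = (\<integral>\<omega>. ln (ren_pf Kp \<beta> m N \<omega>) + ln (ren_pf Kp \<beta> n M (\<lambda>j. \<omega> (j + N))) \<partial>\<P>)"
    by (intro Bochner_Integration.integral_add[symmetric] integrable_ln_pf shift_invariant(1)[OF integrable_ln_pf])
  also have "\<dots> \<le> mean_ln_pf (N + M) (m + n)"
    unfolding mean_ln_pf_def
  proof (rule integral_mono[OF Bochner_Integration.integrable_add[OF integrable_ln_pf shift_invariant(1)[OF integrable_ln_pf]] integrable_ln_pf])
    fix \<omega>
    have "ren_pf Kp \<beta> m N \<omega> > 0" "ren_pf Kp \<beta> n M (\<lambda>j. \<omega> (j + N)) > 0" using assms by (auto intro!: pf_pos)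
    then show "ln (ren_pf Kp \<beta> m N \<omega>) + ln (ren_pf Kp \<beta> n M (\<lambda>j. \<omega> (j + N))) \<le> ln (ren_pf Kp \<beta> (m + n) (N + M) \<omega>)"
      using ln_mono[OF pf_supermult[of Kp \<beta> m N \<omega> n M]] by (simp add: ln_mult_pos)
  qed
  finally show ?thesis .
qed

text \<open>Jensen's inequality: the disorder has mean zero, so the averaged energy of every path vanishes.\<close>

lemma mean_ln_pf_ge_homogeneous:
  assumes "m \<le> N" "m = 0 \<longrightarrow> N = 0"
  shows "ln (hom_pf Kp m N) \<le> mean_ln_pf N m"
  using assms
proof (induction m arbitrary: N)
  case 0
  then show ?case by (simp add: mean_ln_pf_def)
next
  case (Suc m)
  interpret P: prob_space \<P> by (rule prob_space_disorder)
  define adm where "adm n \<longleftrightarrow> m \<le> N - n \<and> (m = 0 \<longrightarrow> N - n = 0)" for n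
  define p where "p n = pmf Kp n * hom_pf Kp m (N - n)" for n
  define y where "y n \<omega> = \<beta> * \<omega> n + (ln (ren_pf Kp \<beta> m (N - n) (\<lambda>j. \<omega> (j + n))) - ln (hom_pf Kp m (N - n)))" for n \<omega>
  have p0: "p n \<ge> 0" for n by (simp add: p_def pf_nonneg)
  have iy: "integrable \<P> (y n)" for n
    unfolding y_def
    using disorder_component(1)[OF integrable_id, of n] shift_invariant(1)[OF integrable_ln_pf, of m "N - n" n]
    by (intro Bochner_Integration.integrable_add Bochner_Integration.integrable_diff integrable_mult_right
        P.integrable_const)
  have Ey: "(\<integral>\<omega>. y n \<omega> \<partial>\<P>) = mean_ln_pf (N - n) m - ln (hom_pf Kp m (N - n))" for n
    unfolding y_def mean_ln_pf_def
    using disorder_component[OF integrable_id, of n] shift_invariant[OF integrable_ln_pf, of m "N - n" n]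
    by (simp add: mean P.prob_space)
  have pE: "p n * (\<integral>\<omega>. y n \<omega> \<partial>\<P>) \<ge> 0" if "n \<in> {1..N}" for n
  proof (cases "adm n")
    case True
    then have "(\<integral>\<omega>. y n \<omega> \<partial>\<P>) \<ge> 0" unfolding Ey using Suc.IH[of "N - n"] by (simp add: adm_def)
    then show ?thesis using p0 by simp
  next
    case False
    then have "p n = 0" unfolding p_def adm_def by (subst pf_eq_0) auto
    then show ?thesis by simp
  qed
  have sp: "sum p {1..N} = hom_pf Kp (Suc m) N" by (simp add: p_def)
  have spos: "sum p {1..N} > 0" unfolding sp using Suc.prems by (intro pf_pos) auto
  have key: "ln (hom_pf Kp (Suc m) N) + (\<Sum>n=1..N. p n * y n \<omega>) / hom_pf Kp (Suc m) N \<le> ln (ren_pf Kp \<beta> (Suc m) N \<omega>)" for \<omega>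
  proof -
    have "p n * exp (y n \<omega>) = pmf Kp n * exp (\<beta> * \<omega> n) * ren_pf Kp \<beta> m (N - n) (\<lambda>j. \<omega> (j + n))" if "n \<in> {1..N}" for n
    proof (cases "adm n")
      case False
      then have "ren_pf Kp b m (N - n) \<omega>' = 0" for b \<omega>'
        unfolding adm_def by (intro pf_eq_0) auto
      then show ?thesis by (simp add: p_def)
    next
      case True
      then have pos: "ren_pf Kp b m (N - n) \<omega>' > 0" for b \<omega>'
        unfolding adm_def by (cases "m = 0") (auto intro!: pf_pos)
      show ?thesis using pos[of 0 "\<lambda>_. 0"] pos[of \<beta> "\<lambda>j. \<omega> (j + n)"]
        by (simp add: p_def y_def exp_add exp_diff)
    qed
    then have e: "ren_pf Kp \<beta> (Suc m) N \<omega> = (\<Sum>n=1..N. p n * exp (y n \<omega>))" by simp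
    show ?thesis
      unfolding sp[symmetric] e by (rule ln_sum_exp_ge) (use p0 spos in auto)
  qed
  have "0 \<le> (\<Sum>n=1..N. p n * (\<integral>\<omega>. y n \<omega> \<partial>\<P>)) / hom_pf Kp (Suc m) N"
    by (intro divide_nonneg_nonneg sum_nonneg pE pf_nonneg)
  then have le1: "ln (hom_pf Kp (Suc m) N) \<le> ln (hom_pf Kp (Suc m) N) + (\<Sum>n=1..N. p n * (\<integral>\<omega>. y n \<omega> \<partial>\<P>)) / hom_pf Kp (Suc m) N"
    by (rule le_add_same_cancel1[THEN iffD2])
  have eq2: "ln (hom_pf Kp (Suc m) N) + (\<Sum>n=1..N. p n * (\<integral>\<omega>. y n \<omega> \<partial>\<P>)) / hom_pf Kp (Suc m) N
      = (\<integral>\<omega>. ln (hom_pf Kp (Suc m) N) + (\<Sum>n=1..N. p n * y n \<omega>) / hom_pf Kp (Suc m) N \<partial>\<P>)"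
  proof -
    have i: "integrable \<P> (\<lambda>\<omega>. \<Sum>n=1..N. p n * y n \<omega>)"
      by (rule Bochner_Integration.integrable_sum, rule integrable_mult_right, rule iy)
    have "(\<integral>\<omega>. (\<Sum>n=1..N. p n * y n \<omega>) \<partial>\<P>) = (\<Sum>n=1..N. p n * (\<integral>\<omega>. y n \<omega> \<partial>\<P>))"
      by (subst Bochner_Integration.integral_sum) (use iy in auto)
    with i show ?thesis by (simp add: P.prob_space del: ren_pf.simps)
  qed
  have le3: "(\<integral>\<omega>. ln (hom_pf Kp (Suc m) N) + (\<Sum>n=1..N. p n * y n \<omega>) / hom_pf Kp (Suc m) N \<partial>\<P>) \<le> mean_ln_pf N (Suc m)"
    unfolding mean_ln_pf_def
  proof (rule integral_mono[OF _ integrable_ln_pf key])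
    have "integrable \<P> (\<lambda>\<omega>. \<Sum>n=1..N. p n * y n \<omega>)"
      by (rule Bochner_Integration.integrable_sum, rule integrable_mult_right, rule iy)
    then show "integrable \<P> (\<lambda>\<omega>. ln (hom_pf Kp (Suc m) N) + (\<Sum>n=1..N. p n * y n \<omega>) / hom_pf Kp (Suc m) N)"
      by (intro Bochner_Integration.integrable_add P.integrable_const integrable_divide)
  qed
  show ?case by (rule order_trans[OF le1[unfolded eq2] le3])
qed

lemma mean_ln_pf_upper_few:
  assumes T: "T > 0" and m: "1 \<le> m" "m \<le> N"
  shows "mean_ln_pf N m \<le> \<beta> * (real N / T + T * real m)"
proof -
  interpret P: prob_space \<P> by (rule prob_space_disorder)
  have i: "integrable \<P> (\<lambda>\<omega>. (\<omega> j)\<^sup>2)" for j by (rule disorder_component[OF integrable_sq])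
  have "mean_ln_pf N m \<le> (\<integral>\<omega>. \<beta> * ((\<Sum>j=1..N. (\<omega> j)\<^sup>2 / T) + T * real m) \<partial>\<P>)"
    unfolding mean_ln_pf_def
  proof (rule integral_mono[OF integrable_ln_pf])
    show "integrable \<P> (\<lambda>\<omega>. \<beta> * ((\<Sum>j=1..N. (\<omega> j)\<^sup>2 / T) + T * real m))"
      using i by simp
    fix \<omega>
    have "ren_pf Kp \<beta> m N \<omega> \<le> exp (\<beta> * ((\<Sum>j=1..N. (\<omega> j)\<^sup>2 / T) + T * real m)) * hom_pf Kp m N"
      by (rule pf_upper_few[OF beta_nonneg T])
    also have "\<dots> \<le> exp (\<beta> * ((\<Sum>j=1..N. (\<omega> j)\<^sup>2 / T) + T * real m)) * 1"
      by (intro mult_left_mono hom_pf_le_1) auto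
    finally show "ln (ren_pf Kp \<beta> m N \<omega>) \<le> \<beta> * ((\<Sum>j=1..N. (\<omega> j)\<^sup>2 / T) + T * real m)"
      using pf_pos[OF m, of \<beta> \<omega>] ln_le_cancel_iff[of "ren_pf Kp \<beta> m N \<omega>" "exp (\<beta> * ((\<Sum>j=1..N. (\<omega> j)\<^sup>2 / T) + T * real m))"]
      by simp
  qed
  also have "\<dots> = \<beta> * (real N / T + T * real m)"
    using i disorder_component(2)[OF integrable_sq] by (simp add: var P.prob_space)
  finally show ?thesis .
qed

lemma mean_ln_pf_upper_many:
  assumes T: "T > 0" and s: "s \<ge> 0" and m: "1 \<le> m" "m \<le> N"
  shows "mean_ln_pf N m \<le> \<beta> * (real N / T + T * (real N - real m)) + s * (real N - real m)
    + real m * ln (pmf Kp 1 + exp (- s))"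
proof -
  interpret P: prob_space \<P> by (rule prob_space_disorder)
  have i: "integrable \<P> (\<lambda>\<omega>. (\<omega> j)\<^sup>2)" "integrable \<P> (\<lambda>\<omega>. \<omega> j)" for j
    by (rule disorder_component(1)[OF integrable_sq], rule disorder_component(1)[OF integrable_id])
  define R where "R = s * (real N - real m) + real m * ln (pmf Kp 1 + exp (- s))"
  have q: "pmf Kp 1 + exp (- s) > 0" by (simp add: add_nonneg_pos)
  have W: "ln (hom_pf Kp m N) \<le> R"
  proof -
    have "ln (hom_pf Kp m N) \<le> ln (exp (s * (real N - real m)) * (pmf Kp 1 + exp (- s)) ^ m)"
      by (rule ln_mono[OF hom_pf_upper[OF s] pf_pos[OF m]])
    also have "\<dots> = R" using q unfolding R_def by (simp add: ln_mult ln_realpow del: One_nat_def)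
    finally show ?thesis .
  qed
  have "mean_ln_pf N m \<le> (\<integral>\<omega>. \<beta> * ((\<Sum>j=1..N. \<omega> j) + (\<Sum>j=1..N. (\<omega> j)\<^sup>2 / T) + T * (real N - real m)) + R \<partial>\<P>)"
    unfolding mean_ln_pf_def
  proof (rule integral_mono[OF integrable_ln_pf])
    show "integrable \<P> (\<lambda>\<omega>. \<beta> * ((\<Sum>j=1..N. \<omega> j) + (\<Sum>j=1..N. (\<omega> j)\<^sup>2 / T) + T * (real N - real m)) + R)"
      using i by simp
    fix \<omega>
    let ?e = "\<beta> * ((\<Sum>j=1..N. \<omega> j) + (\<Sum>j=1..N. (\<omega> j)\<^sup>2 / T) + T * (real N - real m))"
    have "ln (ren_pf Kp \<beta> m N \<omega>) \<le> ln (exp ?e * hom_pf Kp m N)"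
      by (rule ln_mono[OF pf_upper_many[OF beta_nonneg T] pf_pos[OF m]])
    also have "\<dots> = ?e + ln (hom_pf Kp m N)" using pf_pos[OF m, of 0 "\<lambda>_. 0"] by (simp add: ln_mult)
    finally show "ln (ren_pf Kp \<beta> m N \<omega>) \<le> ?e + R" using W by linarith
  qed
  also have "\<dots> = \<beta> * (real N / T + T * (real N - real m)) + R"
  proof -
    have "(\<integral>\<omega>. (\<Sum>j=1..N. \<omega> j) \<partial>\<P>) = 0"
      by (subst Bochner_Integration.integral_sum) (simp_all add: i disorder_component(2)[OF integrable_id] mean)
    moreover have "(\<integral>\<omega>. (\<Sum>j=1..N. (\<omega> j)\<^sup>2 / T) \<partial>\<P>) = real N / T"
      by (subst Bochner_Integration.integral_sum) (simp_all add: i disorder_component(2)[OF integrable_sq] var)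
    moreover have "integrable \<P> (\<lambda>\<omega>. \<Sum>j=1..N. \<omega> j)" "integrable \<P> (\<lambda>\<omega>. \<Sum>j=1..N. (\<omega> j)\<^sup>2 / T)"
      by (simp_all add: i)
    ultimately show ?thesis by (simp add: P.prob_space)
  qed
  finally show ?thesis by (simp add: R_def)
qed

lemma mean_ln_pf_lower:
  assumes "1 \<le> m" "m \<le> N"
  shows "real m * ln (pmf Kp 1) + ln (pmf Kp (N - m + 1)) \<le> mean_ln_pf N m"
proof -
  have K1: "pmf Kp 1 > 0" "ln (pmf Kp 1) \<le> 0" using Kpos[of 1] pmf_le_1[of Kp 1] by auto
  have K: "pmf Kp (N - m + 1) > 0" by (rule Kpos) simp
  have "real m * ln (pmf Kp 1) + ln (pmf Kp (N - m + 1)) \<le> real (m - 1) * ln (pmf Kp 1) + ln (pmf Kp (N - m + 1))"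
    using K1 assms by (simp add: of_nat_diff algebra_simps)
  also have "\<dots> = ln (pmf Kp 1 ^ (m - 1) * pmf Kp (N - m + 1))"
    using K1 K by (simp add: ln_mult ln_realpow)
  also have "\<dots> \<le> ln (hom_pf Kp m N)"
  proof (rule ln_mono[rotated])
    show "0 < pmf Kp 1 ^ (m - 1) * pmf Kp (N - m + 1)" using K1 K by simp
    have "N - m + 1 = Suc (N - 1) - (m - 1)" using assms by simp
    then show "pmf Kp 1 ^ (m - 1) * pmf Kp (N - m + 1) \<le> hom_pf Kp m N"
      using hom_pf_lower[of "m - 1" "N - 1"] assms by (simp del: ren_pf.simps)
  qed
  also have "\<dots> \<le> mean_ln_pf N m" using assms by (intro mean_ln_pf_ge_homogeneous) auto
  finally show ?thesis .
qed

lemma mean_ln_pf_subdiag: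
  "ln (real (Suc m)) + ln (pmf Kp 2) + real m * ln (pmf Kp 1) \<le> mean_ln_pf (Suc (Suc m)) (Suc m)"
proof -
  have K: "pmf Kp 1 > 0" "pmf Kp 2 > 0" using Kpos by auto
  have "ln (real (Suc m)) + ln (pmf Kp 2) + real m * ln (pmf Kp 1) = ln (real (Suc m) * pmf Kp 2 * pmf Kp 1 ^ m)"
    using K by (simp add: ln_mult ln_realpow del: One_nat_def)
  also have "\<dots> \<le> ln (hom_pf Kp (Suc m) (Suc (Suc m)))"
    using K by (intro ln_mono hom_pf_subdiag) auto
  also have "\<dots> \<le> mean_ln_pf (Suc (Suc m)) (Suc m)" by (intro mean_ln_pf_ge_homogeneous) auto
  finally show ?thesis .
qed

end

section \<open>Superadditive arrays\<close>

definition ratio_limit :: "(nat \<Rightarrow> nat \<Rightarrow> real) \<Rightarrow> real \<Rightarrow> real \<Rightarrow> bool" where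
  "ratio_limit a \<rho> L \<longleftrightarrow> (\<forall>\<epsilon>>0. \<exists>\<delta>>0. \<exists>N1. \<forall>N m. N1 \<le> N \<longrightarrow> 1 \<le> m \<longrightarrow> m \<le> N \<longrightarrow>
      \<bar>real m / real N - \<rho>\<bar> < \<delta> \<longrightarrow> \<bar>a N m / real N - L\<bar> \<le> \<epsilon>)"

definition lattice_point :: "real \<Rightarrow> nat \<Rightarrow> nat" where
  "lattice_point \<rho> N = max 1 (nat \<lfloor>\<rho> * real N\<rfloor>)"

lemma lattice_point_ge_1: "1 \<le> lattice_point \<rho> N"
  by (simp add: lattice_point_def)

lemma lattice_point_le:
  assumes "\<rho> \<le> 1" "1 \<le> N"
  shows "lattice_point \<rho> N \<le> N"
proof -
  have "\<rho> * real N \<le> 1 * real N" using assms by (intro mult_right_mono) auto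
  then have "\<lfloor>\<rho> * real N\<rfloor> \<le> int N" by linarith
  then show ?thesis using assms by (simp add: lattice_point_def)
qed

lemma lattice_point_bounds:
  assumes "0 \<le> \<rho>"
  shows "\<rho> * real N - 1 \<le> real (lattice_point \<rho> N)" "real (lattice_point \<rho> N) \<le> \<rho> * real N + 1"
proof -
  have "0 \<le> \<rho> * real N" using assms by simp
  then have "real (nat \<lfloor>\<rho> * real N\<rfloor>) = real_of_int \<lfloor>\<rho> * real N\<rfloor>" by simp
  moreover have "real (lattice_point \<rho> N) = max 1 (real (nat \<lfloor>\<rho> * real N\<rfloor>))" by (simp add: lattice_point_def)
  ultimately have e: "real (lattice_point \<rho> N) = max 1 (real_of_int \<lfloor>\<rho> * real N\<rfloor>)" by simp
  show "\<rho> * real N - 1 \<le> real (lattice_point \<rho> N)" unfolding e by linarith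
  show "real (lattice_point \<rho> N) \<le> \<rho> * real N + 1" unfolding e using \<open>0 \<le> \<rho> * real N\<close> by linarith
qed

lemma lattice_point_tendsto:
  assumes "0 \<le> \<rho>"
  shows "(\<lambda>N. real (lattice_point \<rho> N) / real N) \<longlonglongrightarrow> \<rho>"
proof (rule tendsto_sandwich)
  show "(\<lambda>N. \<rho> - 1 / real N) \<longlonglongrightarrow> \<rho>" "(\<lambda>N. \<rho> + 1 / real N) \<longlonglongrightarrow> \<rho>"
    using tendsto_diff[OF tendsto_const[of \<rho>] lim_1_over_n] tendsto_add[OF tendsto_const[of \<rho>] lim_1_over_n]
    by simp_all
  show "\<forall>\<^sub>F N in sequentially. \<rho> - 1 / real N \<le> real (lattice_point \<rho> N) / real N"
    using eventually_gt_at_top[of 0]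
  proof eventually_elim
    case (elim N)
    then show ?case using lattice_point_bounds(1)[OF assms, of N] by (simp add: pos_le_divide_eq left_diff_distrib)
  qed
  show "\<forall>\<^sub>F N in sequentially. real (lattice_point \<rho> N) / real N \<le> \<rho> + 1 / real N"
    using eventually_gt_at_top[of 0]
  proof eventually_elim
    case (elim N)
    then show ?case using lattice_point_bounds(2)[OF assms, of N] by (simp add: field_simps)
  qed
qed

lemma lattice_point_at_top:
  assumes "0 < \<rho>"
  shows "filterlim (lattice_point \<rho>) at_top sequentially"
proof -
  have "filterlim (\<lambda>N. \<rho> * real N - 1) at_top sequentially"
    using assms by real_asymp
  then have "filterlim (\<lambda>N. real (lattice_point \<rho> N)) at_top sequentially"
    by (rule filterlim_at_top_mono) (use lattice_point_bounds(1)[of \<rho>] assms in auto)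
  then show ?thesis by (simp add: filterlim_sequentially_iff_filterlim_real)
qed

lemma ratio_limit_seq:
  assumes L: "ratio_limit a \<rho> L" and m: "\<forall>\<^sub>F k in F. 1 \<le> ms k \<and> ms k \<le> Ns k"
    and N: "filterlim Ns at_top F" and r: "((\<lambda>k. real (ms k) / real (Ns k)) \<longlongrightarrow> \<rho>) F"
  shows "((\<lambda>k. a (Ns k) (ms k) / real (Ns k)) \<longlongrightarrow> L) F"
proof (rule tendstoI)
  fix e :: real assume e: "e > 0"
  obtain \<delta> N1 where d: "\<delta> > 0" and l: "\<And>N m. N1 \<le> N \<Longrightarrow> 1 \<le> m \<Longrightarrow> m \<le> N \<Longrightarrow>
      \<bar>real m / real N - \<rho>\<bar> < \<delta> \<Longrightarrow> \<bar>a N m / real N - L\<bar> \<le> e / 2"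
    using L[unfolded ratio_limit_def, rule_format, of "e/2"] e by auto
  have "\<forall>\<^sub>F k in F. N1 \<le> Ns k" using N by (simp add: filterlim_at_top)
  moreover have "\<forall>\<^sub>F k in F. dist (real (ms k) / real (Ns k)) \<rho> < \<delta>" using tendstoD[OF r d] .
  ultimately show "\<forall>\<^sub>F k in F. dist (a (Ns k) (ms k) / real (Ns k)) L < e"
    using m
  proof eventually_elim
    case (elim k)
    then have "\<bar>a (Ns k) (ms k) / real (Ns k) - L\<bar> \<le> e / 2" by (intro l) (auto simp: dist_real_def)
    then show ?case using e by (simp add: dist_real_def)
  qed
qed

lemma ratio_limit_lattice_point:
  assumes "ratio_limit a \<rho> L" "0 \<le> \<rho>" "\<rho> \<le> 1"
  shows "(\<lambda>N. a N (lattice_point \<rho> N) / real N) \<longlonglongrightarrow> L"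
proof (rule ratio_limit_seq[OF assms(1)])
  show "\<forall>\<^sub>F k in sequentially. 1 \<le> lattice_point \<rho> k \<and> lattice_point \<rho> k \<le> k"
    using eventually_ge_at_top[of 1] by eventually_elim (use lattice_point_ge_1 lattice_point_le assms in auto)
qed (auto intro: filterlim_ident lattice_point_tendsto assms)

locale superadditive_array =
  fixes a :: "nat \<Rightarrow> nat \<Rightarrow> real" and c :: real
  assumes super: "\<And>N m M n. 1 \<le> m \<Longrightarrow> m \<le> N \<Longrightarrow> 1 \<le> n \<Longrightarrow> n \<le> M \<Longrightarrow> a N m + a M n \<le> a (N + M) (m + n)"
    and bound: "\<And>N m. 1 \<le> m \<Longrightarrow> m \<le> N \<Longrightarrow> \<bar>a N m\<bar> \<le> c * real N"
begin

lemma c_nonneg: "c \<ge> 0"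
  using bound[of 1 1] by simp

lemma ratio_bound: "1 \<le> m \<Longrightarrow> m \<le> N \<Longrightarrow> \<bar>a N m / real N\<bar> \<le> c"
  using bound[of m N] by (simp add: field_simps)

lemma super_mult:
  assumes "1 \<le> m" "m \<le> N" "1 \<le> n" "n \<le> M"
  shows "real k * a N m + a M n \<le> a (k * N + M) (k * m + n)"
proof (induction k)
  case (Suc k)
  have "n \<le> M" "k * m \<le> k * N" using assms by auto
  then have "k * m + n \<le> k * N + M" by (rule add_mono[rotated])
  then have "a N m + a (k * N + M) (k * m + n) \<le> a (N + (k * N + M)) (m + (k * m + n))"
    using assms by (intro super) auto
  then show ?case using Suc by (simp add: algebra_simps)
qed simp

definition near :: "real \<Rightarrow> real \<Rightarrow> real set" where
  "near \<rho> \<delta> = {a N m / real N | N m. 1 \<le> m \<and> m \<le> N \<and> \<bar>real m / real N - \<rho>\<bar> < \<delta>}"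

definition U :: "real \<Rightarrow> real" where
  "U \<rho> = (INF \<delta>\<in>{0<..}. Sup (near \<rho> \<delta>))"

lemma near_bound: "x \<in> near \<rho> \<delta> \<Longrightarrow> \<bar>x\<bar> \<le> c"
  unfolding near_def using ratio_bound by auto

lemma near_bdd: "bdd_above (near \<rho> \<delta>)"
  by (rule bdd_aboveI[of _ c]) (use near_bound in force)

lemma near_ne:
  assumes "0 \<le> \<rho>" "\<rho> \<le> 1" "\<delta> > 0"
  shows "near \<rho> \<delta> \<noteq> {}"
proof -
  have "\<forall>\<^sub>F N in sequentially. dist (real (lattice_point \<rho> N) / real N) \<rho> < \<delta>"
    using tendstoD[OF lattice_point_tendsto[OF assms(1)] assms(3)] .
  then have "\<forall>\<^sub>F N in sequentially. dist (real (lattice_point \<rho> N) / real N) \<rho> < \<delta> \<and> 1 \<le> N"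
    using eventually_ge_at_top[of 1] by eventually_elim auto
  then obtain N where "dist (real (lattice_point \<rho> N) / real N) \<rho> < \<delta>" "1 \<le> N"
    by (auto dest!: eventually_happens)
  then have "a N (lattice_point \<rho> N) / real N \<in> near \<rho> \<delta>"
    unfolding near_def using lattice_point_ge_1[of \<rho> N] lattice_point_le[OF assms(2)] by (auto simp: dist_real_def)
  then show ?thesis by blast
qed

lemma Sup_near_ge:
  assumes "0 \<le> \<rho>" "\<rho> \<le> 1" "\<delta> > 0"
  shows "- c \<le> Sup (near \<rho> \<delta>)"
proof -
  obtain x where x: "x \<in> near \<rho> \<delta>" using near_ne[OF assms] by blast
  have "- c \<le> x" using near_bound[OF x] by linarith
  also have "x \<le> Sup (near \<rho> \<delta>)" using x near_bdd by (rule cSup_upper)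
  finally show ?thesis .
qed

lemma U_bdd:
  assumes "0 \<le> \<rho>" "\<rho> \<le> 1"
  shows "bdd_below ((\<lambda>\<delta>. Sup (near \<rho> \<delta>)) ` {0<..})"
  by (rule bdd_belowI2[of _ "- c"]) (use Sup_near_ge[OF assms] in auto)

lemma U_le_Sup:
  assumes "0 \<le> \<rho>" "\<rho> \<le> 1" "\<delta> > 0"
  shows "U \<rho> \<le> Sup (near \<rho> \<delta>)"
  unfolding U_def using assms by (intro cINF_lower U_bdd) auto

lemma U_abs:
  assumes "0 \<le> \<rho>" "\<rho> \<le> 1"
  shows "\<bar>U \<rho>\<bar> \<le> c"
proof -
  have "U \<rho> \<le> Sup (near \<rho> 1)" by (rule U_le_Sup) (use assms in auto)
  also have "\<dots> \<le> c" by (rule cSup_least[OF near_ne]) (use assms near_bound in force)+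
  finally have "U \<rho> \<le> c" .
  moreover have "- c \<le> U \<rho>" unfolding U_def by (rule cINF_greatest) (use Sup_near_ge[OF assms] in auto)
  ultimately show ?thesis by linarith
qed

text \<open>Write \<open>(N,m) = k (N\<^sub>0,m\<^sub>0) + (M,n)\<close> with \<open>(N\<^sub>0,m\<^sub>0)\<close> nearly optimal. Keeping a fraction \<open>\<kappa>\<close> of \<open>N\<close> for
  the remainder leaves room to correct the slope, so that \<open>1 \<le> n \<le> M\<close>.\<close>

lemma ratio_limit_interior_lower:
  assumes \<rho>: "0 < \<rho>" "\<rho> < 1" and e: "\<epsilon> > 0"
  shows "\<exists>\<delta>>0. \<exists>N1. \<forall>N m. N1 \<le> N \<longrightarrow> 1 \<le> m \<longrightarrow> m \<le> N \<longrightarrow>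
      \<bar>real m / real N - \<rho>\<bar> < \<delta> \<longrightarrow> U \<rho> - \<epsilon> \<le> a N m / real N"
proof -
  define e2 where "e2 = \<epsilon> / 2"
  define \<kappa> where "\<kappa> = min (1/2) (e2 / (2 * (2 * c + e2 + 1)))"
  have e2: "e2 > 0" using e by (simp add: e2_def)
  have k0: "\<kappa> > 0" "\<kappa> \<le> 1/2" using e2 c_nonneg by (auto simp: \<kappa>_def)
  have "\<kappa> \<le> e2 / (2 * (2 * c + e2 + 1))" by (simp add: \<kappa>_def)
  then have "\<kappa> * (2 * (2 * c + e2 + 1)) \<le> e2"
    using e2 c_nonneg by (subst (asm) pos_le_divide_eq) auto
  then have k1: "2 * \<kappa> * (2 * c + e2) \<le> e2" using k0 by (simp add: algebra_simps)
  define \<delta> where "\<delta> = \<kappa> * min \<rho> (1 - \<rho>) / 4"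
  have d0: "\<delta> > 0" using k0 \<rho> by (simp add: \<delta>_def)
  have "\<kappa> * min \<rho> (1 - \<rho>) \<le> \<kappa> * \<rho>" "\<kappa> * min \<rho> (1 - \<rho>) \<le> \<kappa> * (1 - \<rho>)"
    using k0 by (auto intro!: mult_left_mono)
  then have d1: "4 * \<delta> \<le> \<kappa> * \<rho>" "4 * \<delta> \<le> \<kappa> * (1 - \<rho>)" by (auto simp: \<delta>_def)
  have "U \<rho> - e2 < Sup (near \<rho> \<delta>)" using U_le_Sup[of \<rho> \<delta>] \<rho> d0 e2 by simp
  then obtain x where "x \<in> near \<rho> \<delta>" "U \<rho> - e2 < x"
    using less_cSup_iff[OF near_ne near_bdd, of \<rho> \<delta>] \<rho> d0 by auto
  then obtain N0 m0 where m0: "1 \<le> m0" "m0 \<le> N0" and r0: "\<bar>real m0 / real N0 - \<rho>\<bar> < \<delta>"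
    and a0: "U \<rho> - e2 < a N0 m0 / real N0"
    unfolding near_def by auto
  have N0: "real N0 > 0" using m0 by simp
  have cross: "real p \<le> (\<rho> + \<delta>) * real q" "(\<rho> - \<delta>) * real q \<le> real p"
    if "real q > 0" "\<bar>real p / real q - \<rho>\<bar> < \<delta>" for p q :: nat
  proof -
    have "real p / real q \<le> \<rho> + \<delta>" "\<rho> - \<delta> \<le> real p / real q" using that by linarith+
    then show "real p \<le> (\<rho> + \<delta>) * real q" "(\<rho> - \<delta>) * real q \<le> real p"
      using that by (simp_all add: field_simps)
  qed
  note R0 = cross[OF N0 r0]
  obtain N1 :: nat where N1: "real N1 > real N0 / \<kappa>" using reals_Archimedean2 by blast
  have "U \<rho> - \<epsilon> \<le> a N m / real N"
    if N: "N1 \<le> N" and m: "1 \<le> m" "m \<le> N" and r: "\<bar>real m / real N - \<rho>\<bar> < \<delta>" for N m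
  proof -
    have Np: "real N > 0" using m by simp
    have "real N > real N0 / \<kappa>" using N N1 by linarith
    then have NN0: "real N0 < \<kappa> * real N" using k0 by (simp add: field_simps)
    note R = cross[OF Np r]
    define k where "k = nat \<lfloor>(1 - \<kappa>) * real N / real N0\<rfloor>"
    have q0: "0 \<le> (1 - \<kappa>) * real N / real N0" using k0 by simp
    then have kr: "real k = real_of_int \<lfloor>(1 - \<kappa>) * real N / real N0\<rfloor>" by (simp add: k_def)
    have "real k \<le> (1 - \<kappa>) * real N / real N0" unfolding kr by linarith
    then have kN: "real k * real N0 \<le> (1 - \<kappa>) * real N" using N0 by (simp add: field_simps)
    have "(1 - \<kappa>) * real N / real N0 < real k + 1" unfolding kr by linarith
    then have kN': "(1 - \<kappa>) * real N < real k * real N0 + real N0" using N0 by (simp add: field_simps)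
    define X where "X = real k * real N0"
    have X0: "0 \<le> X" "X \<le> (1 - \<kappa>) * real N" "(1 - \<kappa>) * real N < X + real N0"
      using kN kN' by (auto simp: X_def)
    have XN: "X \<le> real N" using X0 k0 Np by (smt (verit, ccfv_SIG) mult_le_cancel_right1)
    have kNle: "k * N0 \<le> N" using XN unfolding X_def by (metis of_nat_le_iff of_nat_mult)
    have km: "(\<rho> - \<delta>) * X \<le> real k * real m0" "real k * real m0 \<le> (\<rho> + \<delta>) * X"
      using mult_left_mono[OF R0(1), of "real k"] mult_left_mono[OF R0(2), of "real k"]
      by (auto simp: X_def algebra_simps)
    have dX: "\<delta> * X \<le> \<delta> * real N" using XN d0 by (intro mult_left_mono) auto
    have MX: "\<kappa> * real N \<le> real N - X" using X0 by (simp add: algebra_simps)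
    have "2 * \<delta> * real N < \<rho> * (\<kappa> * real N)"
    proof -
      have "2 * \<delta> < \<kappa> * \<rho>" using d1 d0 by linarith
      from mult_strict_right_mono[OF this Np] show ?thesis by (simp add: algebra_simps)
    qed
    also have "\<dots> \<le> \<rho> * (real N - X)" using MX \<rho> by (intro mult_left_mono) auto
    finally have "real k * real m0 < real m"
      using km(2) R(2) dX by (simp add: algebra_simps)
    then have kmlt: "k * m0 < m" by (metis of_nat_less_iff of_nat_mult)
    have "2 * \<delta> * real N < (1 - \<rho>) * (\<kappa> * real N)"
    proof -
      have "2 * \<delta> < \<kappa> * (1 - \<rho>)" using d1 d0 by linarith
      from mult_strict_right_mono[OF this Np] show ?thesis by (simp add: algebra_simps)
    qed
    also have "\<dots> \<le> (1 - \<rho>) * (real N - X)" using MX \<rho> by (intro mult_left_mono) auto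
    finally have "real m - real k * real m0 < real N - X"
      using km(1) R(1) dX by (simp add: algebra_simps)
    then have "real m + real (k * N0) < real N + real (k * m0)" by (simp add: X_def)
    then have "m + k * N0 < N + k * m0" by linarith
    then have nM: "m - k * m0 \<le> N - k * N0" using kmlt kNle by linarith
    have n1: "1 \<le> m - k * m0" using kmlt by linarith
    have "real k * a N0 m0 + a (N - k * N0) (m - k * m0) \<le> a (k * N0 + (N - k * N0)) (k * m0 + (m - k * m0))"
      by (rule super_mult[OF m0 n1 nM])
    then have s: "real k * a N0 m0 + a (N - k * N0) (m - k * m0) \<le> a N m"
      using kmlt kNle by simp
    have M: "real (N - k * N0) = real N - X" using kNle by (simp add: of_nat_diff X_def)
    have b: "- c * (real N - X) \<le> a (N - k * N0) (m - k * m0)"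
      using bound[OF n1 nM] unfolding M by (simp add: algebra_simps abs_le_iff)
    have "(U \<rho> - e2) * real N0 \<le> a N0 m0" using a0 N0 by (simp add: field_simps)
    from mult_left_mono[OF this, of "real k"] have "(U \<rho> - e2) * X \<le> real k * a N0 m0"
      by (simp add: X_def algebra_simps)
    with s b have 1: "(U \<rho> - e2) * real N - (U \<rho> - e2) * (real N - X) - c * (real N - X) \<le> a N m"
      by (simp add: algebra_simps)
    have y: "real N - X \<le> 2 * \<kappa> * real N" "0 \<le> real N - X" using X0(3) NN0 XN by (auto simp: algebra_simps)
    have "(U \<rho> - e2) + c \<le> 2 * c + e2" using U_abs[of \<rho>] \<rho> e2 by simp
    then have "((U \<rho> - e2) + c) * (real N - X) \<le> (2 * c + e2) * (real N - X)"
      using y by (intro mult_right_mono) auto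
    also have "\<dots> \<le> (2 * c + e2) * (2 * \<kappa> * real N)"
      using y c_nonneg e2 by (intro mult_left_mono) auto
    also have "\<dots> \<le> e2 * real N"
      using mult_right_mono[OF k1, of "real N"] by (simp add: algebra_simps)
    finally have "(U \<rho> - e2) * real N - e2 * real N \<le> a N m" using 1 by (simp add: algebra_simps)
    then have "(U \<rho> - \<epsilon>) * real N \<le> a N m" by (simp add: e2_def algebra_simps)
    then show ?thesis using Np by (simp add: field_simps)
  qed
  then show ?thesis using d0 by blast
qed

lemma ratio_limit_interior:
  assumes \<rho>: "0 < \<rho>" "\<rho> < 1"
  shows "ratio_limit a \<rho> (U \<rho>)"
  unfolding ratio_limit_def
proof (intro allI impI)
  fix \<epsilon> :: real assume e: "\<epsilon> > 0"
  have "(INF \<delta>\<in>{0<..}. Sup (near \<rho> \<delta>)) < U \<rho> + \<epsilon>" using e by (simp add: U_def)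
  then obtain \<delta>1 where d1: "\<delta>1 > 0" "Sup (near \<rho> \<delta>1) < U \<rho> + \<epsilon>"
    using U_bdd[of \<rho>] \<rho> by (subst (asm) cINF_less_iff) auto
  obtain \<delta>2 N1 where d2: "\<delta>2 > 0" and l: "\<And>N m. N1 \<le> N \<Longrightarrow> 1 \<le> m \<Longrightarrow> m \<le> N \<Longrightarrow>
      \<bar>real m / real N - \<rho>\<bar> < \<delta>2 \<Longrightarrow> U \<rho> - \<epsilon> \<le> a N m / real N"
    using ratio_limit_interior_lower[OF \<rho> e] by blast
  show "\<exists>\<delta>>0. \<exists>N1. \<forall>N m. N1 \<le> N \<longrightarrow> 1 \<le> m \<longrightarrow> m \<le> N \<longrightarrow>
      \<bar>real m / real N - \<rho>\<bar> < \<delta> \<longrightarrow> \<bar>a N m / real N - U \<rho>\<bar> \<le> \<epsilon>"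
  proof (intro exI[of _ "min \<delta>1 \<delta>2"] conjI exI[of _ N1] allI impI)
    fix N m assume N: "N1 \<le> N" "1 \<le> m" "m \<le> N" "\<bar>real m / real N - \<rho>\<bar> < min \<delta>1 \<delta>2"
    have "a N m / real N \<le> Sup (near \<rho> \<delta>1)"
      using N by (intro cSup_upper near_bdd) (auto simp: near_def)
    moreover have "U \<rho> - \<epsilon> \<le> a N m / real N" using N by (intro l) auto
    ultimately show "\<bar>a N m / real N - U \<rho>\<bar> \<le> \<epsilon>" using d1 by linarith
  qed (use d1 d2 in auto)
qed

end

locale superadditive_limit = superadditive_array +
  fixes g :: "real \<Rightarrow> real"
  assumes loc: "\<And>\<rho>. \<rho> \<in> {0..1} \<Longrightarrow> ratio_limit a \<rho> (g \<rho>)"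
begin

lemma continuous_g: "continuous_on {0..1} g"
  unfolding continuous_on_iff
proof (intro ballI allI impI)
  fix \<rho> e :: real assume \<rho>: "\<rho> \<in> {0..1}" and e: "0 < e"
  obtain \<delta> N1 where d: "\<delta> > 0" and l: "\<And>N m. N1 \<le> N \<Longrightarrow> 1 \<le> m \<Longrightarrow> m \<le> N \<Longrightarrow>
      \<bar>real m / real N - \<rho>\<bar> < \<delta> \<Longrightarrow> \<bar>a N m / real N - g \<rho>\<bar> \<le> e / 2"
    using loc[OF \<rho>, unfolded ratio_limit_def, rule_format, of "e/2"] e by auto
  show "\<exists>d>0. \<forall>x'\<in>{0..1}. dist x' \<rho> < d \<longrightarrow> dist (g x') (g \<rho>) < e"
  proof (intro exI[of _ \<delta>] conjI d ballI impI)
    fix x assume x: "x \<in> {0..1}" "dist x \<rho> < \<delta>"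
    have lim: "(\<lambda>N. \<bar>a N (lattice_point x N) / real N - g \<rho>\<bar>) \<longlonglongrightarrow> \<bar>g x - g \<rho>\<bar>"
      using x by (intro tendsto_intros ratio_limit_lattice_point loc) auto
    have "((\<lambda>N. \<bar>real (lattice_point x N) / real N - \<rho>\<bar>) \<longlongrightarrow> \<bar>x - \<rho>\<bar>) sequentially"
      using x by (intro tendsto_intros lattice_point_tendsto) auto
    then have "\<forall>\<^sub>F N in sequentially. \<bar>real (lattice_point x N) / real N - \<rho>\<bar> < \<delta>"
      using x by (intro order_tendstoD(2)) (auto simp: dist_real_def)
    then have "\<forall>\<^sub>F N in sequentially. \<bar>a N (lattice_point x N) / real N - g \<rho>\<bar> \<le> e / 2"
      using eventually_ge_at_top[of "max 1 N1"]
    proof eventually_elim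
      case (elim N)
      show ?case by (rule l) (use elim x lattice_point_ge_1 lattice_point_le in auto)
    qed
    then have "\<bar>g x - g \<rho>\<bar> \<le> e / 2"
      by (rule tendsto_upperbound[OF lim]) simp
    then show "dist (g x) (g \<rho>) < e" using e by (simp add: dist_real_def)
  qed
qed

lemma ratio_le_g:
  assumes m: "1 \<le> m" "m \<le> N"
  shows "a N m / real N \<le> g (real m / real N)"
proof -
  let ?\<rho> = "real m / real N"
  have \<rho>: "?\<rho> \<in> {0..1}" using m by auto
  have lim: "(\<lambda>k. a (Suc k * N) (Suc k * m) / real (Suc k * N)) \<longlonglongrightarrow> g ?\<rho>"
  proof (rule ratio_limit_seq[OF loc[OF \<rho>]])
    show "\<forall>\<^sub>F k in sequentially. 1 \<le> Suc k * m \<and> Suc k * m \<le> Suc k * N"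
      using m by (intro always_eventually) (auto simp: mult_le_mono2 intro: add_mono)
    show "filterlim (\<lambda>k. Suc k * N) sequentially sequentially"
    proof (rule filterlim_at_top_mono[OF filterlim_Suc], rule always_eventually, rule allI)
      fix k show "Suc k \<le> Suc k * N" using m mult_le_mono2[of 1 N "Suc k"] by simp
    qed
    show "(\<lambda>k. real (Suc k * m) / real (Suc k * N)) \<longlonglongrightarrow> real m / real N"
    proof -
      have "real (Suc k * m) / real (Suc k * N) = real m / real N" for k
        unfolding of_nat_mult by (simp del: of_nat_Suc)
      then show ?thesis by (simp only: tendsto_const)
    qed
  qed
  have "a N m / real N \<le> a (Suc k * N) (Suc k * m) / real (Suc k * N)" for k
  proof -
    have "real k * a N m + a N m \<le> a (k * N + N) (k * m + m)" by (rule super_mult[OF m m])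
    then have "real (Suc k) * a N m \<le> a (Suc k * N) (Suc k * m)" by (simp add: algebra_simps)
    then have "real (Suc k) * a N m / real (Suc k * N) \<le> a (Suc k * N) (Suc k * m) / real (Suc k * N)"
      by (intro divide_right_mono) auto
    moreover have "real (Suc k) * a N m / real (Suc k * N) = a N m / real N"
      unfolding of_nat_mult by (simp del: of_nat_Suc)
    ultimately show ?thesis by simp
  qed
  then show ?thesis by (intro LIMSEQ_le_const[OF lim]) auto
qed

lemma concave_g: "concave_on {0..1} g"
  unfolding concave_on_def
proof (rule convex_onI)
  fix t x y :: real
  assume t: "0 < t" "t < 1" and x: "x \<in> {0..1}" and y: "y \<in> {0..1}"
  define N1 where "N1 = lattice_point (1 - t)"
  define N2 where "N2 = lattice_point t"
  define m1 where "m1 k = lattice_point x (N1 k)" for k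
  define m2 where "m2 k = lattice_point y (N2 k)" for k
  have N1: "filterlim N1 at_top sequentially" "\<And>k. 1 \<le> N1 k" "(\<lambda>k. real (N1 k) / real k) \<longlonglongrightarrow> 1 - t"
    unfolding N1_def using t by (auto intro!: lattice_point_at_top lattice_point_tendsto lattice_point_ge_1[unfolded One_nat_def])
  have N2: "filterlim N2 at_top sequentially" "\<And>k. 1 \<le> N2 k" "(\<lambda>k. real (N2 k) / real k) \<longlonglongrightarrow> t"
    unfolding N2_def using t by (auto intro!: lattice_point_at_top lattice_point_tendsto lattice_point_ge_1[unfolded One_nat_def])
  have m1: "1 \<le> m1 k" "m1 k \<le> N1 k" for k unfolding m1_def using x N1(2) lattice_point_ge_1 lattice_point_le by auto
  have m2: "1 \<le> m2 k" "m2 k \<le> N2 k" for k unfolding m2_def using y N2(2) lattice_point_ge_1 lattice_point_le by auto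
  have r1: "(\<lambda>k. real (m1 k) / real (N1 k)) \<longlonglongrightarrow> x"
    unfolding m1_def using filterlim_compose[OF lattice_point_tendsto N1(1)] x by auto
  have r2: "(\<lambda>k. real (m2 k) / real (N2 k)) \<longlonglongrightarrow> y"
    unfolding m2_def using filterlim_compose[OF lattice_point_tendsto N2(1)] y by auto
  have s: "(\<lambda>k. real (N1 k) / real k + real (N2 k) / real k) \<longlonglongrightarrow> 1"
    using tendsto_add[OF N1(3) N2(3)] by simp
  have w: "(\<lambda>k. real (n k) / real (N1 k + N2 k)) \<longlonglongrightarrow> L"
    if "(\<lambda>k. real (n k) / real k) \<longlonglongrightarrow> L" for n :: "nat \<Rightarrow> nat" and L
  proof -
    have "(\<lambda>k. (real (n k) / real k) / (real (N1 k) / real k + real (N2 k) / real k)) \<longlonglongrightarrow> L / 1"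
      by (intro tendsto_divide that s) simp
    then have "(\<lambda>k. (real (n k) / real k) / (real (N1 k) / real k + real (N2 k) / real k)) \<longlonglongrightarrow> L" by simp
    then show ?thesis
      by (rule Lim_transform_eventually)
        (use eventually_gt_at_top[of 0] in eventually_elim, simp add: add_divide_distrib[symmetric])
  qed
  note w1 = w[OF N1(3)] and w2 = w[OF N2(3)]
  have split: "p / real (N1 k) * (real (N1 k) / real (N1 k + N2 k)) + q / real (N2 k) * (real (N2 k) / real (N1 k + N2 k))
      = (p + q) / real (N1 k + N2 k)" for p q k
    using N1(2)[of k] N2(2)[of k] by (simp add: add_divide_distrib)
  let ?z = "(1 - t) * x + t * y"
  have z: "?z \<in> {0..1}" using convex_real_interval(5)[of 0 "1::real"] x y t
    by (auto simp: convex_alt)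
  have "(\<lambda>k. real (m1 k) / real (N1 k) * (real (N1 k) / real (N1 k + N2 k)) + real (m2 k) / real (N2 k) * (real (N2 k) / real (N1 k + N2 k)))
     \<longlonglongrightarrow> x * (1 - t) + y * t"
    by (intro tendsto_intros r1 r2 w1 w2)
  then have rr: "(\<lambda>k. real (m1 k + m2 k) / real (N1 k + N2 k)) \<longlonglongrightarrow> ?z"
    unfolding split by (simp add: mult.commute)
  have L: "(\<lambda>k. a (N1 k + N2 k) (m1 k + m2 k) / real (N1 k + N2 k)) \<longlonglongrightarrow> g ?z"
  proof (rule ratio_limit_seq[OF loc[OF z] _ _ rr])
    show "\<forall>\<^sub>F k in sequentially. 1 \<le> m1 k + m2 k \<and> m1 k + m2 k \<le> N1 k + N2 k"
      using m1 m2 by (intro always_eventually) (auto intro: add_mono trans_le_add1)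
    show "filterlim (\<lambda>k. N1 k + N2 k) sequentially sequentially"
      by (rule filterlim_at_top_mono[OF N1(1)]) auto
  qed
  have L1: "(\<lambda>k. a (N1 k) (m1 k) / real (N1 k)) \<longlonglongrightarrow> g x"
    by (rule ratio_limit_seq[OF loc[OF x] _ N1(1) r1]) (use m1 in auto)
  have L2: "(\<lambda>k. a (N2 k) (m2 k) / real (N2 k)) \<longlonglongrightarrow> g y"
    by (rule ratio_limit_seq[OF loc[OF y] _ N2(1) r2]) (use m2 in auto)
  have "(\<lambda>k. a (N1 k) (m1 k) / real (N1 k) * (real (N1 k) / real (N1 k + N2 k)) + a (N2 k) (m2 k) / real (N2 k) * (real (N2 k) / real (N1 k + N2 k)))
     \<longlonglongrightarrow> g x * (1 - t) + g y * t"
    by (intro tendsto_intros L1 L2 w1 w2)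
  then have "(\<lambda>k. (a (N1 k) (m1 k) + a (N2 k) (m2 k)) / real (N1 k + N2 k)) \<longlonglongrightarrow> g x * (1 - t) + g y * t"
    unfolding split .
  then have "g x * (1 - t) + g y * t \<le> g ?z"
    by (rule LIMSEQ_le[OF _ L]) (intro exI[of _ 0] allI impI divide_right_mono super m1 m2, simp)
  then show "- g ((1 - t) *\<^sub>R x + t *\<^sub>R y) \<le> (1 - t) * - g x + t * - g y"
    by (simp add: algebra_simps)
qed simp

lemma uniform_limit_g:
  assumes e: "\<epsilon> > 0"
  shows "\<forall>\<^sub>F N in sequentially. \<forall>m. 1 \<le> m \<longrightarrow> m \<le> N \<longrightarrow> \<bar>a N m / real N - g (real m / real N)\<bar> \<le> \<epsilon>"
proof (rule ccontr)
  assume "\<not> ?thesis"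
  then have "\<forall>k. \<exists>N m. k \<le> N \<and> 1 \<le> m \<and> m \<le> N \<and> \<not> \<bar>a N m / real N - g (real m / real N)\<bar> \<le> \<epsilon>"
    unfolding eventually_sequentially by blast
  then obtain Ns ms where b: "\<And>k. k \<le> Ns k" "\<And>k. 1 \<le> ms k" "\<And>k. ms k \<le> Ns k"
    "\<And>k. \<bar>a (Ns k) (ms k) / real (Ns k) - g (real (ms k) / real (Ns k))\<bar> > \<epsilon>"
    unfolding not_le by metis
  define x where "x k = real (ms k) / real (Ns k)" for k
  have x: "x k \<in> {0..1}" for k using b(2)[of k] b(3)[of k] by (simp add: x_def)
  obtain l r where l: "l \<in> {0..1}" and r: "strict_mono r" and lim: "(x \<circ> r) \<longlonglongrightarrow> l"
    using compact_Icc[of 0 "1::real", unfolded compact_def] x by metis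
  have Nr: "filterlim (\<lambda>k. Ns (r k)) at_top sequentially"
    by (rule filterlim_at_top_mono[OF filterlim_subseq[OF r]]) (use b(1) in auto)
  have 1: "(\<lambda>k. a (Ns (r k)) (ms (r k)) / real (Ns (r k))) \<longlonglongrightarrow> g l"
    by (rule ratio_limit_seq[OF loc[OF l] _ Nr]) (use b lim in \<open>auto simp: x_def comp_def\<close>)
  have 2: "(\<lambda>k. g (x (r k))) \<longlonglongrightarrow> g l"
    using continuous_on_tendsto_compose[OF continuous_g lim l] x by (simp add: comp_def)
  have "(\<lambda>k. \<bar>a (Ns (r k)) (ms (r k)) / real (Ns (r k)) - g (x (r k))\<bar>) \<longlonglongrightarrow> \<bar>g l - g l\<bar>"
    by (intro tendsto_intros 1 2)
  then have "\<epsilon> \<le> \<bar>g l - g l\<bar>"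
    by (rule LIMSEQ_le_const) (use b(4) in \<open>auto simp: x_def less_imp_le\<close>)
  then show False using e by simp
qed

end

section \<open>The variational formula\<close>

locale variational =
  fixes g :: "real \<Rightarrow> real" and H :: "real \<Rightarrow> ereal"
  assumes g_concave: "concave_on {0..1} g" and g_cont: "continuous_on {0..1} g"
    and H_concave: "ereal_concave_on {0..1} H"
    and H_finite: "\<And>x. x \<in> {0<..<1} \<Longrightarrow> \<bar>H x\<bar> \<noteq> \<infinity>"
    and H_not_pinf: "\<And>x. H x \<noteq> \<infinity>"
    and H_cont: "continuous_on {0..1} H"
begin

definition \<phi> :: "real \<Rightarrow> real" where
  "\<phi> x = real_of_ereal (H x) + g x"

definition f :: "real \<Rightarrow> real" where
  "f h = (SUP x\<in>{0<..<1}. h * x + \<phi> x)"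

lemma phi_upper: "\<exists>B. \<forall>x\<in>{0..1}. \<phi> x \<le> B"
proof -
  obtain x0 where x0: "x0 \<in> {0..1}" "\<And>y. y \<in> {0..1} \<Longrightarrow> H y \<le> H x0"
    using continuous_attains_sup[OF compact_Icc _ H_cont] by auto
  obtain x1 where x1: "x1 \<in> {0..1}" "\<And>y. y \<in> {0..1} \<Longrightarrow> g y \<le> g x1"
    using continuous_attains_sup[OF compact_Icc _ g_cont] by auto
  have "real_of_ereal (H y) \<le> \<bar>real_of_ereal (H x0)\<bar>" if "y \<in> {0..1}" for y
    using x0(2)[OF that] H_not_pinf[of x0] by (cases "H y"; cases "H x0") auto
  then have "\<phi> y \<le> \<bar>real_of_ereal (H x0)\<bar> + g x1" if "y \<in> {0..1}" for y
    unfolding \<phi>_def using x1(2)[OF that] that by (intro add_mono) auto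
  then show ?thesis by blast
qed

lemma bdd_f: "bdd_above ((\<lambda>x. h * x + \<phi> x) ` {0<..<1})"
proof -
  obtain B where B: "\<And>x. x \<in> {0..1} \<Longrightarrow> \<phi> x \<le> B" using phi_upper by blast
  show ?thesis
  proof (rule bdd_aboveI2)
    fix x :: real assume x: "x \<in> {0<..<1}"
    have "\<bar>h\<bar> * x \<le> \<bar>h\<bar> * 1" using x by (intro mult_left_mono) auto
    moreover have "h * x \<le> \<bar>h\<bar> * x" using x by (intro mult_right_mono) auto
    moreover have "\<phi> x \<le> B" using x by (intro B) auto
    ultimately show "h * x + \<phi> x \<le> \<bar>h\<bar> + B" by linarith
  qed
qed

lemma le_f: "x \<in> {0<..<1} \<Longrightarrow> h * x + \<phi> x \<le> f h"
  unfolding f_def by (rule cSUP_upper[OF _ bdd_f])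

lemma f_le: "(\<And>x. x \<in> {0<..<1} \<Longrightarrow> h * x + \<phi> x \<le> y) \<Longrightarrow> f h \<le> y"
  unfolding f_def by (rule cSUP_least) (auto intro: exI[of _ "1/2"])

lemma phi_tendsto:
  assumes x: "x \<in> {0..1}" and fin: "H x \<noteq> -\<infinity>"
  shows "(\<phi> \<longlongrightarrow> \<phi> x) (at x within {0..1})"
proof -
  have "(H \<longlongrightarrow> ereal (real_of_ereal (H x))) (at x within {0..1})"
  proof -
    have "(H \<longlongrightarrow> H x) (at x within {0..1})" using H_cont x unfolding continuous_on_def by blast
    moreover have "H x = ereal (real_of_ereal (H x))" using fin H_not_pinf[of x] by (cases "H x") auto
    ultimately show ?thesis by simp
  qed
  then have "((\<lambda>y. real_of_ereal (H y)) \<longlongrightarrow> real_of_ereal (H x)) (at x within {0..1})"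
    by (rule lim_real_of_ereal)
  moreover have "(g \<longlongrightarrow> g x) (at x within {0..1})"
    using g_cont x by (auto simp: continuous_on_def)
  ultimately show ?thesis unfolding \<phi>_def by (intro tendsto_add)
qed

lemma at_within_01: "x \<in> {0..1::real} \<Longrightarrow> at x within {0<..<1} \<noteq> bot"
proof -
  assume "x \<in> {0..1::real}"
  then consider "x = 0" | "x = 1" | "x \<in> interior {0<..<1}" by force
  then have "x islimpt {0<..<1}"
    by cases (auto intro: islimpt_greaterThanLessThan1 islimpt_greaterThanLessThan2 interior_limit_point)
  then show ?thesis by (simp add: trivial_limit_within)
qed

lemma le_f_closed:
  assumes x: "x \<in> {0..1}" and fin: "H x \<noteq> -\<infinity>"
  shows "h * x + \<phi> x \<le> f h"
proof (rule tendsto_upperbound)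
  show "((\<lambda>y. h * y + \<phi> y) \<longlongrightarrow> h * x + \<phi> x) (at x within {0<..<1})"
    by (intro tendsto_intros tendsto_within_subset[OF phi_tendsto[OF x fin]]) auto
  show "\<forall>\<^sub>F y in at x within {0<..<1}. h * y + \<phi> y \<le> f h"
    unfolding eventually_at_filter by (intro always_eventually) (auto intro: le_f)
  show "at x within {0<..<1} \<noteq> bot" by (rule at_within_01[OF x])
qed

lemma ereal_phi:
  assumes "H x \<noteq> -\<infinity>"
  shows "ereal (h * x + g x) + H x = ereal (h * x + \<phi> x)"
  using assms H_not_pinf[of x] by (cases "H x") (auto simp: \<phi>_def)

lemma f_eq_SUP: "ereal (f h) = (SUP \<rho>\<in>{0..1}. ereal (h * \<rho> + g \<rho>) + H \<rho>)"
proof (rule antisym)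
  let ?S = "SUP \<rho>\<in>{0..1}. ereal (h * \<rho> + g \<rho>) + H \<rho>"
  have le: "ereal (h * x + \<phi> x) \<le> ?S" if "x \<in> {0<..<1}" for x
  proof -
    have "H x \<noteq> -\<infinity>" using H_finite[OF that] by auto
    then have "ereal (h * x + \<phi> x) = ereal (h * x + g x) + H x" by (simp add: ereal_phi)
    also have "\<dots> \<le> ?S" using that by (intro SUP_upper) auto
    finally show ?thesis .
  qed
  show "ereal (f h) \<le> ?S"
  proof (cases ?S)
    case (real r)
    have "f h \<le> r" using le real by (intro f_le) auto
    then show ?thesis using real by simp
  next
    case MInf
    then show ?thesis using le[of "1/2"] by simp
  qed simp
  show "?S \<le> ereal (f h)"
  proof (rule SUP_least)
    fix x :: real assume x: "x \<in> {0..1}"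
    show "ereal (h * x + g x) + H x \<le> ereal (f h)"
    proof (cases "H x = -\<infinity>")
      case False
      then show ?thesis using le_f_closed[OF x False] by (simp add: ereal_phi)
    qed simp
  qed
qed

lemma mono_f: "mono f"
proof (rule monoI)
  fix h h' :: real assume h: "h \<le> h'"
  show "f h \<le> f h'"
  proof (rule f_le)
    fix x :: real assume x: "x \<in> {0<..<1}"
    have "h * x \<le> h' * x" using h x by (intro mult_right_mono) auto
    then show "h * x + \<phi> x \<le> f h'" using le_f[OF x, of h'] by linarith
  qed
qed

lemma convex_f: "convex_on UNIV f"
proof (rule convex_onI)
  fix t h h' :: real assume t: "0 < t" "t < 1"
  show "f ((1 - t) *\<^sub>R h + t *\<^sub>R h') \<le> (1 - t) * f h + t * f h'"
  proof (rule f_le)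
    fix x :: real assume x: "x \<in> {0<..<1}"
    have "((1 - t) *\<^sub>R h + t *\<^sub>R h') * x + \<phi> x = (1 - t) * (h * x + \<phi> x) + t * (h' * x + \<phi> x)"
      by (simp add: algebra_simps)
    also have "\<dots> \<le> (1 - t) * f h + t * f h'"
      using t by (intro add_mono mult_left_mono le_f x) auto
    finally show "((1 - t) *\<^sub>R h + t *\<^sub>R h') * x + \<phi> x \<le> (1 - t) * f h + t * f h'" .
  qed
qed simp

lemma convex_neg_phi: "convex_on {0<..<1} (\<lambda>x. - \<phi> x)"
proof (rule convex_onI)
  fix t x y :: real assume t: "0 < t" "t < 1" and x: "x \<in> {0<..<1}" and y: "y \<in> {0<..<1}"
  let ?z = "(1 - t) * x + t * y"
  have z: "?z \<in> {0<..<1}" using convex_real_interval(8)[of 0 "1::real"] x y t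
    by (auto simp: convex_alt)
  have "ereal (1 - t) * H x + ereal (1 - (1 - t)) * H y \<le> H ((1 - t) * x + (1 - (1 - t)) * y)"
    using x y t by (intro H_concave[unfolded ereal_concave_on_def, rule_format]) auto
  then have "(1 - t) * real_of_ereal (H x) + t * real_of_ereal (H y) \<le> real_of_ereal (H ?z)"
    using H_finite[OF x] H_finite[OF y] H_finite[OF z]
    by (cases "H x"; cases "H y"; cases "H ?z") auto
  moreover have "(1 - t) * g x + t * g y \<le> g ?z"
  proof -
    have "convex_on {0..1} (\<lambda>x. - g x)" using g_concave by (simp add: concave_on_def)
    from convex_onD[OF this, of t x y] show ?thesis using t x y by auto
  qed
  ultimately show "- \<phi> ((1 - t) *\<^sub>R x + t *\<^sub>R y) \<le> (1 - t) * - \<phi> x + t * - \<phi> y"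
    by (simp add: \<phi>_def algebra_simps)
qed simp

lemma approx_supporting:
  assumes x: "x \<in> {0..1}" and fin: "H x \<noteq> -\<infinity>" and e: "\<epsilon> > 0"
  shows "\<exists>h. f h \<le> h * x + \<phi> x + \<epsilon>"
proof -
  obtain B where B: "\<And>x. x \<in> {0..1} \<Longrightarrow> \<phi> x \<le> B" using phi_upper by blast
  have "\<forall>\<^sub>F y in at x within {0..1}. \<phi> y < \<phi> x + \<epsilon>"
    using order_tendstoD(2)[OF phi_tendsto[OF x fin]] e by simp
  then obtain \<delta> where d: "\<delta> > 0" and near: "\<And>y. y \<in> {0..1} \<Longrightarrow> y \<noteq> x \<Longrightarrow> dist y x < \<delta> \<Longrightarrow> \<phi> y < \<phi> x + \<epsilon>"
    unfolding eventually_at by blast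
  define A where "A = \<bar>B\<bar> + \<bar>\<phi> x\<bar>"
  have A0: "A \<ge> 0" by (simp add: A_def)
  have far: "A / \<delta> * r \<ge> B - \<phi> x" if "r \<ge> \<delta>" for r
  proof -
    have "B - \<phi> x \<le> A" by (simp add: A_def)
    also have "\<dots> = A / \<delta> * \<delta>" using d by simp
    also have "\<dots> \<le> A / \<delta> * r" using that d A0 by (intro mult_left_mono) auto
    finally show ?thesis .
  qed
  consider "x = 0" | "x = 1" | "x \<in> {0<..<1}" using x by force
  then show ?thesis
  proof cases
    case 1
    show ?thesis
    proof (intro exI[of _ "- (A / \<delta>)"] f_le)
      fix y :: real assume y: "y \<in> {0<..<1}"
      have n: "A / \<delta> * y \<ge> 0" using A0 d y by simp
      show "- (A / \<delta>) * y + \<phi> y \<le> - (A / \<delta>) * x + \<phi> x + \<epsilon>"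
      proof (cases "y < \<delta>")
        case True
        then show ?thesis using near[of y] y 1 n by (simp add: dist_real_def)
      next
        case False
        then show ?thesis using far[of y] B[of y] y 1 e by simp
      qed
    qed
  next
    case 2
    show ?thesis
    proof (intro exI[of _ "A / \<delta>"] f_le)
      fix y :: real assume y: "y \<in> {0<..<1}"
      have n: "A / \<delta> * (1 - y) \<ge> 0" using A0 d y by simp
      have s: "A / \<delta> * x = A / \<delta> * y + A / \<delta> * (1 - y)" using 2 by (simp add: right_diff_distrib)
      show "A / \<delta> * y + \<phi> y \<le> A / \<delta> * x + \<phi> x + \<epsilon>"
      proof (cases "1 - y < \<delta>")
        case True
        then have "\<phi> y < \<phi> x + \<epsilon>" using near[of y] y 2 by (simp add: dist_real_def)
        then show ?thesis using n unfolding s by linarith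
      next
        case False
        then have "A / \<delta> * (1 - y) \<ge> B - \<phi> x" by (intro far) simp
        then show ?thesis using B[of y] y e unfolding s by simp
      qed
    qed
  next
    case 3
    define S where "S = Inf ((\<lambda>t. (- \<phi> x - - \<phi> t) / (x - t)) ` ({x<..} \<inter> {0<..<1}))"
    have "f S \<le> S * x + \<phi> x"
    proof (rule f_le)
      fix y :: real assume y: "y \<in> {0<..<1}"
      have "- \<phi> y \<ge> - \<phi> x + S * (y - x)"
        unfolding S_def by (rule convex_le_Inf_differential[OF convex_neg_phi _ y]) (use 3 in auto)
      then show "S * y + \<phi> y \<le> S * x + \<phi> x" by (simp add: algebra_simps)
    qed
    then show ?thesis using e by (intro exI[of _ S]) simp
  qed
qed

lemma g_eq_INF:
  assumes x: "x \<in> {0..1}" and fin: "H x \<noteq> -\<infinity>"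
  shows "ereal (g x) = (INF h. ereal (f h - x * h) - H x)"
proof -
  obtain r where r: "H x = ereal r" using fin H_not_pinf[of x] by (cases "H x") auto
  have \<phi>: "\<phi> x = r + g x" by (simp add: \<phi>_def r)
  show ?thesis
  proof (rule antisym)
    show "ereal (g x) \<le> (INF h. ereal (f h - x * h) - H x)"
    proof (rule INF_greatest)
      fix h
      show "ereal (g x) \<le> ereal (f h - x * h) - H x"
        using le_f_closed[OF x fin, of h] by (simp add: r \<phi> mult.commute)
    qed
    show "(INF h. ereal (f h - x * h) - H x) \<le> ereal (g x)"
    proof (rule ereal_le_epsilon2)
      fix e :: real assume e: "0 < e"
      obtain h where h: "f h \<le> h * x + \<phi> x + e" using approx_supporting[OF x fin e] by blast
      have "(INF h. ereal (f h - x * h) - H x) \<le> ereal (f h - x * h) - H x" by (rule INF_lower) simp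
      also have "\<dots> \<le> ereal (g x) + ereal e" using h by (simp add: r \<phi> mult.commute)
      finally show "(INF h. ereal (f h - x * h) - H x) \<le> ereal (g x) + ereal e" .
    qed
  qed
qed

end

locale weighted_variational = variational +
  fixes Q :: "nat \<Rightarrow> nat \<Rightarrow> real"
  assumes Q_nonneg: "\<And>m N. Q m N \<ge> 0"
    and Q_upper: "\<And>b. b > 0 \<Longrightarrow> \<exists>c. \<forall>N m. 1 \<le> N \<longrightarrow> 1 \<le> m \<longrightarrow> m \<le> N \<longrightarrow>
                     Q m N \<le> c * exp (b * real N)"
    and Q_lower: "\<And>u v b. 0 < u \<Longrightarrow> u < v \<Longrightarrow> v < 1 \<Longrightarrow> b > 0 \<Longrightarrow>
                     \<exists>c>0. \<forall>N m. 1 \<le> m \<longrightarrow> m \<le> N \<longrightarrow>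
                        u \<le> real m / real N \<longrightarrow> real m / real N \<le> v \<longrightarrow>
                        Q m N \<ge> c * exp (- b * real N)"
begin

lemma Laplace_limit:
  fixes W :: "nat \<Rightarrow> nat \<Rightarrow> real" and h :: real
  assumes W_pos: "\<And>N m. 1 \<le> m \<Longrightarrow> m \<le> N \<Longrightarrow> W N m > 0"
    and W: "\<And>\<epsilon>. \<epsilon> > 0 \<Longrightarrow> \<forall>\<^sub>F N in sequentially. \<forall>m. 1 \<le> m \<longrightarrow> m \<le> N \<longrightarrow>
              \<bar>ln (W N m) / real N - g (real m / real N)\<bar> \<le> \<epsilon>"
  defines "Z \<equiv> \<lambda>N. \<Sum>m=1..N. exp (h * real m) * Psi Q H m N * W N m"
  shows "\<forall>\<^sub>F N in sequentially. Z N > 0" and "(\<lambda>N. ln (Z N) / real N) \<longlonglongrightarrow> f h"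
proof -
  have Psi_nonneg: "Psi Q H m N \<ge> 0" for m N
    by (simp add: Psi_def Q_nonneg)
  have term_nonneg: "exp (h * real m) * Psi Q H m N * W N m \<ge> 0" if "m \<in> {1..N}" for m N
    using that W_pos[of m N] Psi_nonneg by auto
  have W_eq: "W N m = exp (real N * (ln (W N m) / real N))" if "1 \<le> m" "m \<le> N" for N m
    using W_pos[OF that] that by simp
  have lower: "\<exists>c>0. \<forall>\<^sub>F N in sequentially. c * exp (real N * (f h - 3 * \<epsilon>)) \<le> Z N" if e: "\<epsilon> > 0" for \<epsilon>
  proof -
    have "\<exists>\<rho>\<in>{0<..<1}. f h - \<epsilon> < h * \<rho> + \<phi> \<rho>"
    proof (rule ccontr)
      assume "\<not> ?thesis"
      then have "f h \<le> f h - \<epsilon>" by (intro f_le) (auto simp: not_less)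
      then show False using e by simp
    qed
    then obtain \<rho> where \<rho>: "0 < \<rho>" "\<rho> < 1" and gt: "f h - \<epsilon> < h * \<rho> + \<phi> \<rho>" by auto
    have fin: "H \<rho> \<noteq> -\<infinity>" using H_finite[of \<rho>] \<rho> by auto
    obtain c where c: "c > 0" and Qc: "\<And>N m. 1 \<le> m \<Longrightarrow> m \<le> N \<Longrightarrow>
                        \<rho> / 2 \<le> real m / real N \<Longrightarrow> real m / real N \<le> (1 + \<rho>) / 2 \<Longrightarrow>
                        Q m N \<ge> c * exp (- \<epsilon> * real N)"
      using Q_lower[of "\<rho> / 2" "(1 + \<rho>) / 2" \<epsilon>] \<rho> e by auto
    define m where "m = lattice_point \<rho>"
    have m1: "\<forall>\<^sub>F N in sequentially. 1 \<le> m N \<and> m N \<le> N"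
      using eventually_ge_at_top[of 1] by eventually_elim (use lattice_point_ge_1 lattice_point_le \<rho> in \<open>auto simp: m_def\<close>)
    have lim: "(\<lambda>N. real (m N) / real N) \<longlonglongrightarrow> \<rho>" unfolding m_def using \<rho> by (intro lattice_point_tendsto) auto
    have i1: "\<forall>\<^sub>F N in sequentially. \<rho> / 2 < real (m N) / real N"
      using order_tendstoD(1)[OF lim, of "\<rho> / 2"] \<rho> by simp
    have i2: "\<forall>\<^sub>F N in sequentially. real (m N) / real N < (1 + \<rho>) / 2"
      using order_tendstoD(2)[OF lim, of "(1 + \<rho>) / 2"] \<rho> by simp
    have i0: "\<forall>\<^sub>F N in sequentially. real (m N) / real N \<in> {0<..<1}"
      using i1 i2
    proof eventually_elim
      case (elim N)
      have "0 < real (m N) / real N" by (rule less_trans[OF _ elim(1)]) (use \<rho> in simp)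
      moreover have "real (m N) / real N < 1" by (rule less_trans[OF elim(2)]) (use \<rho> in simp)
      ultimately show ?case by simp
    qed
    have "continuous_on {0<..<1} (\<lambda>y. h * y + \<phi> y)"
      unfolding continuous_on_def
    proof
      fix y :: real assume y: "y \<in> {0<..<1}"
      then have "H y \<noteq> -\<infinity>" using H_finite[OF y] by auto
      then show "((\<lambda>y. h * y + \<phi> y) \<longlongrightarrow> h * y + \<phi> y) (at y within {0<..<1})"
        using y by (intro tendsto_intros tendsto_within_subset[OF phi_tendsto]) auto
    qed
    then have "(\<lambda>N. h * (real (m N) / real N) + \<phi> (real (m N) / real N)) \<longlonglongrightarrow> h * \<rho> + \<phi> \<rho>"
    proof (rule continuous_on_tendsto_compose[OF _ lim])
      show "\<rho> \<in> {0<..<1}" using \<rho> by simp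
    qed (rule i0)
    then have i3: "\<forall>\<^sub>F N in sequentially. f h - \<epsilon> < h * (real (m N) / real N) + \<phi> (real (m N) / real N)"
      using gt by (rule order_tendstoD(1))
    have "\<forall>\<^sub>F N in sequentially. c * exp (real N * (f h - 3 * \<epsilon>)) \<le> Z N"
      using m1 i1 i2 i3 W[OF e] i0
    proof eventually_elim
      case (elim N)
      let ?x = "real (m N) / real N"
      have Np: "real N > 0" using elim by auto
      have m: "1 \<le> m N" "m N \<le> N" using elim by auto
      have "H ?x \<noteq> -\<infinity>" using H_finite[OF elim(6)] by auto
      then have P: "Psi Q H (m N) N = Q (m N) N * exp (real N * real_of_ereal (H ?x))"
        by (simp add: Psi_def)
      have "f h - 3 * \<epsilon> \<le> h * ?x + (- \<epsilon>) + real_of_ereal (H ?x) + ln (W N (m N)) / real N"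
        using elim(4) elim(5)[rule_format, OF m] unfolding \<phi>_def by linarith
      then have "real N * (f h - 3 * \<epsilon>) \<le> real N * (h * ?x + (- \<epsilon>) + real_of_ereal (H ?x) + ln (W N (m N)) / real N)"
        using Np by (intro mult_left_mono) auto
      also have "\<dots> = h * real (m N) + - \<epsilon> * real N + real N * real_of_ereal (H ?x) + real N * (ln (W N (m N)) / real N)"
        using Np by (simp add: algebra_simps)
      finally have "c * exp (real N * (f h - 3 * \<epsilon>)) \<le> c * exp \<dots>" using c by simp
      also have "\<dots> = exp (h * real (m N)) * (c * exp (- \<epsilon> * real N) * exp (real N * real_of_ereal (H ?x))) * W N (m N)"
        unfolding exp_add W_eq[OF m, symmetric] by (simp add: mult_ac)
      also have "\<dots> \<le> exp (h * real (m N)) * Psi Q H (m N) N * W N (m N)"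
        unfolding P using Qc[OF m] elim W_pos[OF m] by (intro mult_right_mono mult_left_mono) auto
      also have "\<dots> \<le> Z N"
        unfolding Z_def using m term_nonneg
        by (intro member_le_sum[of "m N" "{1..N}" "\<lambda>m. exp (h * real m) * Psi Q H m N * W N m"]) auto
      finally show ?case .
    qed
    with c show ?thesis by blast
  qed
  have upper: "\<exists>c>0. \<forall>\<^sub>F N in sequentially. Z N \<le> real N * (c * exp (real N * (f h + 2 * \<epsilon>)))" if e: "\<epsilon> > 0" for \<epsilon>
  proof -
    obtain c where c: "\<And>N m. 1 \<le> N \<Longrightarrow> 1 \<le> m \<Longrightarrow> m \<le> N \<Longrightarrow> Q m N \<le> c * exp (\<epsilon> * real N)"
      using Q_upper[OF e] by blast
    define c' where "c' = max c 1"
    have c': "c' > 0" "c \<le> c'" by (auto simp: c'_def)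
    have "\<forall>\<^sub>F N in sequentially. Z N \<le> real N * (c' * exp (real N * (f h + 2 * \<epsilon>)))"
      using W[OF e] eventually_gt_at_top[of 0]
    proof eventually_elim
      case (elim N)
      have "exp (h * real m) * Psi Q H m N * W N m \<le> c' * exp (real N * (f h + 2 * \<epsilon>))" if "m \<in> {1..N}" for m
      proof (cases "H (real m / real N) = -\<infinity>")
        case True
        then show ?thesis using c' by (simp add: Psi_def)
      next
        case False
        let ?x = "real m / real N"
        have m: "1 \<le> m" "m \<le> N" using that by auto
        have Np: "real N > 0" using elim by simp
        have x: "?x \<in> {0..1}" using m by auto
        have P: "Psi Q H m N = Q m N * exp (real N * real_of_ereal (H ?x))" using False by (simp add: Psi_def)
        have "Q m N \<le> c * exp (\<epsilon> * real N)" using m by (intro c) auto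
        also have "\<dots> \<le> c' * exp (\<epsilon> * real N)" using c' by (intro mult_right_mono) auto
        finally have q: "Q m N \<le> c' * exp (\<epsilon> * real N)" .
        have "exp (h * real m) * Psi Q H m N * W N m
           \<le> exp (h * real m) * (c' * exp (\<epsilon> * real N) * exp (real N * real_of_ereal (H ?x))) * W N m"
          unfolding P using q W_pos[OF m] by (intro mult_right_mono mult_left_mono) auto
        also have "\<dots> = c' * exp (h * real m + \<epsilon> * real N + real N * real_of_ereal (H ?x) + real N * (ln (W N m) / real N))"
          unfolding exp_add W_eq[OF m, symmetric] by (simp add: mult_ac)
        also have "\<dots> \<le> c' * exp (real N * (f h + 2 * \<epsilon>))"
        proof -
          have "h * ?x + \<epsilon> + real_of_ereal (H ?x) + ln (W N m) / real N \<le> f h + 2 * \<epsilon>"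
            using le_f_closed[OF x False, of h] elim(1)[rule_format, OF m] unfolding \<phi>_def by linarith
          from mult_left_mono[OF this, of "real N"]
          have "h * real m + \<epsilon> * real N + real N * real_of_ereal (H ?x) + real N * (ln (W N m) / real N) \<le> real N * (f h + 2 * \<epsilon>)"
            using Np by (simp add: algebra_simps)
          then show ?thesis using c' by simp
        qed
        finally show ?thesis .
      qed
      then have "Z N \<le> (\<Sum>m=1..N. c' * exp (real N * (f h + 2 * \<epsilon>)))"
        unfolding Z_def by (intro sum_mono) auto
      then show ?case by simp
    qed
    with c' show ?thesis by blast
  qed
  show pos: "\<forall>\<^sub>F N in sequentially. Z N > 0"
  proof -
    obtain c where c: "c > 0" and "\<forall>\<^sub>F N in sequentially. c * exp (real N * (f h - 3 * 1)) \<le> Z N"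
      using lower[of 1] by auto
    then show ?thesis
      by (elim eventually_mono) (smt (verit, ccfv_SIG) mult_pos_pos exp_gt_zero)
  qed
  show "(\<lambda>N. ln (Z N) / real N) \<longlonglongrightarrow> f h"
  proof (rule tendstoI)
    fix e :: real assume e: "e > 0"
    define \<epsilon> where "\<epsilon> = e / 5"
    have e5: "\<epsilon> > 0" using e by (simp add: \<epsilon>_def)
    obtain c where c: "c > 0" and lo: "\<forall>\<^sub>F N in sequentially. c * exp (real N * (f h - 3 * \<epsilon>)) \<le> Z N"
      using lower[OF e5] by blast
    obtain c' where c': "c' > 0" and up: "\<forall>\<^sub>F N in sequentially. Z N \<le> real N * (c' * exp (real N * (f h + 2 * \<epsilon>)))"
      using upper[OF e5] by blast
    have "(\<lambda>N. ln c / real N) \<longlonglongrightarrow> 0" by (rule lim_const_over_n)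
    then have l1: "\<forall>\<^sub>F N in sequentially. - \<epsilon> < ln c / real N" using e5 by (intro order_tendstoD(1)) auto
    have "(\<lambda>N. ln c' / real N) \<longlonglongrightarrow> 0" by (rule lim_const_over_n)
    moreover have "(\<lambda>N. ln (real N) / real N) \<longlonglongrightarrow> 0" by (rule lim_ln_over_n)
    ultimately have "(\<lambda>N. ln (real N) / real N + ln c' / real N) \<longlonglongrightarrow> 0"
      using tendsto_add[of "\<lambda>N. ln (real N) / real N" 0 sequentially "\<lambda>N. ln c' / real N" 0] by simp
    then have l2: "\<forall>\<^sub>F N in sequentially. ln (real N) / real N + ln c' / real N < \<epsilon>"
      using e5 by (intro order_tendstoD(2)) auto
    show "\<forall>\<^sub>F N in sequentially. dist (ln (Z N) / real N) (f h) < e"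
      using lo up l1 l2 pos eventually_gt_at_top[of 0]
    proof eventually_elim
      case (elim N)
      have Np: "real N > 0" using elim by simp
      have "ln (c * exp (real N * (f h - 3 * \<epsilon>))) \<le> ln (Z N)"
        using elim(1) c by (intro ln_mono) auto
      then have "ln c + real N * (f h - 3 * \<epsilon>) \<le> ln (Z N)" using c by (simp add: ln_mult)
      then have "(ln c + real N * (f h - 3 * \<epsilon>)) / real N \<le> ln (Z N) / real N"
        by (intro divide_right_mono) auto
      then have 1: "ln c / real N + (f h - 3 * \<epsilon>) \<le> ln (Z N) / real N"
        using Np by (simp add: add_divide_distrib)
      have "ln (Z N) \<le> ln (real N * (c' * exp (real N * (f h + 2 * \<epsilon>))))"
        using elim by (intro ln_mono) auto
      also have "\<dots> = ln (real N) + ln c' + real N * (f h + 2 * \<epsilon>)" using c' Np by (simp add: ln_mult)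
      finally have "ln (Z N) / real N \<le> (ln (real N) + ln c' + real N * (f h + 2 * \<epsilon>)) / real N"
        by (intro divide_right_mono) auto
      then have 2: "ln (Z N) / real N \<le> ln (real N) / real N + ln c' / real N + (f h + 2 * \<epsilon>)"
        using Np by (simp add: add_divide_distrib)
      have "\<bar>ln (Z N) / real N - f h\<bar> \<le> 4 * \<epsilon>" using 1 2 elim(3,4) e5 by linarith
      then show ?case using e5 by (simp add: dist_real_def \<epsilon>_def)
    qed
  qed
qed

end

section \<open>The limits\<close>

lemma concave_right_derivative_at_bot:
  fixes g :: "real \<Rightarrow> real"
  assumes conc: "concave_on {0..1} g" and cont: "continuous_on {0..1} g"
    and steep: "\<And>B. \<exists>r\<in>{0<..<1}. (g 1 - g r) / (1 - r) < B"
  shows "\<exists>d. (\<forall>\<rho>\<in>{0<..<1}. (g has_real_derivative d \<rho>) (at \<rho> within {\<rho>..})) \<and> filterlim d at_bot (at_left 1)"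
proof -
  define G where "G x = - g x" for x
  have G: "convex_on {0..1} G" using conc by (simp add: concave_on_def G_def[abs_def])
  define q where "q \<rho> y = (G \<rho> - G y) / (\<rho> - y)" for \<rho> y
  define D where "D \<rho> = Inf (q \<rho> ` ({\<rho><..} \<inter> {0..1}))" for \<rho>
  have left: "(G r - G \<rho>) / (r - \<rho>) \<le> q \<rho> y"
    if "r \<in> {0..1}" "y \<in> {0..1}" "r < \<rho>" "\<rho> < y" for r \<rho> y
    using convex_on_slope_le[OF G that] unfolding q_def by linarith
  have der: "(g has_real_derivative - D \<rho>) (at \<rho> within {\<rho>..})" if \<rho>: "\<rho> \<in> {0<..<1}" for \<rho>
  proof -
    have "(q \<rho> \<longlongrightarrow> D \<rho>) (at \<rho> within ({\<rho><..} \<inter> {0..1}))"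
      unfolding D_def
    proof (rule Lim_right_bound)
      fix a b assume ab: "a \<in> {0..1}" "b \<in> {0..1}" "\<rho> < a" "a \<le> b"
      show "q \<rho> a \<le> q \<rho> b"
      proof (cases "a = b")
        case False
        then show ?thesis unfolding q_def using ab \<rho> by (intro convex_on_slope_le(1)[OF G]) auto
      qed simp
    next
      fix a assume "a \<in> {0..1}" "\<rho> < a"
      then show "(G 0 - G \<rho>) / (0 - \<rho>) \<le> q \<rho> a" using \<rho> by (intro left) auto
    qed
    moreover have "at \<rho> within ({\<rho><..} \<inter> {0..1}) = at \<rho> within {\<rho>..}"
      by (rule at_within_nhd[of \<rho> "{0<..<1}"]) (use \<rho> in auto)
    ultimately have "(q \<rho> \<longlongrightarrow> D \<rho>) (at \<rho> within {\<rho>..})" by simp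
    then have "((\<lambda>y. - q \<rho> y) \<longlongrightarrow> - D \<rho>) (at \<rho> within {\<rho>..})" by (rule tendsto_minus)
    moreover have "- q \<rho> y = (g y - g \<rho>) / (y - \<rho>)" for y
      unfolding q_def G_def by (cases "y = \<rho>") (auto simp: field_simps)
    ultimately show ?thesis by (simp add: has_field_derivative_iff)
  qed
  have bd: "- D \<rho> \<le> (g \<rho> - g r) / (\<rho> - r)" if "0 < r" "r < \<rho>" "\<rho> < 1" for r \<rho>
  proof -
    have "(G r - G \<rho>) / (r - \<rho>) \<le> D \<rho>"
      unfolding D_def by (rule cINF_greatest) (use that in \<open>auto intro!: left exI[of _ 1]\<close>)
    moreover have "(G r - G \<rho>) / (r - \<rho>) = - ((g \<rho> - g r) / (\<rho> - r))"
      unfolding G_def using that by (simp add: field_simps)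
    ultimately show ?thesis by linarith
  qed
  have "filterlim (\<lambda>\<rho>. - D \<rho>) at_bot (at_left 1)"
    unfolding filterlim_at_bot
  proof
    fix B :: real
    obtain r where r: "0 < r" "r < 1" "(g 1 - g r) / (1 - r) < B" using steep[of B] by auto
    have "(g \<longlongrightarrow> g 1) (at 1 within {0..1})" using cont by (auto simp: continuous_on_def)
    moreover have "at (1::real) within {0..1} = at_left 1"
      by (rule at_within_nhd[of 1 "{0<..}"]) auto
    ultimately have "(g \<longlongrightarrow> g 1) (at_left 1)" by simp
    then have "((\<lambda>\<rho>. (g \<rho> - g r) / (\<rho> - r)) \<longlongrightarrow> (g 1 - g r) / (1 - r)) (at_left 1)"
      using r by (intro tendsto_intros) auto
    then have "\<forall>\<^sub>F \<rho> in at_left 1. (g \<rho> - g r) / (\<rho> - r) < B" using r by (intro order_tendstoD(2)) auto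
    moreover have "\<forall>\<^sub>F \<rho> in at_left 1. \<rho> \<in> {r<..<1}" using r eventually_at_left_real[of r 1] by auto
    ultimately show "\<forall>\<^sub>F \<rho> in at_left 1. - D \<rho> \<le> B"
    proof eventually_elim
      case (elim \<rho>)
      then have "- D \<rho> \<le> (g \<rho> - g r) / (\<rho> - r)" using r by (intro bd) auto
      then show ?case using elim(1) by linarith
    qed
  qed
  with der show ?thesis by (intro exI[of _ "\<lambda>\<rho>. - D \<rho>"]) auto
qed

lemma ln_regular_tail:
  fixes K :: "nat \<Rightarrow> real"
  assumes Kpos: "\<And>n. n \<ge> 1 \<Longrightarrow> K n > 0" and C: "C > 0"
    and tail: "K \<sim>[at_top] (\<lambda>n. C * real n powr (-(1 + \<alpha>)))" and e: "\<epsilon> > 0"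
  shows "\<exists>D. \<forall>n\<ge>1. - D - \<epsilon> * real n \<le> ln (K n)"
proof -
  have "((\<lambda>n. if K n = 0 \<and> C * real n powr (-(1 + \<alpha>)) = 0 then 1 else K n / (C * real n powr (-(1 + \<alpha>)))) \<longlongrightarrow> 1) at_top"
    using tail unfolding asymp_equiv_def .
  then have "\<forall>\<^sub>F n in at_top. 1/2 < (if K n = 0 \<and> C * real n powr (-(1 + \<alpha>)) = 0 then 1 else K n / (C * real n powr (-(1 + \<alpha>))))"
    by (rule order_tendstoD(1)) simp
  then have half: "\<forall>\<^sub>F n in sequentially. C / 2 * real n powr (-(1 + \<alpha>)) \<le> K n"
    using eventually_ge_at_top[of 1]
  proof eventually_elim
    case (elim n)
    have p: "C * real n powr (-(1 + \<alpha>)) > 0" using C elim by simp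
    then have "1/2 < K n / (C * real n powr (-(1 + \<alpha>)))" using elim(1) by (auto split: if_splits)
    then show ?case using p by (simp add: pos_less_divide_eq)
  qed
  have "(\<lambda>n. ln (C / 2) / real n - (1 + \<alpha>) * (ln (real n) / real n)) \<longlonglongrightarrow> 0 - (1 + \<alpha>) * 0"
    by (intro tendsto_intros lim_const_over_n lim_ln_over_n)
  then have "\<forall>\<^sub>F n in sequentially. - \<epsilon> < ln (C / 2) / real n - (1 + \<alpha>) * (ln (real n) / real n)"
    using e by (intro order_tendstoD(1)) auto
  then have "\<forall>\<^sub>F n in sequentially. - \<epsilon> * real n \<le> ln (K n)"
    using half eventually_ge_at_top[of 1]
  proof eventually_elim
    case (elim n)
    have n: "real n > 0" using elim by simp
    have "- \<epsilon> * real n \<le> (ln (C / 2) / real n - (1 + \<alpha>) * (ln (real n) / real n)) * real n"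
      using elim(1) n by (intro mult_right_mono) auto
    also have "\<dots> = ln (C / 2) + (-(1 + \<alpha>)) * ln (real n)" using n by (simp add: field_simps)
    also have "\<dots> = ln (C / 2 * real n powr (-(1 + \<alpha>)))" using C n by (subst ln_mult) (simp_all add: ln_powr)
    also have "\<dots> \<le> ln (K n)" using elim(2) C n by (intro ln_mono) auto
    finally show ?case .
  qed
  then obtain n0 where n0: "\<And>n. n \<ge> n0 \<Longrightarrow> - \<epsilon> * real n \<le> ln (K n)"
    unfolding eventually_sequentially by blast
  define D where "D = (\<Sum>n<n0. \<bar>ln (K n)\<bar>)"
  have "- D - \<epsilon> * real n \<le> ln (K n)" for n
  proof (cases "n \<ge> n0")
    case True
    have "D \<ge> 0" by (simp add: D_def sum_nonneg)
    then show ?thesis using n0[OF True] by simp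
  next
    case False
    then have "\<bar>ln (K n)\<bar> \<le> D" unfolding D_def by (intro member_le_sum) auto
    moreover have "\<epsilon> * real n \<ge> 0" using e by simp
    ultimately show ?thesis by linarith
  qed
  then show ?thesis by blast
qed

locale disordered_renewal_tail = disordered_renewal +
  assumes ln_K_lower: "\<And>\<epsilon>. \<epsilon> > 0 \<Longrightarrow> \<exists>D. \<forall>n\<ge>1. - D - \<epsilon> * real n \<le> ln (pmf Kp n)"
begin

lemma ln_K1_nonpos: "ln (pmf Kp 1) \<le> 0"
  using Kpos[of 1] pmf_le_1[of Kp 1] by simp

lemma mean_ln_pf_lower_linear:
  assumes "\<epsilon> > 0"
  shows "\<exists>D\<ge>0. \<forall>N m. 1 \<le> m \<longrightarrow> m \<le> N \<longrightarrow> real m * ln (pmf Kp 1) - D - \<epsilon> * real N \<le> mean_ln_pf N m"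
proof -
  obtain D where D: "\<And>n. n \<ge> 1 \<Longrightarrow> - D - \<epsilon> * real n \<le> ln (pmf Kp n)" using ln_K_lower[OF assms] by blast
  have "real m * ln (pmf Kp 1) - \<bar>D\<bar> - \<epsilon> * real N \<le> mean_ln_pf N m" if m: "1 \<le> m" "m \<le> N" for N m
  proof -
    have "\<epsilon> * real (N - m + 1) \<le> \<epsilon> * real N" using m assms by (intro mult_left_mono) auto
    then show ?thesis using D[of "N - m + 1"] mean_ln_pf_lower[OF m] by linarith
  qed
  then show ?thesis by (intro exI[of _ "\<bar>D\<bar>"]) auto
qed

lemma mean_ln_pf_bound: "\<exists>c. \<forall>N m. 1 \<le> m \<longrightarrow> m \<le> N \<longrightarrow> \<bar>mean_ln_pf N m\<bar> \<le> c * real N"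
proof -
  obtain D where D: "D \<ge> 0" "\<And>N m. 1 \<le> m \<Longrightarrow> m \<le> N \<Longrightarrow> real m * ln (pmf Kp 1) - D - 1 * real N \<le> mean_ln_pf N m"
    using mean_ln_pf_lower_linear[of 1] by auto
  define l where "l = - ln (pmf Kp 1)"
  have l: "l \<ge> 0" using ln_K1_nonpos by (simp add: l_def)
  have "\<bar>mean_ln_pf N m\<bar> \<le> (2 * \<beta> + l + D + 1) * real N" if m: "1 \<le> m" "m \<le> N" for N m
  proof -
    have "l * real m \<le> l * real N" using m l by (intro mult_left_mono) auto
    moreover have "D * 1 \<le> D * real N" using m D(1) by (intro mult_left_mono) auto
    moreover have "0 \<le> \<beta> * real N" using beta_nonneg by simp
    ultimately have lo: "- ((2 * \<beta> + l + D + 1) * real N) \<le> mean_ln_pf N m"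
      using D(2)[OF m] by (simp add: l_def algebra_simps)
    have "\<beta> * real m \<le> \<beta> * real N" using m beta_nonneg by (intro mult_left_mono) auto
    then have "mean_ln_pf N m \<le> 2 * \<beta> * real N"
      using mean_ln_pf_upper_few[of 1 m N] m by (simp add: algebra_simps)
    also have "\<dots> \<le> (2 * \<beta> + l + D + 1) * real N" using l D(1) by (intro mult_right_mono) auto
    finally show ?thesis using lo by linarith
  qed
  then show ?thesis by blast
qed

lemma endpoint_lower:
  assumes e: "\<epsilon> > 0"
  shows "\<exists>\<delta>>0. \<exists>N1. \<forall>N m. N1 \<le> N \<longrightarrow> 1 \<le> m \<longrightarrow> m \<le> N \<longrightarrow>
      \<bar>real m / real N - \<rho>\<bar> < \<delta> \<longrightarrow> \<rho> * ln (pmf Kp 1) - \<epsilon> \<le> mean_ln_pf N m / real N"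
proof -
  obtain D where D: "D \<ge> 0" "\<And>N m. 1 \<le> m \<Longrightarrow> m \<le> N \<Longrightarrow> real m * ln (pmf Kp 1) - D - \<epsilon> / 3 * real N \<le> mean_ln_pf N m"
    using mean_ln_pf_lower_linear[of "\<epsilon> / 3"] e by auto
  define l where "l = ln (pmf Kp 1)"
  define \<delta> where "\<delta> = \<epsilon> / (3 * (\<bar>l\<bar> + 1))"
  have d: "\<delta> > 0" using e by (simp add: \<delta>_def)
  have "\<bar>l\<bar> * \<delta> \<le> \<epsilon> / 3" using e by (simp add: \<delta>_def field_simps)
  obtain N1 :: nat where N1: "real N1 > 3 * D / \<epsilon>" using reals_Archimedean2 by blast
  have "\<rho> * l - \<epsilon> \<le> mean_ln_pf N m / real N"
    if N: "N1 \<le> N" and m: "1 \<le> m" "m \<le> N" and r: "\<bar>real m / real N - \<rho>\<bar> < \<delta>" for N m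
  proof -
    have Np: "real N > 0" using m by simp
    have "real N > 3 * D / \<epsilon>" using N N1 by linarith
    then have "D / real N \<le> \<epsilon> / 3" using e Np by (simp add: field_simps)
    moreover have "(real m * l - D - \<epsilon> / 3 * real N) / real N \<le> mean_ln_pf N m / real N"
      using D(2)[OF m] unfolding l_def by (intro divide_right_mono) auto
    then have "(real m / real N) * l - D / real N - \<epsilon> / 3 \<le> mean_ln_pf N m / real N"
      using Np by (simp add: diff_divide_distrib)
    moreover have "\<bar>(real m / real N) * l - \<rho> * l\<bar> \<le> \<epsilon> / 3"
    proof -
      have "(real m / real N) * l - \<rho> * l = l * (real m / real N - \<rho>)" by (simp add: algebra_simps)
      then have "\<bar>(real m / real N) * l - \<rho> * l\<bar> = \<bar>l\<bar> * \<bar>real m / real N - \<rho>\<bar>"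
        by (simp only: abs_mult)
      also have "\<dots> \<le> \<bar>l\<bar> * \<delta>" using r by (intro mult_left_mono) auto
      finally show ?thesis using \<open>\<bar>l\<bar> * \<delta> \<le> \<epsilon> / 3\<close> by linarith
    qed
    ultimately show ?thesis
      using abs_le_D2[of "(real m / real N) * l - \<rho> * l" "\<epsilon> / 3"] by argo
  qed
  then show ?thesis using d unfolding l_def by blast
qed

lemma ratio_limit_endpointI:
  assumes up: "\<And>\<epsilon>. \<epsilon> > 0 \<Longrightarrow> \<exists>\<delta>>0. \<forall>N m. 1 \<le> m \<longrightarrow> m \<le> N \<longrightarrow>
      \<bar>real m / real N - \<rho>\<bar> < \<delta> \<longrightarrow> mean_ln_pf N m / real N \<le> \<rho> * ln (pmf Kp 1) + \<epsilon>"
  shows "ratio_limit mean_ln_pf \<rho> (\<rho> * ln (pmf Kp 1))"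
  unfolding ratio_limit_def
proof (intro allI impI)
  fix \<epsilon> :: real assume e: "\<epsilon> > 0"
  obtain \<delta>1 where 1: "\<delta>1 > 0" "\<And>N m. 1 \<le> m \<Longrightarrow> m \<le> N \<Longrightarrow>
      \<bar>real m / real N - \<rho>\<bar> < \<delta>1 \<Longrightarrow> mean_ln_pf N m / real N \<le> \<rho> * ln (pmf Kp 1) + \<epsilon>"
    using up[OF e] by blast
  obtain \<delta>2 N1 where 2: "\<delta>2 > 0" "\<And>N m. N1 \<le> N \<Longrightarrow> 1 \<le> m \<Longrightarrow> m \<le> N \<Longrightarrow>
      \<bar>real m / real N - \<rho>\<bar> < \<delta>2 \<Longrightarrow> \<rho> * ln (pmf Kp 1) - \<epsilon> \<le> mean_ln_pf N m / real N"
    using endpoint_lower[OF e] by blast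
  show "\<exists>\<delta>>0. \<exists>N1. \<forall>N m. N1 \<le> N \<longrightarrow> 1 \<le> m \<longrightarrow> m \<le> N \<longrightarrow>
      \<bar>real m / real N - \<rho>\<bar> < \<delta> \<longrightarrow> \<bar>mean_ln_pf N m / real N - \<rho> * ln (pmf Kp 1)\<bar> \<le> \<epsilon>"
  proof (intro exI[of _ "min \<delta>1 \<delta>2"] conjI exI[of _ N1] allI impI)
    fix N m assume a: "N1 \<le> N" "1 \<le> m" "m \<le> N" "\<bar>real m / real N - \<rho>\<bar> < min \<delta>1 \<delta>2"
    have "mean_ln_pf N m / real N \<le> \<rho> * ln (pmf Kp 1) + \<epsilon>" by (rule 1(2)) (use a in auto)
    moreover have "\<rho> * ln (pmf Kp 1) - \<epsilon> \<le> mean_ln_pf N m / real N" by (rule 2(2)) (use a in auto)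
    ultimately show "\<bar>mean_ln_pf N m / real N - \<rho> * ln (pmf Kp 1)\<bar> \<le> \<epsilon>" by linarith
  qed (use 1 2 in auto)
qed

lemma ratio_limit_0: "ratio_limit mean_ln_pf 0 (0 * ln (pmf Kp 1))"
proof (rule ratio_limit_endpointI)
  fix \<epsilon> :: real assume e: "\<epsilon> > 0"
  define T where "T = 2 * (\<beta> + 1) / \<epsilon>"
  have T: "T > 0" using e beta_nonneg by (simp add: T_def)
  have bT: "\<beta> / T \<le> \<epsilon> / 2" using e beta_nonneg by (simp add: T_def field_simps)
  define \<delta> where "\<delta> = \<epsilon> / 2 / (\<beta> * T + 1)"
  have p: "\<beta> * T \<ge> 0" using beta_nonneg T by simp
  have d: "\<delta> > 0" using e p by (simp add: \<delta>_def)
  have dT: "\<beta> * T * \<delta> \<le> \<epsilon> / 2"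
  proof -
    have "\<beta> * T * \<delta> \<le> (\<beta> * T + 1) * \<delta>" using d by (intro mult_right_mono) auto
    also have "\<dots> = \<epsilon> / 2" unfolding \<delta>_def using p by (intro nonzero_mult_div_cancel_left[THEN trans[OF times_divide_eq_right]]) linarith
    finally show ?thesis .
  qed
  show "\<exists>\<delta>>0. \<forall>N m. 1 \<le> m \<longrightarrow> m \<le> N \<longrightarrow>
      \<bar>real m / real N - 0\<bar> < \<delta> \<longrightarrow> mean_ln_pf N m / real N \<le> 0 * ln (pmf Kp 1) + \<epsilon>"
  proof (intro exI[of _ \<delta>] conjI d allI impI)
    fix N m assume m: "1 \<le> m" "m \<le> N" and r: "\<bar>real m / real N - 0\<bar> < \<delta>"
    have Np: "real N > 0" using m by simp
    have "mean_ln_pf N m / real N \<le> \<beta> * (real N / T + T * real m) / real N"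
      using mean_ln_pf_upper_few[OF T m] by (intro divide_right_mono) auto
    also have "\<dots> = \<beta> / T + \<beta> * T * (real m / real N)" using Np by (simp add: add_divide_distrib distrib_left)
    also have "\<dots> \<le> \<epsilon> / 2 + \<beta> * T * \<delta>" using bT r p by (intro add_mono mult_left_mono) auto
    finally show "mean_ln_pf N m / real N \<le> 0 * ln (pmf Kp 1) + \<epsilon>" using dT by simp
  qed
qed

lemma ratio_limit_1: "ratio_limit mean_ln_pf 1 (1 * ln (pmf Kp 1))"
proof (rule ratio_limit_endpointI)
  fix \<epsilon> :: real assume e: "\<epsilon> > 0"
  have K1: "pmf Kp 1 > 0" by (rule Kpos) simp
  have "((\<lambda>s. \<beta> / s + ln (pmf Kp 1 + exp (- s))) \<longlongrightarrow> 0 + ln (pmf Kp 1 + 0)) at_top"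
  proof (intro tendsto_intros)
    show "((\<lambda>s. \<beta> / s) \<longlongrightarrow> 0) at_top" by (intro tendsto_divide_0[OF tendsto_const] filterlim_at_top_imp_at_infinity filterlim_ident)
    show "((\<lambda>s::real. exp (- s)) \<longlongrightarrow> 0) at_top"
      by (rule filterlim_compose[OF exp_at_bot filterlim_uminus_at_bot_at_top])
    show "pmf Kp 1 + 0 \<noteq> 0" using K1 by simp
  qed
  then have "\<forall>\<^sub>F s in at_top. \<beta> / s + ln (pmf Kp 1 + exp (- s)) < ln (pmf Kp 1) + \<epsilon> / 2"
    using e by (intro order_tendstoD(2)) auto
  then have "\<forall>\<^sub>F s in at_top. s > 0 \<and> \<beta> / s + ln (pmf Kp 1 + exp (- s)) < ln (pmf Kp 1) + \<epsilon> / 2"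
    using eventually_gt_at_top[of "0::real"] by eventually_elim auto
  then obtain s where s: "s > 0" and sl: "\<beta> / s + ln (pmf Kp 1 + exp (- s)) < ln (pmf Kp 1) + \<epsilon> / 2"
    using eventually_happens by (metis (mono_tags, lifting) trivial_limit_at_top_linorder)
  define q where "q = ln (pmf Kp 1 + exp (- s))"
  define A where "A = \<beta> * s + s + \<bar>q\<bar>"
  have A0: "A \<ge> 0" using beta_nonneg s by (simp add: A_def)
  define \<delta> where "\<delta> = \<epsilon> / 2 / (A + 1)"
  have d: "\<delta> > 0" using e A0 by (simp add: \<delta>_def)
  have dA: "A * \<delta> \<le> \<epsilon> / 2"
  proof -
    have "A * \<delta> \<le> (A + 1) * \<delta>" using d by (intro mult_right_mono) auto
    also have "\<dots> = \<epsilon> / 2" unfolding \<delta>_def using A0 by (intro nonzero_mult_div_cancel_left[THEN trans[OF times_divide_eq_right]]) linarith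
    finally show ?thesis .
  qed
  show "\<exists>\<delta>>0. \<forall>N m. 1 \<le> m \<longrightarrow> m \<le> N \<longrightarrow>
      \<bar>real m / real N - 1\<bar> < \<delta> \<longrightarrow> mean_ln_pf N m / real N \<le> 1 * ln (pmf Kp 1) + \<epsilon>"
  proof (intro exI[of _ \<delta>] conjI d allI impI)
    fix N m assume m: "1 \<le> m" "m \<le> N" and r: "\<bar>real m / real N - 1\<bar> < \<delta>"
    have Np: "real N > 0" using m by simp
    define x where "x = real m / real N"
    have x: "0 \<le> 1 - x" "1 - x < \<delta>" using m r by (auto simp: x_def)
    have mx: "real m = x * real N" using Np by (simp add: x_def)
    have "mean_ln_pf N m / real N \<le>
        (\<beta> * (real N / s + s * (real N - real m)) + s * (real N - real m) + real m * q) / real N"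
      unfolding q_def using mean_ln_pf_upper_many[OF s _ m, of s] s by (intro divide_right_mono) auto
    also have "\<dots> = \<beta> / s + (\<beta> * s + s) * (1 - x) + x * q"
      unfolding mx using Np s by (simp add: field_simps)
    also have "x * q = q - (1 - x) * q" by (simp add: algebra_simps)
    also have "- ((1 - x) * q) \<le> (1 - x) * \<bar>q\<bar>"
      using x mult_left_mono[of "- q" "\<bar>q\<bar>" "1 - x"] by simp
    then have "\<beta> / s + (\<beta> * s + s) * (1 - x) + (q - (1 - x) * q) \<le> (\<beta> / s + q) + A * (1 - x)"
      by (simp add: A_def algebra_simps)
    also have "A * (1 - x) \<le> A * \<delta>" using x A0 by (intro mult_left_mono) auto
    finally show "mean_ln_pf N m / real N \<le> 1 * ln (pmf Kp 1) + \<epsilon>"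
      using sl dA unfolding q_def by linarith
  qed
qed

lemma ex_limit_function:
  "\<exists>c g. superadditive_limit mean_ln_pf c g \<and> g 0 = 0 \<and> g 1 = ln (pmf Kp 1)"
proof -
  obtain c where c: "\<And>N m. 1 \<le> m \<Longrightarrow> m \<le> N \<Longrightarrow> \<bar>mean_ln_pf N m\<bar> \<le> c * real N"
    using mean_ln_pf_bound by blast
  interpret sa: superadditive_array mean_ln_pf c
    by unfold_locales (auto intro: mean_ln_pf_superadditive c)
  define g where "g \<rho> = (if \<rho> = 0 \<or> \<rho> = 1 then \<rho> * ln (pmf Kp 1) else sa.U \<rho>)" for \<rho>
  have "superadditive_limit mean_ln_pf c g"
  proof
    fix \<rho> :: real assume "\<rho> \<in> {0..1}"
    then consider "\<rho> = 0" | "\<rho> = 1" | "0 < \<rho>" "\<rho> < 1" by force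
    then show "ratio_limit mean_ln_pf \<rho> (g \<rho>)"
      by cases (use ratio_limit_0 ratio_limit_1 sa.ratio_limit_interior in \<open>auto simp: g_def\<close>)
  qed
  then show ?thesis by (intro exI[of _ c] exI[of _ g]) (simp add: g_def)
qed

lemma steep_at_1:
  assumes "superadditive_limit mean_ln_pf c g" "g 1 = ln (pmf Kp 1)"
  shows "\<exists>r\<in>{0<..<1}. (g 1 - g r) / (1 - r) < B"
proof -
  interpret superadditive_limit mean_ln_pf c g by fact
  define l where "l = ln (pmf Kp 1)"
  have "filterlim (\<lambda>m::nat. ln (real (Suc m))) at_top sequentially"
    by (intro filterlim_compose[OF ln_at_top] filterlim_compose[OF filterlim_real_sequentially filterlim_Suc])
  then have "\<forall>\<^sub>F m in sequentially. 2 * l - ln (pmf Kp 2) - B < ln (real (Suc m))"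
    unfolding filterlim_at_top_dense by blast
  then obtain m where m: "2 * l - ln (pmf Kp 2) - B < ln (real (Suc m))"
    by (auto simp: eventually_sequentially)
  define r where "r = real (Suc m) / real (Suc (Suc m))"
  have q: "1 - r = 1 / real (Suc (Suc m))" by (simp add: r_def field_simps)
  have "mean_ln_pf (Suc (Suc m)) (Suc m) / real (Suc (Suc m)) \<le> g r"
    unfolding r_def by (rule ratio_le_g) auto
  then have "mean_ln_pf (Suc (Suc m)) (Suc m) \<le> real (Suc (Suc m)) * g r"
    by (simp add: field_simps del: of_nat_Suc)
  then have "ln (real (Suc m)) + ln (pmf Kp 2) + real m * l \<le> real (Suc (Suc m)) * g r"
    using mean_ln_pf_subdiag[of m] unfolding l_def by linarith
  then have "real (Suc (Suc m)) * (g 1 - g r) \<le> 2 * l - ln (pmf Kp 2) - ln (real (Suc m))"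
    unfolding assms(2) l_def[symmetric] by (simp add: algebra_simps)
  also have "\<dots> < B" using m by linarith
  finally have "(g 1 - g r) / (1 - r) < B" unfolding q by (simp add: mult.commute del: of_nat_Suc)
  moreover have "r \<in> {0<..<1}" by (simp add: r_def)
  ultimately show ?thesis by blast
qed

lemma AE_ln_pf_uniform:
  assumes "superadditive_limit mean_ln_pf c g"
  shows "AE \<omega> in \<P>. \<forall>\<epsilon>>0. \<forall>\<^sub>F N in sequentially. \<forall>m. 1 \<le> m \<longrightarrow> m \<le> N \<longrightarrow>
     \<bar>ln (ren_pf Kp \<beta> m N \<omega>) / real N - g (real m / real N)\<bar> \<le> \<epsilon>"
proof -
  interpret superadditive_limit mean_ln_pf c g by fact
  have "AE \<omega> in \<P>. \<forall>\<epsilon>>0. \<forall>\<^sub>F N in sequentially. \<forall>m\<le>N.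
     \<bar>ln (ren_pf Kp \<beta> m N \<omega>) - (\<integral>\<omega>. ln (ren_pf Kp \<beta> m N \<omega>) \<partial>\<P>)\<bar> \<le> \<epsilon> * real N"
    by (rule concentration_AE[OF beta_nonneg _ coord_lipschitz_ln_pf]) measurable
  then show ?thesis
  proof (rule AE_mp, intro AE_I2 impI allI)
    fix \<omega> and \<epsilon> :: real
    assume A: "\<forall>\<epsilon>>0. \<forall>\<^sub>F N in sequentially. \<forall>m\<le>N.
     \<bar>ln (ren_pf Kp \<beta> m N \<omega>) - (\<integral>\<omega>. ln (ren_pf Kp \<beta> m N \<omega>) \<partial>\<P>)\<bar> \<le> \<epsilon> * real N" and e: "\<epsilon> > 0"
    have e2: "\<epsilon> / 2 > 0" using e by simp
    show "\<forall>\<^sub>F N in sequentially. \<forall>m. 1 \<le> m \<longrightarrow> m \<le> N \<longrightarrow>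
       \<bar>ln (ren_pf Kp \<beta> m N \<omega>) / real N - g (real m / real N)\<bar> \<le> \<epsilon>"
      using A[rule_format, OF e2] uniform_limit_g[OF e2]
    proof eventually_elim
      case (elim N)
      show ?case
      proof (intro allI impI)
        fix m assume m: "1 \<le> m" "m \<le> N"
        have Np: "real N > 0" using m by simp
        have "\<bar>ln (ren_pf Kp \<beta> m N \<omega>) - mean_ln_pf N m\<bar> / real N \<le> \<epsilon> / 2 * real N / real N"
          using elim(1) m unfolding mean_ln_pf_def by (intro divide_right_mono) auto
        then have "\<bar>ln (ren_pf Kp \<beta> m N \<omega>) / real N - mean_ln_pf N m / real N\<bar> \<le> \<epsilon> / 2"
          using Np by (simp add: diff_divide_distrib[symmetric])
        then show "\<bar>ln (ren_pf Kp \<beta> m N \<omega>) / real N - g (real m / real N)\<bar> \<le> \<epsilon>"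
          using elim(2)[rule_format, OF m] by linarith
      qed
    qed
  qed
qed

lemma AE_constrained_limit:
  assumes "superadditive_limit mean_ln_pf c g" and \<rho>: "\<rho> \<in> {0..1}"
  shows "AE \<omega> in \<P>.
          \<forall>Ns ms :: nat \<Rightarrow> nat.
            (\<forall>k. 1 \<le> ms k \<and> ms k \<le> Ns k) \<longrightarrow> filterlim Ns at_top sequentially \<longrightarrow>
            (\<lambda>k. real (ms k) / real (Ns k)) \<longlonglongrightarrow> \<rho> \<longrightarrow>
            (\<lambda>k. ln (constrained_pf Kp \<beta> \<omega> (Ns k) (ms k)) / real (Ns k)) \<longlonglongrightarrow> g \<rho>"
  using AE_ln_pf_uniform[OF assms(1)]
proof (rule AE_mp, intro AE_I2 impI allI)
  interpret superadditive_limit mean_ln_pf c g by fact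
  fix \<omega> and Ns ms :: "nat \<Rightarrow> nat"
  assume A: "\<forall>\<epsilon>>0. \<forall>\<^sub>F N in sequentially. \<forall>m. 1 \<le> m \<longrightarrow> m \<le> N \<longrightarrow>
     \<bar>ln (ren_pf Kp \<beta> m N \<omega>) / real N - g (real m / real N)\<bar> \<le> \<epsilon>"
    and m: "\<forall>k. 1 \<le> ms k \<and> ms k \<le> Ns k" and N: "filterlim Ns at_top sequentially"
    and r: "(\<lambda>k. real (ms k) / real (Ns k)) \<longlonglongrightarrow> \<rho>"
  have "(\<lambda>k. g (real (ms k) / real (Ns k))) \<longlonglongrightarrow> g \<rho>"
  proof (rule continuous_on_tendsto_compose[OF continuous_g r \<rho>])
    show "\<forall>\<^sub>F k in sequentially. real (ms k) / real (Ns k) \<in> {0..1}"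
      using m by (intro always_eventually) (auto simp: divide_le_eq)
  qed
  moreover have "(\<lambda>k. ln (ren_pf Kp \<beta> (ms k) (Ns k) \<omega>) / real (Ns k) - g (real (ms k) / real (Ns k))) \<longlonglongrightarrow> 0"
  proof (rule tendstoI)
    fix e :: real assume e: "e > 0"
    have "\<forall>\<^sub>F k in sequentially. \<forall>m. 1 \<le> m \<longrightarrow> m \<le> Ns k \<longrightarrow>
       \<bar>ln (ren_pf Kp \<beta> m (Ns k) \<omega>) / real (Ns k) - g (real m / real (Ns k))\<bar> \<le> e / 2"
      using eventually_compose_filterlim[OF A[rule_format, of "e / 2"] N] e by simp
    then show "\<forall>\<^sub>F k in sequentially. dist (ln (ren_pf Kp \<beta> (ms k) (Ns k) \<omega>) / real (Ns k) - g (real (ms k) / real (Ns k))) 0 < e"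
      by eventually_elim (use m e in \<open>force simp: dist_real_def\<close>)
  qed
  ultimately have "(\<lambda>k. (ln (ren_pf Kp \<beta> (ms k) (Ns k) \<omega>) / real (Ns k) - g (real (ms k) / real (Ns k))) + g (real (ms k) / real (Ns k))) \<longlonglongrightarrow> 0 + g \<rho>"
    by (intro tendsto_add)
  then show "(\<lambda>k. ln (constrained_pf Kp \<beta> \<omega> (Ns k) (ms k)) / real (Ns k)) \<longlonglongrightarrow> g \<rho>"
    by (simp add: constrained_pf_eq)
qed

end

context disordered_renewal_tail
begin

lemma free_energy:
  assumes sl: "superadditive_limit mean_ln_pf c g" and var: "weighted_variational g H Q"
  shows "AE \<omega> in \<P>.
               (\<forall>\<^sub>F N in sequentially. Z_Psi Kp Q H \<beta> h \<omega> N > 0)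
             \<and> (\<lambda>N. ln (Z_Psi Kp Q H \<beta> h \<omega> N) / real N) \<longlonglongrightarrow> variational.f g H h" (is ?AE)
    and "\<forall>\<^sub>F N in sequentially. integrable \<P> (\<lambda>\<omega>. ln (Z_Psi Kp Q H \<beta> h \<omega> N))" (is ?I)
    and "(\<lambda>N. \<integral>\<omega>. \<bar>ln (Z_Psi Kp Q H \<beta> h \<omega> N) / real N - variational.f g H h\<bar> \<partial>\<P>) \<longlonglongrightarrow> 0" (is ?L)
proof -
  interpret superadditive_limit mean_ln_pf c g by fact
  interpret weighted_variational g H Q by fact
  interpret P: prob_space \<P> by (rule prob_space_disorder)
  define S where "S N \<omega> = (\<Sum>m=1..N. exp (h * real m) * Psi Q H m N * ren_pf Kp \<beta> m N \<omega>)" for N \<omega>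
  have ZS: "Z_Psi Kp Q H \<beta> h \<omega> N = S N \<omega>" if "N \<ge> 1" for N \<omega>
    unfolding S_def by (rule Z_Psi_eq[OF that])
  have ev_eq: "\<forall>\<^sub>F N in sequentially. (\<lambda>\<omega>. Z_Psi Kp Q H \<beta> h \<omega> N) = S N"
    using eventually_ge_at_top[of 1] by eventually_elim (auto simp: ZS)
  have Psi_nonneg: "Psi Q H m N \<ge> 0" for m N by (simp add: Psi_def Q_nonneg)
  have mS[measurable]: "(\<lambda>\<omega>. ln (S N \<omega>)) \<in> borel_measurable \<P>" for N
    unfolding S_def by measurable
  have LS: "coord_lipschitz \<beta> (Suc N) (\<lambda>\<omega>. ln (S N \<omega>))" for N
  proof (rule coord_lipschitz_ln[OF _ _ beta_nonneg])
    show "S N \<omega> \<ge> 0" for \<omega>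
      unfolding S_def by (intro sum_nonneg mult_nonneg_nonneg Psi_nonneg pf_nonneg) auto
    show "S N \<omega> \<le> exp (\<beta> * (\<Sum>j<Suc N. \<bar>\<omega> j - \<omega>' j\<bar>)) * S N \<omega>'" for \<omega> \<omega>'
    proof -
      define e where "e = exp (\<beta> * (\<Sum>j<Suc N. \<bar>\<omega> j - \<omega>' j\<bar>))"
      have "S N \<omega> \<le> (\<Sum>m=1..N. e * (exp (h * real m) * Psi Q H m N * ren_pf Kp \<beta> m N \<omega>'))"
        unfolding S_def
      proof (rule sum_mono)
        fix m
        have "exp (h * real m) * Psi Q H m N * ren_pf Kp \<beta> m N \<omega>
          \<le> exp (h * real m) * Psi Q H m N * (e * ren_pf Kp \<beta> m N \<omega>')"
          unfolding e_def
          by (intro mult_left_mono pf_lipschitz beta_nonneg mult_nonneg_nonneg Psi_nonneg) auto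
        then show "exp (h * real m) * Psi Q H m N * ren_pf Kp \<beta> m N \<omega>
          \<le> e * (exp (h * real m) * Psi Q H m N * ren_pf Kp \<beta> m N \<omega>')"
          by (simp only: mult_ac)
      qed
      also have "\<dots> = e * S N \<omega>'" unfolding S_def sum_distrib_left ..
      finally show ?thesis unfolding e_def .
    qed
  qed
  have iS: "integrable \<P> (\<lambda>\<omega>. ln (S N \<omega>))" for N by (rule coord_lipschitz_integrable[OF mS LS])
  define E where "E N = (\<integral>\<omega>. ln (S N \<omega>) \<partial>\<P>)" for N
  have lim: "AE \<omega> in \<P>. (\<forall>\<^sub>F N in sequentially. S N \<omega> > 0) \<and> (\<lambda>N. ln (S N \<omega>) / real N) \<longlonglongrightarrow> f h"
    using AE_ln_pf_uniform[OF sl]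
  proof (rule AE_mp, intro AE_I2 impI)
    fix \<omega>
    assume A: "\<forall>\<epsilon>>0. \<forall>\<^sub>F N in sequentially. \<forall>m. 1 \<le> m \<longrightarrow> m \<le> N \<longrightarrow>
       \<bar>ln (ren_pf Kp \<beta> m N \<omega>) / real N - g (real m / real N)\<bar> \<le> \<epsilon>"
    note L = Laplace_limit[of "\<lambda>N m. ren_pf Kp \<beta> m N \<omega>" h, OF pf_pos A[rule_format]]
    show "(\<forall>\<^sub>F N in sequentially. S N \<omega> > 0) \<and> (\<lambda>N. ln (S N \<omega>) / real N) \<longlonglongrightarrow> f h"
      unfolding S_def using L by blast
  qed
  show ?AE
    using lim
  proof (rule AE_mp, intro AE_I2 impI)
    fix \<omega> assume A: "(\<forall>\<^sub>F N in sequentially. S N \<omega> > 0) \<and> (\<lambda>N. ln (S N \<omega>) / real N) \<longlonglongrightarrow> f h"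
    have e: "\<forall>\<^sub>F N in sequentially. S N \<omega> = Z_Psi Kp Q H \<beta> h \<omega> N"
      using ev_eq by eventually_elim (simp add: fun_eq_iff)
    show "(\<forall>\<^sub>F N in sequentially. Z_Psi Kp Q H \<beta> h \<omega> N > 0) \<and> (\<lambda>N. ln (Z_Psi Kp Q H \<beta> h \<omega> N) / real N) \<longlonglongrightarrow> f h"
    proof
      show "\<forall>\<^sub>F N in sequentially. Z_Psi Kp Q H \<beta> h \<omega> N > 0"
        using conjunct1[OF A] e by eventually_elim simp
      show "(\<lambda>N. ln (Z_Psi Kp Q H \<beta> h \<omega> N) / real N) \<longlonglongrightarrow> f h"
        by (rule Lim_transform_eventually[OF conjunct2[OF A]]) (use e in eventually_elim, simp)
    qed
  qed
  show ?I using ev_eq by eventually_elim (use iS in \<open>simp add: fun_eq_iff\<close>)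
  have "AE \<omega> in \<P>. \<forall>\<epsilon>>0. \<forall>\<^sub>F N in sequentially. \<forall>i\<le>N. \<bar>ln (S N \<omega>) - E N\<bar> \<le> \<epsilon> * real N"
    unfolding E_def by (rule concentration_AE[OF beta_nonneg mS LS])
  with lim have "AE \<omega> in \<P>. (\<lambda>N. ln (S N \<omega>) / real N) \<longlonglongrightarrow> f h \<and>
      (\<forall>\<epsilon>>0. \<forall>\<^sub>F N in sequentially. \<forall>i\<le>N. \<bar>ln (S N \<omega>) - E N\<bar> \<le> \<epsilon> * real N)"
    by eventually_elim auto
  then have "\<exists>\<omega>. (\<lambda>N. ln (S N \<omega>) / real N) \<longlonglongrightarrow> f h \<and>
      (\<forall>\<epsilon>>0. \<forall>\<^sub>F N in sequentially. \<forall>i\<le>N. \<bar>ln (S N \<omega>) - E N\<bar> \<le> \<epsilon> * real N)"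
    using eventually_happens'[OF P.ae_filter_bot] by blast
  then obtain \<omega> where w1: "(\<lambda>N. ln (S N \<omega>) / real N) \<longlonglongrightarrow> f h"
    and w2: "\<And>\<epsilon>. \<epsilon> > 0 \<Longrightarrow> \<forall>\<^sub>F N in sequentially. \<forall>i\<le>N. \<bar>ln (S N \<omega>) - E N\<bar> \<le> \<epsilon> * real N"
    by blast
  have "(\<lambda>N. ln (S N \<omega>) / real N - E N / real N) \<longlonglongrightarrow> 0"
  proof (rule tendstoI)
    fix e :: real assume e: "e > 0"
    have "\<forall>\<^sub>F N in sequentially. \<forall>i\<le>N. \<bar>ln (S N \<omega>) - E N\<bar> \<le> e / 2 * real N" using w2[of "e / 2"] e by simp
    then show "\<forall>\<^sub>F N in sequentially. dist (ln (S N \<omega>) / real N - E N / real N) 0 < e"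
      using eventually_gt_at_top[of 0]
    proof eventually_elim
      case (elim N)
      then have "\<bar>ln (S N \<omega>) - E N\<bar> \<le> e / 2 * real N" by blast
      then have "\<bar>ln (S N \<omega>) - E N\<bar> / real N \<le> e / 2" using elim by (simp add: divide_le_eq)
      moreover have "dist (ln (S N \<omega>) / real N - E N / real N) 0 = \<bar>ln (S N \<omega>) - E N\<bar> / real N"
        by (simp add: dist_real_def diff_divide_distrib[symmetric])
      ultimately show ?case using e by linarith
    qed
  qed
  from tendsto_diff[OF w1 this] have EN: "(\<lambda>N. E N / real N) \<longlonglongrightarrow> f h" by simp
  have "(\<lambda>N. \<integral>\<omega>. \<bar>ln (S N \<omega>) / real N - f h\<bar> \<partial>\<P>) \<longlonglongrightarrow> 0"
  proof (rule tendsto_sandwich)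
    show "\<forall>\<^sub>F N in sequentially. 0 \<le> (\<integral>\<omega>. \<bar>ln (S N \<omega>) / real N - f h\<bar> \<partial>\<P>)"
      by (intro always_eventually allI integral_nonneg_AE) auto
    show "(\<lambda>N. (\<integral>\<omega>. \<bar>ln (S N \<omega>) - E N\<bar> \<partial>\<P>) / real N + \<bar>E N / real N - f h\<bar>) \<longlonglongrightarrow> 0"
    proof -
      have "(\<lambda>N. \<bar>E N / real N - f h\<bar>) \<longlonglongrightarrow> \<bar>f h - f h\<bar>" by (intro tendsto_intros EN)
      then show ?thesis
        using tendsto_add[OF concentration_L1[OF beta_nonneg mS LS]] unfolding E_def by fastforce
    qed
    show "\<forall>\<^sub>F N in sequentially. (\<integral>\<omega>. \<bar>ln (S N \<omega>) / real N - f h\<bar> \<partial>\<P>)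
        \<le> (\<integral>\<omega>. \<bar>ln (S N \<omega>) - E N\<bar> \<partial>\<P>) / real N + \<bar>E N / real N - f h\<bar>"
    proof (intro always_eventually allI)
      fix N
      have i1: "integrable \<P> (\<lambda>\<omega>. \<bar>ln (S N \<omega>) - E N\<bar> / real N)"
        using iS by (intro integrable_divide integrable_abs Bochner_Integration.integrable_diff P.integrable_const)
      have "(\<integral>\<omega>. \<bar>ln (S N \<omega>) / real N - f h\<bar> \<partial>\<P>)
          \<le> (\<integral>\<omega>. \<bar>ln (S N \<omega>) - E N\<bar> / real N + \<bar>E N / real N - f h\<bar> \<partial>\<P>)"
      proof (rule integral_mono)
        show "integrable \<P> (\<lambda>\<omega>. \<bar>ln (S N \<omega>) / real N - f h\<bar>)"
          using iS by (intro integrable_divide integrable_abs Bochner_Integration.integrable_diff P.integrable_const)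
        show "integrable \<P> (\<lambda>\<omega>. \<bar>ln (S N \<omega>) - E N\<bar> / real N + \<bar>E N / real N - f h\<bar>)"
          using i1 by (intro Bochner_Integration.integrable_add P.integrable_const)
        fix \<omega>
        have "\<bar>ln (S N \<omega>) - E N\<bar> / real N = \<bar>ln (S N \<omega>) / real N - E N / real N\<bar>"
          by (simp add: diff_divide_distrib[symmetric])
        then show "\<bar>ln (S N \<omega>) / real N - f h\<bar> \<le> \<bar>ln (S N \<omega>) - E N\<bar> / real N + \<bar>E N / real N - f h\<bar>"
          by linarith
      qed
      also have "\<dots> = (\<integral>\<omega>. \<bar>ln (S N \<omega>) - E N\<bar> \<partial>\<P>) / real N + \<bar>E N / real N - f h\<bar>"
        using i1 by (simp add: P.prob_space)
      finally show "(\<integral>\<omega>. \<bar>ln (S N \<omega>) / real N - f h\<bar> \<partial>\<P>)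
        \<le> (\<integral>\<omega>. \<bar>ln (S N \<omega>) - E N\<bar> \<partial>\<P>) / real N + \<bar>E N / real N - f h\<bar>" .
    qed
  qed simp
  then show ?L
    by (rule Lim_transform_eventually) (use ev_eq in eventually_elim, simp add: fun_eq_iff)
qed

end

theorem theorem1p2:
  fixes Kp :: "nat pmf" and C_K \<alpha> :: real and \<mu> :: "real measure"
    and H :: "real \<Rightarrow> ereal" and Q :: "nat \<Rightarrow> nat \<Rightarrow> real"
  assumes K0: "pmf Kp 0 = 0"
    and Kpos: "\<And>n. n \<ge> 1 \<Longrightarrow> pmf Kp n > 0"
    and alpha_pos: "\<alpha> > 0" and CK_pos: "C_K > 0"
    and K_tail: "(\<lambda>n. pmf Kp n) \<sim>[at_top] (\<lambda>n. C_K * real n powr (-(1 + \<alpha>)))"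
    and mu_prob: "prob_space \<mu>" and mu_borel: "sets \<mu> = sets borel"
    and mu_expmom: "\<And>s. integrable \<mu> (\<lambda>x. exp (s * x))"
    and mu_mean: "(\<integral>x. x \<partial>\<mu>) = 0"
    and mu_var: "(\<integral>x. x ^ 2 \<partial>\<mu>) = 1"
    and H_concave: "ereal_concave_on {0..1} H"
    and H_finite: "\<And>x. x \<in> {0<..<1} \<Longrightarrow> \<bar>H x\<bar> \<noteq> \<infinity>"
    and H_not_pinf: "\<And>x. H x \<noteq> \<infinity>"
    and H_analytic: "real_analytic_on (\<lambda>x. real_of_ereal (H x)) {0<..<1}"
    and H_cont: "continuous_on {0..1} H"
    and Q_nonneg: "\<And>m N. Q m N \<ge> 0"
    and Q_upper: "\<And>b. b > 0 \<Longrightarrow> \<exists>c. \<forall>N m. 1 \<le> N \<longrightarrow> 1 \<le> m \<longrightarrow> m \<le> N \<longrightarrow>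
                     Q m N \<le> c * exp (b * real N)"
    and Q_lower: "\<And>u v b. 0 < u \<Longrightarrow> u < v \<Longrightarrow> v < 1 \<Longrightarrow> b > 0 \<Longrightarrow>
                     \<exists>c>0. \<forall>N m. 1 \<le> m \<longrightarrow> m \<le> N \<longrightarrow>
                        u \<le> real m / real N \<longrightarrow> real m / real N \<le> v \<longrightarrow>
                        Q m N \<ge> c * exp (- b * real N)"
  shows "\<exists>g f :: real \<Rightarrow> real \<Rightarrow> real.
    (\<forall>\<beta>\<ge>0.
       (\<forall>\<rho>\<in>{0..1}. AE \<omega> in disorder_law \<mu>.
          \<forall>Ns ms :: nat \<Rightarrow> nat.
            (\<forall>k. 1 \<le> ms k \<and> ms k \<le> Ns k) \<longrightarrow> filterlim Ns at_top sequentially \<longrightarrow>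
            (\<lambda>k. real (ms k) / real (Ns k)) \<longlonglongrightarrow> \<rho> \<longrightarrow>
            (\<lambda>k. ln (constrained_pf Kp \<beta> \<omega> (Ns k) (ms k)) / real (Ns k)) \<longlonglongrightarrow> g \<beta> \<rho>)
     \<and> concave_on {0..1} (g \<beta>)
     \<and> g \<beta> 0 = 0 \<and> (g \<beta> \<longlongrightarrow> 0) (at_right 0)
     \<and> g \<beta> 1 = ln (pmf Kp 1) \<and> (g \<beta> \<longlongrightarrow> ln (pmf Kp 1)) (at_left 1)
     \<and> (\<exists>d. (\<forall>\<rho>\<in>{0<..<1}. (g \<beta> has_real_derivative d \<rho>) (at \<rho> within {\<rho>..}))
            \<and> filterlim d at_bot (at_left 1)))
  \<and> (\<forall>\<beta>\<ge>0.
       (\<forall>h. (AE \<omega> in disorder_law \<mu>.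
               (\<forall>\<^sub>F N in sequentially. Z_Psi Kp Q H \<beta> h \<omega> N > 0)
             \<and> (\<lambda>N. ln (Z_Psi Kp Q H \<beta> h \<omega> N) / real N) \<longlonglongrightarrow> f \<beta> h)
          \<and> (\<forall>\<^sub>F N in sequentially.
               integrable (disorder_law \<mu>) (\<lambda>\<omega>. ln (Z_Psi Kp Q H \<beta> h \<omega> N)))
          \<and> (\<lambda>N. \<integral>\<omega>. \<bar>ln (Z_Psi Kp Q H \<beta> h \<omega> N) / real N - f \<beta> h\<bar> \<partial>disorder_law \<mu>)
               \<longlonglongrightarrow> 0)
     \<and> mono (f \<beta>) \<and> convex_on UNIV (f \<beta>)
     \<and> (\<forall>h. ereal (f \<beta> h) = (SUP \<rho>\<in>{0..1}. ereal (h * \<rho> + g \<beta> \<rho>) + H \<rho>))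
     \<and> (\<forall>\<rho>\<in>{0..1}. H \<rho> \<noteq> -\<infinity> \<longrightarrow>
          ereal (g \<beta> \<rho>) = (INF h. ereal (f \<beta> h - \<rho> * h) - H \<rho>)))"
proof -
  have model: "disordered_renewal_tail \<mu> Kp \<beta>" if "\<beta> \<ge> 0" for \<beta>
    by (intro disordered_renewal_tail.intro disordered_renewal.intro iid_disorder.intro
        iid_disorder_axioms.intro renewal_kernel.intro disordered_renewal_axioms.intro
        disordered_renewal_tail_axioms.intro mu_prob mu_borel mu_expmom mu_mean mu_var K0 Kpos that
        ln_regular_tail[OF Kpos CK_pos K_tail])
  define lim where "lim \<beta> g \<longleftrightarrow>
    (\<exists>c. superadditive_limit (disordered_renewal.mean_ln_pf \<mu> Kp \<beta>) c g) \<and> g 0 = 0 \<and> g 1 = ln (pmf Kp 1)" for \<beta> g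
  have "\<exists>g. \<beta> \<ge> 0 \<longrightarrow> lim \<beta> g" for \<beta>
    using disordered_renewal_tail.ex_limit_function[OF model, of \<beta>] unfolding lim_def by blast
  then obtain g where lim: "\<And>\<beta>. \<beta> \<ge> 0 \<Longrightarrow> lim \<beta> (g \<beta>)" by metis
  show ?thesis
  proof ((rule exI[of _ g], rule exI[of _ "\<lambda>\<beta>. variational.f (g \<beta>) H"], rule conjI; intro allI impI), goal_cases)
    case (1 \<beta>)
    interpret disordered_renewal_tail \<mu> Kp \<beta> by (rule model[OF 1])
    obtain c where sl: "superadditive_limit mean_ln_pf c (g \<beta>)" and g0: "g \<beta> 0 = 0" and g1: "g \<beta> 1 = ln (pmf Kp 1)"
      using lim[OF 1] unfolding lim_def by blast
    interpret superadditive_limit mean_ln_pf c "g \<beta>" by fact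
    have "(g \<beta> \<longlongrightarrow> g \<beta> 0) (at 0 within {0..1})" "(g \<beta> \<longlongrightarrow> g \<beta> 1) (at 1 within {0..1})"
      using continuous_g by (auto simp: continuous_on_def)
    moreover have "at (0::real) within {0..1} = at_right 0"
      by (rule at_within_nhd[of 0 "{..<1}"]) auto
    moreover have "at (1::real) within {0..1} = at_left 1"
      by (rule at_within_nhd[of 1 "{0<..}"]) auto
    ultimately show ?case
      using AE_constrained_limit[OF sl] concave_g g0 g1
        concave_right_derivative_at_bot[OF concave_g continuous_g steep_at_1[OF sl g1]]
      by (intro conjI) auto
  next
    case (2 \<beta>)
    interpret disordered_renewal_tail \<mu> Kp \<beta> by (rule model[OF 2])
    obtain c where sl: "superadditive_limit mean_ln_pf c (g \<beta>)"
      using lim[OF 2] unfolding lim_def by blast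
    interpret superadditive_limit mean_ln_pf c "g \<beta>" by fact
    interpret weighted_variational "g \<beta>" H Q
      by (intro weighted_variational.intro variational.intro weighted_variational_axioms.intro
          concave_g continuous_g H_concave H_finite H_not_pinf H_cont Q_nonneg Q_upper Q_lower)
    show ?case
      using free_energy[OF sl weighted_variational_axioms] mono_f convex_f f_eq_SUP g_eq_INF
      by (intro conjI allI ballI impI)
  qed
qed

end
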